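(* Assume $k$ has characteristic $0$. Let $a/b$ be a non-negative rational number written in least common terms, so that $b$ is positive and $(a,b)=1$. Let $r$ be the constant function on $R$ with value $a/b$, and let $w\in W$. Then $\mathfrak t_w(\mathcal O)_r$ is non-empty if and only if $w$ is regular of order $b$.
   Context: Let $k$ be an algebraically closed field of characteristic $0$, $G$ a connected reductive group over $k$, $T\subset G$ a maximal torus, $\mathfrak t$ its Lie algebra, $R\subset X^*(T)$ the set of roots of $T$ in $G$, $W$ the Weyl group of $T$ in $G$. The differential of a root $\alpha$ is also denoted $\alpha\in\mathfrak t^*$; for a $k$-algebra $A$ put $\mathfrak t(A)=\mathfrak t\otimes_kA$ and extend $\alpha$ to an $A$-linear map $\mathfrak t(A)\to A$ and the $W$-action on $\mathfrak t$ to an $A$-linear action on $\mathfrak t(A)$. An element $w\in W$ is regular (in the sense of Springer) if there exists a non-zero eigenvector $u$ of $w$ in $\mathfrak t$ that is regular, in the sense that no root $\alpha\in R$ vanishes on $u$. Let $\mathcal O=k[[\epsilon]]$ and $F=k((\epsilon))$; fix an algebraic closure $\bar F$ of $F$, with the valuation $\mathrm{val}$ extending that of $F$, normalized by $\mathrm{val}(\epsilon)=1$. For positive integers $l$ choose compatibly $l$-th roots $\epsilon^{1/l}\in\bar F$ of $\epsilon$ (with $(\epsilon^{1/lm})^m=\epsilon^{1/l}$) and primitive $l$-th roots of unity $\zeta_l\in k$ (with $(\zeta_{lm})^m=\zeta_l$). For $w\in W$ of order $l$ put $\epsilon_E=\epsilon^{1/l}$, $E=k((\epsilon_E))$, $\mathcal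 O_E=k[[\epsilon_E]]$, and let $\tau_E$ be the automorphism of $E/F$ with $\tau_E(\epsilon_E)=\zeta_l\epsilon_E$, acting on $\mathfrak t(\mathcal O_E)$ through $\mathcal O_E$. Define $\mathfrak t_w(\mathcal O)=\{u\in\mathfrak t(\mathcal O_E): w\tau_E(u)=u\}$ and, for a function $r:R\to\mathbb Q_{\ge0}$, $\mathfrak t_w(\mathcal O)_r=\{u\in\mathfrak t_w(\mathcal O):\mathrm{val}\,\alpha(u)=r(\alpha)\ \forall\alpha\in R\}$.
   Formalization: The set of roots R is assumed non-empty: if G is a torus then R is empty, the valuation condition is void, and the set contains 0 for every a/b (e.g. 1/2) although w = 1 has order 1, so the statement fails there. *)

theory Defs
  imports
    "HOL-Analysis.Determinants"
    "HOL-Analysis.Abstract_Topology"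
    "HOL-Library.Extended_Real"
    "HOL-Algebra.Multiplicative_Group"
    "HOL-Computational_Algebra.Polynomial"
    "HOL-Computational_Algebra.Formal_Power_Series"
begin

section \<open>Linear algebraic groups\<close>

text \<open>Every linear algebraic group over an algebraically closed field \<open>k\<close> of characteristic 0 is a
  Zariski closed subgroup of some \<open>GL\<^sub>n(k)\<close>; groups are given in this form, identified with their
  sets of \<open>k\<close>-points.  The index type \<open>'n\<close> is arbitrary.\<close>

inductive_set poly_fun :: "('k::field ^ 'n ^ 'n \<Rightarrow> 'k) set" where
  const: "(\<lambda>_. c) \<in> poly_fun"
| coord: "(\<lambda>A. A $ i $ j) \<in> poly_fun"
| add: "p \<in> poly_fun \<Longrightarrow> q \<in> poly_fun \<Longrightarrow> (\<lambda>A. p A + q A) \<in> poly_fun"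
| mult: "p \<in> poly_fun \<Longrightarrow> q \<in> poly_fun \<Longrightarrow> (\<lambda>A. p A * q A) \<in> poly_fun"

definition zariski_open :: "('k::field ^ 'n ^ 'n) set \<Rightarrow> bool" where
  "zariski_open U \<longleftrightarrow> (\<exists>P \<subseteq> poly_fun. U = {A. \<exists>p\<in>P. p A \<noteq> 0})"

definition zariski :: "('k::field ^ 'n ^ 'n) topology" where
  "zariski = topology zariski_open"

lemma istopology_zariski_open: "istopology zariski_open"
  unfolding istopology_def
proof (intro conjI allI impI)
  fix S T :: "('k::field ^ 'n ^ 'n) set"
  assume "zariski_open S" "zariski_open T"
  then obtain P Q where P: "P \<subseteq> poly_fun" "S = {A. \<exists>p\<in>P. p A \<noteq> 0}"
    and Q: "Q \<subseteq> poly_fun" "T = {A. \<exists>p\<in>Q. p A \<noteq> 0}"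
    unfolding zariski_open_def by blast
  let ?R = "(\<lambda>(p, q) A. p A * q A) ` (P \<times> Q)"
  have "?R \<subseteq> poly_fun"
    using P(1) Q(1) by (auto intro!: poly_fun.mult)
  moreover have "S \<inter> T = {A. \<exists>p\<in>?R. p A \<noteq> 0}"
    unfolding P(2) Q(2) by fastforce
  ultimately show "zariski_open (S \<inter> T)"
    unfolding zariski_open_def by blast
next
  fix \<K> :: "('k::field ^ 'n ^ 'n) set set"
  assume *: "\<forall>K\<in>\<K>. zariski_open K"
  let ?R = "{p \<in> poly_fun. \<exists>K\<in>\<K>. \<forall>A. p A \<noteq> 0 \<longrightarrow> A \<in> K}"
  have "\<Union>\<K> = {A. \<exists>p\<in>?R. p A \<noteq> 0}"
  proof (intro equalityI subsetI)
    fix A assume "A \<in> \<Union>\<K>"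
    then obtain K where K: "K \<in> \<K>" "A \<in> K" by (rule UnionE)
    from * K(1) have "zariski_open K" by (rule bspec)
    then obtain P where P: "P \<subseteq> poly_fun" "K = {A. \<exists>p\<in>P. p A \<noteq> 0}"
      unfolding zariski_open_def by (elim exE conjE)
    from K(2) obtain p where p: "p \<in> P" "p A \<noteq> 0" unfolding P(2) by auto
    have "\<forall>A. p A \<noteq> 0 \<longrightarrow> A \<in> K" unfolding P(2) using p(1) by auto
    with K(1) P(1) p(1) have "p \<in> ?R" by auto
    with p(2) show "A \<in> {A. \<exists>p\<in>?R. p A \<noteq> 0}" by auto
  next
    fix A assume "A \<in> {A. \<exists>p\<in>?R. p A \<noteq> 0}"
    then show "A \<in> \<Union>\<K>" by auto
  qed
  then show "zariski_open (\<Union>\<K>)"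
    unfolding zariski_open_def by (intro exI[of _ ?R] conjI) auto
qed

lemma openin_zariski: "openin zariski U \<longleftrightarrow> zariski_open U"
  unfolding zariski_def by (simp add: topology_inverse' istopology_zariski_open)

definition GL :: "('k::field ^ 'n ^ 'n) monoid" where
  "GL = \<lparr>carrier = {A. invertible A}, mult = (**), one = mat 1\<rparr>"

definition algebraic_group :: "('k::field ^ 'n ^ 'n) set \<Rightarrow> bool" where
  "algebraic_group G \<longleftrightarrow>
     subgroup G GL \<and> closedin (subtopology zariski (carrier GL)) G"

definition matpow :: "'k::field ^ 'n ^ 'n \<Rightarrow> nat \<Rightarrow> 'k ^ 'n ^ 'n" where
  "matpow A m = (((**) A) ^^ m) (mat 1)"

definition unipotent :: "'k::field ^ 'n ^ 'n \<Rightarrow> bool" where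
  "unipotent A \<longleftrightarrow> (\<exists>m. matpow (A - mat 1) m = 0)"

text \<open>The second condition says that the unipotent radical, i.e. the largest closed connected
  normal unipotent subgroup, is trivial.\<close>

definition reductive :: "('k::field ^ 'n ^ 'n) set \<Rightarrow> bool" where
  "reductive G \<longleftrightarrow> algebraic_group G \<and>
     (\<forall>U. algebraic_group U \<and> connectedin zariski U \<and> U \<lhd> (GL\<lparr>carrier := G\<rparr>) \<and>
          (\<forall>A\<in>U. unipotent A) \<longrightarrow> U = {mat 1})"

definition connected_reductive :: "('k::field ^ 'n ^ 'n) set \<Rightarrow> bool" where
  "connected_reductive G \<longleftrightarrow> reductive G \<and> connectedin zariski G"

definition conj_by :: "'k::field ^ 'n ^ 'n \<Rightarrow> 'k ^ 'n ^ 'n \<Rightarrow> 'k ^ 'n ^ 'n" where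
  "conj_by g X = g ** X ** matrix_inv g"

definition diagonal_matrix :: "'k::field ^ 'n ^ 'n \<Rightarrow> bool" where
  "diagonal_matrix A \<longleftrightarrow> (\<forall>i j. i \<noteq> j \<longrightarrow> A $ i $ j = 0)"

text \<open>A torus is a connected diagonalizable algebraic group.\<close>

definition torus :: "('k::field ^ 'n ^ 'n) set \<Rightarrow> bool" where
  "torus T \<longleftrightarrow> algebraic_group T \<and> connectedin zariski T \<and>
     (\<exists>P. invertible P \<and> (\<forall>A\<in>T. diagonal_matrix (conj_by P A)))"

definition maximal_torus :: "('k::field ^ 'n ^ 'n) set \<Rightarrow> ('k ^ 'n ^ 'n) set \<Rightarrow> bool" where
  "maximal_torus T G \<longleftrightarrow> torus T \<and> T \<subseteq> G \<and>
     (\<forall>T'. torus T' \<and> T \<subseteq> T' \<and> T' \<subseteq> G \<longrightarrow> T' = T)"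


section \<open>Lie algebras, roots and the Weyl group\<close>

abbreviation smult_mat :: "'a::times \<Rightarrow> 'a ^ 'n ^ 'n \<Rightarrow> 'a ^ 'n ^ 'n" where
  "smult_mat c \<equiv> map_matrix ((*) c)"

text \<open>The derivative of a polynomial function at the identity in the direction \<open>X\<close>: the
  coefficient of \<open>s\<close> in \<open>p (1 + s X)\<close>, expanded as a polynomial in \<open>s\<close>.\<close>

definition dderiv :: "('k::field_char_0 ^ 'n ^ 'n \<Rightarrow> 'k) \<Rightarrow> 'k ^ 'n ^ 'n \<Rightarrow> 'k" where
  "dderiv p X = coeff (THE q. \<forall>s. poly q s = p (mat 1 + smult_mat s X)) 1"

lemma poly_fun_along_line:
  fixes p :: "'k::field_char_0 ^ 'n ^ 'n \<Rightarrow> 'k"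
  assumes "p \<in> poly_fun"
  shows "\<exists>!q. \<forall>s. poly q s = p (A + smult_mat s X)"
proof (rule ex_ex1I)
  show "\<exists>q. \<forall>s. poly q s = p (A + smult_mat s X)"
    using assms
  proof induction
    case (const c)
    show ?case by (rule exI[of _ "[:c:]"]) simp
  next
    case (coord i j)
    show ?case by (rule exI[of _ "[:A $ i $ j, X $ i $ j:]"]) simp
  next
    case (add p q)
    then show ?case by (metis poly_add)
  next
    case (mult p q)
    then show ?case by (metis poly_mult)
  qed
next
  fix q q'
  assume "\<forall>s. poly q s = p (A + smult_mat s X)" "\<forall>s. poly q' s = p (A + smult_mat s X)"
  then have "poly q = poly q'" by auto
  then show "q = q'" by (simp add: poly_eq_poly_eq_iff)
qed

definition lie_algebra :: "('k::field_char_0 ^ 'n ^ 'n) set \<Rightarrow> ('k ^ 'n ^ 'n) set" where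
  "lie_algebra G = {X. \<forall>p\<in>poly_fun. (\<forall>A\<in>G. p A = 0) \<longrightarrow> dderiv p X = 0}"

text \<open>Regular functions on a closed subgroup \<open>T\<close> of \<open>GL\<^sub>n\<close> are restrictions of \<open>p / det\<^sup>m\<close> with
  \<open>p\<close> polynomial.  A character is made independent of its values off \<open>T\<close> by extensionality, so
  that distinct functions are distinct characters.\<close>

definition regular_rep ::
    "('k::field_char_0 ^ 'n ^ 'n) set \<Rightarrow> ('k ^ 'n ^ 'n \<Rightarrow> 'k) \<Rightarrow> ('k ^ 'n ^ 'n \<Rightarrow> 'k) \<Rightarrow> nat \<Rightarrow> bool"
  where "regular_rep T f p m \<longleftrightarrow> p \<in> poly_fun \<and> (\<forall>A\<in>T. f A * det A ^ m = p A)"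

definition characters :: "('k::field_char_0 ^ 'n ^ 'n) set \<Rightarrow> ('k ^ 'n ^ 'n \<Rightarrow> 'k) set" where
  "characters T = {\<eta> \<in> extensional T.
     (\<exists>p m. regular_rep T \<eta> p m) \<and> (\<forall>A\<in>T. \<eta> A \<noteq> 0) \<and>
     (\<forall>A\<in>T. \<forall>B\<in>T. \<eta> (A ** B) = \<eta> A * \<eta> B)}"

text \<open>The differential at the identity of a character: apply the Leibniz rule to
  \<open>\<eta> \<cdot> det\<^sup>m = p\<close>, using \<open>det 1 = \<eta> 1 = 1\<close>.  For \<open>X\<close> in the Lie algebra of \<open>T\<close> the
  result does not depend on \<open>p\<close> and \<open>m\<close>.\<close>

definition differential ::
    "('k::field_char_0 ^ 'n ^ 'n) set \<Rightarrow> ('k ^ 'n ^ 'n \<Rightarrow> 'k) \<Rightarrow> 'k ^ 'n ^ 'n \<Rightarrow> 'k" where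
  "differential T \<eta> X =
     (THE d. \<exists>p m. regular_rep T \<eta> p m \<and> dderiv p X = d + dderiv (\<lambda>A. det A ^ m) X)"

definition weight_space ::
    "('k::field_char_0 ^ 'n ^ 'n) set \<Rightarrow> ('k ^ 'n ^ 'n) set \<Rightarrow> ('k ^ 'n ^ 'n \<Rightarrow> 'k) \<Rightarrow> ('k ^ 'n ^ 'n) set"
  where "weight_space G T \<eta> =
    {X \<in> lie_algebra G. \<forall>A\<in>T. conj_by A X = smult_mat (\<eta> A) X}"

definition roots ::
    "('k::field_char_0 ^ 'n ^ 'n) set \<Rightarrow> ('k ^ 'n ^ 'n) set \<Rightarrow> ('k ^ 'n ^ 'n \<Rightarrow> 'k) set" where
  "roots G T = {\<alpha> \<in> characters T. (\<exists>A\<in>T. \<alpha> A \<noteq> 1) \<and> (\<exists>X \<in> weight_space G T \<alpha>. X \<noteq> 0)}"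

definition torus_normalizer ::
    "('k::field ^ 'n ^ 'n) set \<Rightarrow> ('k ^ 'n ^ 'n) set \<Rightarrow> ('k ^ 'n ^ 'n) set" where
  "torus_normalizer G T = {g \<in> G. conj_by g ` T = T}"

definition torus_centralizer ::
    "('k::field ^ 'n ^ 'n) set \<Rightarrow> ('k ^ 'n ^ 'n) set \<Rightarrow> ('k ^ 'n ^ 'n) set" where
  "torus_centralizer G T = {g \<in> G. \<forall>A\<in>T. conj_by g A = A}"

definition weyl_group ::
    "('k::field ^ 'n ^ 'n) set \<Rightarrow> ('k ^ 'n ^ 'n) set \<Rightarrow> ('k ^ 'n ^ 'n) set monoid" where
  "weyl_group G T = (GL\<lparr>carrier := torus_normalizer G T\<rparr>) Mod (torus_centralizer G T)"

text \<open>The Weyl group acts on the Lie algebra of the torus through conjugation by any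
  representative; there the choice does not matter, since elements centralizing the torus also
  centralize its Lie algebra.\<close>

definition weyl_rep :: "('k::field ^ 'n ^ 'n) set \<Rightarrow> 'k ^ 'n ^ 'n" where
  "weyl_rep w = (SOME g. g \<in> w)"

definition weyl_act :: "('k::field ^ 'n ^ 'n) set \<Rightarrow> 'k ^ 'n ^ 'n \<Rightarrow> 'k ^ 'n ^ 'n" where
  "weyl_act w X = conj_by (weyl_rep w) X"

definition springer_regular ::
    "('k::field_char_0 ^ 'n ^ 'n) set \<Rightarrow> ('k ^ 'n ^ 'n) set \<Rightarrow> ('k ^ 'n ^ 'n) set \<Rightarrow> bool" where
  "springer_regular G T w \<longleftrightarrow>
     (\<exists>u \<in> lie_algebra T. u \<noteq> 0 \<and> (\<exists>c. weyl_act w u = smult_mat c u) \<and>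
        (\<forall>\<alpha> \<in> roots G T. differential T \<alpha> u \<noteq> 0))"


section \<open>Extension of scalars to \<open>k[[\<epsilon>\<^sub>E]]\<close>\<close>

text \<open>With \<open>l\<close> the order of \<open>w\<close> and \<open>\<epsilon>\<^sub>E = \<epsilon>\<^bsup>1/l\<^esup>\<close>, the ring \<open>k[[\<epsilon>\<^sub>E]]\<close> is the type \<open>'k fps\<close>
  with \<open>\<epsilon>\<^sub>E\<close> as \<open>fps_X\<close>; the subring \<open>k[[\<epsilon>]]\<close> consists of the series in \<open>fps_X ^ l\<close>.
  All valuations below are of elements of \<open>k[[\<epsilon>\<^sub>E]]\<close>, so only the restriction of \<open>val\<close> to
  this ring is needed; it is normalized by \<open>val \<epsilon> = 1\<close>.\<close>

definition val_E :: "nat \<Rightarrow> 'k::field fps \<Rightarrow> ereal" where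
  "val_E l f = (if f = 0 then \<infinity> else ereal (real (subdegree f) / real l))"

lemma val_E_uniformizer: "l > 0 \<Longrightarrow> val_E l ((fps_X :: 'k::field fps) ^ l) = 1"
  by (simp add: val_E_def)

text \<open>For a subspace \<open>V\<close> of matrices, the tensor product of \<open>V\<close> with \<open>k[[\<epsilon>\<^sub>E]]\<close> embeds into the
  matrices over \<open>k[[\<epsilon>\<^sub>E]]\<close>; its image is the \<open>k[[\<epsilon>\<^sub>E]]\<close>-span of \<open>V\<close>.\<close>

definition extend_scalars :: "('k::field ^ 'n ^ 'n) set \<Rightarrow> ('k fps ^ 'n ^ 'n) set" where
  "extend_scalars V =
     {U. \<exists>S c. finite S \<and> S \<subseteq> V \<and> U = (\<Sum>X\<in>S. smult_mat (c X) (map_matrix fps_const X))}"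

text \<open>The linear extension of a functional, computed coefficientwise.\<close>

definition extend_functional ::
    "('k::field ^ 'n ^ 'n \<Rightarrow> 'k) \<Rightarrow> 'k fps ^ 'n ^ 'n \<Rightarrow> 'k fps" where
  "extend_functional \<phi> U = Abs_fps (\<lambda>m. \<phi> (map_matrix (\<lambda>f. fps_nth f m) U))"

lemma extend_functional_sum:
  fixes \<phi> :: "'k::field ^ 'n ^ 'n \<Rightarrow> 'k"
  assumes V: "0 \<in> V" "\<And>X Y. X \<in> V \<Longrightarrow> Y \<in> V \<Longrightarrow> X + Y \<in> V" "\<And>a X. X \<in> V \<Longrightarrow> smult_mat a X \<in> V"
    and \<phi>: "\<And>X Y. X \<in> V \<Longrightarrow> Y \<in> V \<Longrightarrow> \<phi> (X + Y) = \<phi> X + \<phi> Y"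
      "\<And>a X. X \<in> V \<Longrightarrow> \<phi> (smult_mat a X) = a * \<phi> X"
    and S: "finite S" "S \<subseteq> V"
  shows "extend_functional \<phi> (\<Sum>X\<in>S. smult_mat (c X) (map_matrix fps_const X)) =
    (\<Sum>X\<in>S. c X * fps_const (\<phi> X))"
proof (rule fps_ext)
  fix m
  have "(\<Sum>X\<in>S. smult_mat (fps_nth (c X) m) X) \<in> V \<and>
      \<phi> (\<Sum>X\<in>S. smult_mat (fps_nth (c X) m) X) = (\<Sum>X\<in>S. fps_nth (c X) m * \<phi> X)"
    using S
  proof induction
    case empty
    have "\<phi> (smult_mat 0 0) = 0" using \<phi>(2)[OF V(1), of 0] by simp
    moreover have "smult_mat 0 (0 :: 'k ^ 'n ^ 'n) = 0" by (simp add: vec_eq_iff)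
    ultimately show ?case using V(1) by simp
  next
    case (insert X S)
    then have IH: "(\<Sum>X\<in>S. smult_mat (fps_nth (c X) m) X) \<in> V"
        "\<phi> (\<Sum>X\<in>S. smult_mat (fps_nth (c X) m) X) = (\<Sum>X\<in>S. fps_nth (c X) m * \<phi> X)"
      and X: "X \<in> V"
      by auto
    show ?case
      using V(2)[OF V(3)[OF X] IH(1)] \<phi>(1)[OF V(3)[OF X] IH(1)] \<phi>(2)[OF X] IH(2) insert(1,2)
      by (simp only: sum.insert simp_thms)
  qed
  moreover have "map_matrix (\<lambda>f. fps_nth f m)
      (\<Sum>X\<in>S. smult_mat (c X) (map_matrix fps_const X)) = (\<Sum>X\<in>S. smult_mat (fps_nth (c X) m) X)"
    by (simp add: vec_eq_iff fps_sum_nth)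
  ultimately show "fps_nth (extend_functional \<phi>
      (\<Sum>X\<in>S. smult_mat (c X) (map_matrix fps_const X))) m = fps_nth (\<Sum>X\<in>S. c X * fps_const (\<phi> X)) m"
    by (simp add: extend_functional_def fps_sum_nth)
qed

definition weyl_act_E :: "('k::field ^ 'n ^ 'n) set \<Rightarrow> 'k fps ^ 'n ^ 'n \<Rightarrow> 'k fps ^ 'n ^ 'n" where
  "weyl_act_E w U = map_matrix fps_const (weyl_rep w) ** U **
     map_matrix fps_const (matrix_inv (weyl_rep w))"

text \<open>\<open>\<tau>\<^sub>E\<close> substitutes \<open>z \<epsilon>\<^sub>E\<close> for \<open>\<epsilon>\<^sub>E\<close>; below \<open>z\<close> is the chosen primitive root of unity.\<close>

definition tau_E :: "'k::field \<Rightarrow> 'k fps \<Rightarrow> 'k fps" where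
  "tau_E z f = fps_compose f (fps_const z * fps_X)"

definition compatible_roots_of_unity :: "(nat \<Rightarrow> 'k::field) \<Rightarrow> bool" where
  "compatible_roots_of_unity \<zeta> \<longleftrightarrow>
     (\<forall>l>0. \<zeta> l ^ l = 1 \<and> (\<forall>j. 0 < j \<and> j < l \<longrightarrow> \<zeta> l ^ j \<noteq> 1)) \<and>
     (\<forall>l>0. \<forall>m>0. \<zeta> (l * m) ^ m = \<zeta> l)"

definition t_w ::
    "(nat \<Rightarrow> 'k::field_char_0) \<Rightarrow> ('k ^ 'n ^ 'n) set \<Rightarrow> ('k ^ 'n ^ 'n) set \<Rightarrow> ('k ^ 'n ^ 'n) set \<Rightarrow>
     ('k fps ^ 'n ^ 'n) set" where
  "t_w \<zeta> G T w = {u \<in> extend_scalars (lie_algebra T).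
     weyl_act_E w (map_matrix (tau_E (\<zeta> (group.ord (weyl_group G T) w))) u) = u}"

definition t_w_stratum ::
    "(nat \<Rightarrow> 'k::field_char_0) \<Rightarrow> ('k ^ 'n ^ 'n) set \<Rightarrow> ('k ^ 'n ^ 'n) set \<Rightarrow> ('k ^ 'n ^ 'n) set \<Rightarrow>
     (('k ^ 'n ^ 'n \<Rightarrow> 'k) \<Rightarrow> rat) \<Rightarrow> ('k fps ^ 'n ^ 'n) set" where
  "t_w_stratum \<zeta> G T w r = {u \<in> t_w \<zeta> G T w. \<forall>\<alpha> \<in> roots G T.
     val_E (group.ord (weyl_group G T) w) (extend_functional (differential T \<alpha>) u)
       = ereal (of_rat (r \<alpha>))}"

end

theory Submission
  imports Defs
    "HOL-Library.Function_Algebras"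
    "HOL-Computational_Algebra.Primes"
    "HOL-Combinatorics.Cycles"
begin

text \<open>Let \<open>l\<close> be the order of \<open>w\<close> and write an element of \<open>\<tt>(\<O>\<^sub>E)\<close> as a power series
  \<open>u = \<Sum>\<^sub>j u\<^sub>j \<epsilon>\<^sub>E\<^sup>j\<close> with coefficients in \<open>\<tt>\<close>.  The condition \<open>w \<tau>\<^sub>E(u) = u\<close> says that \<open>w u\<^sub>j = z\<^sup>-\<^sup>j u\<^sub>j\<close>
  for all \<open>j\<close>, where \<open>z\<close> is the chosen primitive \<open>l\<close>-th root of unity.  That \<open>val \<alpha>(u) = a/b\<close> for all
  roots says that no root vanishes on \<open>u\<^sub>j\<close> for \<open>j = l a / b\<close>, while all roots vanish on the earlier
  coefficients.  So a point of the stratum gives a regular eigenvector of \<open>w\<close> with eigenvalue \<open>z\<^sup>-\<^sup>j\<close>,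
  and conversely such an eigenvector \<open>v\<close> gives the point \<open>v \<epsilon>\<^sub>E\<^sup>j\<close>.  What remains is covered by two
  theorems of Springer: the order of \<open>w\<close> is the order of the eigenvalue at any regular eigenvector
  (\<open>regular_eigenvalue_primitive\<close>), and if one primitive root of unity occurs as such an
  eigenvalue, then so do all primitive roots of unity of the same order
  (\<open>regular_eigenvector_conjugate\<close>).

  The first theorem amounts to the statement that an element \<open>g\<close> of the connected group \<open>G\<close> that
  fixes a regular element \<open>u\<close> of \<open>\<tt>\<close> centralizes \<open>T\<close> (\<open>centralizer_of_regular\<close>).  Diagonalize
  \<open>T\<close> and grade the coordinates by a rational valued additive function of the eigenvalues of
  \<open>u\<close>, so that every root has a nonzero degree.  If \<open>g\<close> does not commute with \<open>t \<in> T\<close>, there is a minor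
  \<open>f\<close> with \<open>f(g) \<noteq> 0\<close> that is an eigenfunction of the conjugation by \<open>t\<close> with an eigenvalue other
  than 1, and that is invariant under the unipotent matrices of positive degree on the right and
  of negative degree on the left.  The leading term at the identity of such a function on \<open>G\<close>
  would be a polynomial on the part of degree 0 of the Lie algebra of \<open>G\<close>, on which \<open>t\<close> acts
  trivially; hence \<open>f\<close> vanishes on \<open>G\<close> to infinite order at the identity
  (\<open>graded_invariants_vanish\<close>).  By Krull's intersection theorem \<open>f\<close> vanishes on \<open>G\<close> near the identity,
  and then everywhere, because a connected group is irreducible (\<open>connected_group_irreducible\<close>).
  This contradicts \<open>f(g) \<noteq> 0\<close>.

  For the second theorem one would like to apply a field automorphism that maps one primitive root
  of unity to the other to the coordinates of a regular eigenvector.  Additive maps from the field to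
  itself that are only equivariant for multiplication by these roots of unity are good enough
  and easy to construct from the irreducibility of the cyclotomic polynomials
  (\<open>exists_equivariant_additive\<close>); they preserve \<open>\<tt>\<close>, because it is defined by linear equations with
  integral coefficients (\<open>additive_map_preserves_lie_T\<close>).\<close>

section \<open>Noetherian rings\<close>

definition subring :: "'a::comm_ring_1 set \<Rightarrow> bool" where
  "subring R \<longleftrightarrow> 1 \<in> R \<and> (\<forall>x\<in>R. \<forall>y\<in>R. x - y \<in> R \<and> x * y \<in> R)"

definition ideal_of :: "'a::comm_ring_1 set \<Rightarrow> 'a set \<Rightarrow> bool" where
  "ideal_of R I \<longleftrightarrow> I \<subseteq> R \<and> 0 \<in> I \<and> (\<forall>x\<in>I. \<forall>y\<in>I. x + y \<in> I) \<and> (\<forall>r\<in>R. \<forall>x\<in>I. r * x \<in> I)"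

definition noetherian :: "'a::comm_ring_1 set \<Rightarrow> bool" where
  "noetherian R \<longleftrightarrow> wf {(J, I). ideal_of R I \<and> ideal_of R J \<and> I \<subset> J}"

lemma subringD:
  assumes "subring R"
  shows "1 \<in> R" "0 \<in> R" "x \<in> R \<Longrightarrow> y \<in> R \<Longrightarrow> x - y \<in> R" "x \<in> R \<Longrightarrow> y \<in> R \<Longrightarrow> x * y \<in> R"
    "x \<in> R \<Longrightarrow> - x \<in> R" "x \<in> R \<Longrightarrow> y \<in> R \<Longrightarrow> x + y \<in> R" "x \<in> R \<Longrightarrow> x ^ n \<in> R"
proof -
  show 1: "1 \<in> R" and 2: "\<And>x y. x \<in> R \<Longrightarrow> y \<in> R \<Longrightarrow> x - y \<in> R" and
    3: "\<And>x y. x \<in> R \<Longrightarrow> y \<in> R \<Longrightarrow> x * y \<in> R"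
    using assms by (auto simp: subring_def)
  show 0: "0 \<in> R" using 2[OF 1 1] by simp
  show 4: "- x \<in> R" if "x \<in> R" for x using 2[OF 0 that] by simp
  show "x + y \<in> R" if "x \<in> R" "y \<in> R" for x y using 2[OF that(1) 4[OF that(2)]] by simp
  show "x ^ n \<in> R" if "x \<in> R" using that by (induction n) (auto intro: 1 3)
qed

lemma ideal_ofD:
  assumes "ideal_of R I"
  shows "x \<in> I \<Longrightarrow> x \<in> R" "0 \<in> I" "x \<in> I \<Longrightarrow> y \<in> I \<Longrightarrow> x + y \<in> I"
    "r \<in> R \<Longrightarrow> x \<in> I \<Longrightarrow> r * x \<in> I" "r \<in> R \<Longrightarrow> x \<in> I \<Longrightarrow> x * r \<in> I"
  using assms by (auto simp: ideal_of_def mult.commute)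

lemma ideal_of_diff:
  assumes "ideal_of R I" "subring R" "x \<in> I" "y \<in> I" shows "x - y \<in> I"
  using ideal_ofD(3)[OF assms(1,3) ideal_ofD(4)[OF assms(1) subringD(5)[OF assms(2) subringD(1)[OF assms(2)]] assms(4)]]
  by simp

lemma ideal_of_sum:
  assumes "ideal_of R I" "\<And>a. a \<in> A \<Longrightarrow> f a \<in> I" shows "(\<Sum>a\<in>A. f a) \<in> I"
  using assms(2) by (induction A rule: infinite_finite_induct) (auto intro: ideal_ofD[OF assms(1)])

lemma noetherian_chain:
  assumes "noetherian R" "\<And>n. ideal_of R (I n)" "\<And>n. I n \<subseteq> I (Suc n)"
  shows "\<exists>N. \<forall>n\<ge>N. I n = I N"
proof -
  from assms(1) have wf: "wf {(J, I). ideal_of R I \<and> ideal_of R J \<and> I \<subset> J}" by (simp add: noetherian_def)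
  obtain X where X: "X \<in> range I" "\<And>Y. (Y, X) \<in> {(J, I). ideal_of R I \<and> ideal_of R J \<and> I \<subset> J} \<Longrightarrow> Y \<notin> range I"
    by (rule wfE_min[OF wf, of "I 0" "range I"]) auto
  then obtain N where N: "X = I N" by auto
  have "I n = I N" if "n \<ge> N" for n
  proof -
    have "I N \<subseteq> I n" by (rule lift_Suc_mono_le[of I, OF _ that]) (rule assms(3))
    then show ?thesis using X(2)[of "I n"] N assms(2) by auto
  qed
  then show ?thesis by blast
qed

lemma noetherianI_chain:
  assumes "\<And>I. (\<And>n. ideal_of R (I n)) \<Longrightarrow> (\<And>n::nat. I n \<subseteq> I (Suc n)) \<Longrightarrow> \<exists>N. I (Suc N) = I N"
  shows "noetherian R"
  unfolding noetherian_def wf_iff_no_infinite_down_chain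
proof
  assume "\<exists>I. \<forall>i. (I (Suc i), I i) \<in> {(J, I). ideal_of R I \<and> ideal_of R J \<and> I \<subset> J}"
  then obtain I where "\<forall>i::nat. (I (Suc i), I i) \<in> {(J, I). ideal_of R I \<and> ideal_of R J \<and> I \<subset> J}" ..
  then have I: "ideal_of R (I i)" "I i \<subset> I (Suc i)" for i by auto
  show False using assms[of I] I by blast
qed

primrec deg_less :: "'a::comm_ring_1 set \<Rightarrow> 'a \<Rightarrow> nat \<Rightarrow> 'a set" where
  "deg_less R x 0 = {0}"
| "deg_less R x (Suc d) = {a * x ^ d + y | a y. a \<in> R \<and> y \<in> deg_less R x d}"

definition adjoin :: "'a::comm_ring_1 set \<Rightarrow> 'a \<Rightarrow> 'a set" where
  "adjoin R x = (\<Union>d. deg_less R x d)"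

definition leading_coeffs :: "'a::comm_ring_1 set \<Rightarrow> 'a \<Rightarrow> nat \<Rightarrow> 'a set \<Rightarrow> 'a set" where
  "leading_coeffs R x d I = {a \<in> R. \<exists>y\<in>deg_less R x d. a * x ^ d + y \<in> I}"

context
  fixes R :: "'a::comm_ring_1 set" and x :: 'a
  assumes R: "subring R"
begin

lemma deg_less_zero: "0 \<in> deg_less R x d"
proof (induction d)
  case (Suc d)
  have "0 = 0 * x ^ d + 0" by simp
  with Suc subringD(2)[OF R] show ?case unfolding deg_less.simps by blast
qed simp

lemma deg_less_mono: "d \<le> e \<Longrightarrow> deg_less R x d \<subseteq> deg_less R x e"
proof (rule lift_Suc_mono_le)
  fix d
  show "deg_less R x d \<subseteq> deg_less R x (Suc d)"
  proof
    fix y assume "y \<in> deg_less R x d"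
    moreover have "y = 0 * x ^ d + y" by simp
    ultimately show "y \<in> deg_less R x (Suc d)"
      unfolding deg_less.simps using subringD(2)[OF R] by blast
  qed
qed

lemma deg_less_add: "y \<in> deg_less R x d \<Longrightarrow> z \<in> deg_less R x d \<Longrightarrow> y + z \<in> deg_less R x d"
proof (induction d arbitrary: y z)
  case (Suc d)
  then obtain a y' b z' where "a \<in> R" "b \<in> R" "y' \<in> deg_less R x d" "z' \<in> deg_less R x d"
    "y = a * x ^ d + y'" "z = b * x ^ d + z'" by auto
  moreover then have "y + z = (a + b) * x ^ d + (y' + z')" by (simp add: algebra_simps)
  ultimately show ?case unfolding deg_less.simps using Suc.IH subringD(6)[OF R] by blast
qed simp

lemma deg_less_smult: "r \<in> R \<Longrightarrow> y \<in> deg_less R x d \<Longrightarrow> r * y \<in> deg_less R x d"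
proof (induction d arbitrary: y)
  case (Suc d)
  then obtain a y' where "a \<in> R" "y' \<in> deg_less R x d" "y = a * x ^ d + y'" by auto
  moreover then have "r * y = (r * a) * x ^ d + r * y'" by (simp add: algebra_simps)
  ultimately show ?case unfolding deg_less.simps using Suc.IH Suc.prems(1) subringD(4)[OF R] by blast
qed simp

lemma deg_less_times_x: "y \<in> deg_less R x d \<Longrightarrow> x * y \<in> deg_less R x (Suc d)"
proof (induction d arbitrary: y)
  case 0
  then show ?case using deg_less_zero[of "Suc 0"] by simp
next
  case (Suc d)
  then obtain a y' where "a \<in> R" "y' \<in> deg_less R x d" "y = a * x ^ d + y'" by auto
  moreover then have "x * y = a * x ^ Suc d + x * y'" by (simp add: algebra_simps)
  ultimately show ?case unfolding deg_less.simps(2)[of R x "Suc d"] using Suc.IH by blast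
qed

lemma adjoin_add: "y \<in> adjoin R x \<Longrightarrow> z \<in> adjoin R x \<Longrightarrow> y + z \<in> adjoin R x"
proof -
  assume "y \<in> adjoin R x" "z \<in> adjoin R x"
  then obtain d e where "y \<in> deg_less R x d" "z \<in> deg_less R x e" by (auto simp: adjoin_def)
  then have "y \<in> deg_less R x (max d e)" "z \<in> deg_less R x (max d e)"
    using deg_less_mono by (meson max.cobounded1 max.cobounded2 subsetD)+
  from deg_less_add[OF this] show ?thesis by (auto simp: adjoin_def)
qed

lemma adjoin_smult: "r \<in> R \<Longrightarrow> z \<in> adjoin R x \<Longrightarrow> r * z \<in> adjoin R x"
  using deg_less_smult by (auto simp: adjoin_def)

lemma adjoin_power_times: "z \<in> adjoin R x \<Longrightarrow> x ^ d * z \<in> adjoin R x"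
proof (induction d)
  case (Suc d)
  then show ?case using deg_less_times_x unfolding adjoin_def UN_iff power_Suc mult.assoc by (metis UNIV_I)
qed simp

lemma adjoin_mult: "y \<in> adjoin R x \<Longrightarrow> z \<in> adjoin R x \<Longrightarrow> y * z \<in> adjoin R x"
proof -
  have "y \<in> deg_less R x d \<Longrightarrow> z \<in> adjoin R x \<Longrightarrow> y * z \<in> adjoin R x" for d y
  proof (induction d arbitrary: y)
    case 0
    then show ?case using deg_less_zero by (auto simp: adjoin_def)
  next
    case (Suc d)
    then obtain a y' where a: "a \<in> R" "y' \<in> deg_less R x d" "y = a * x ^ d + y'" by auto
    have "y * z = a * (x ^ d * z) + y' * z" by (simp add: a algebra_simps)
    then show ?case using Suc a adjoin_smult adjoin_power_times adjoin_add by simp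
  qed
  then show "y \<in> adjoin R x \<Longrightarrow> z \<in> adjoin R x \<Longrightarrow> y * z \<in> adjoin R x" by (auto simp: adjoin_def)
qed

lemma adjoin_base: "r \<in> R \<Longrightarrow> r \<in> adjoin R x"
proof -
  assume "r \<in> R"
  moreover have "r = r * x ^ 0 + 0" by simp
  ultimately have "r \<in> deg_less R x (Suc 0)" unfolding deg_less.simps by blast
  then show ?thesis unfolding adjoin_def by blast
qed

lemma adjoin_gen: "x \<in> adjoin R x"
  using adjoin_power_times[of 1 1] adjoin_base subringD(1)[OF R] by simp

lemma subring_adjoin: "subring (adjoin R x)"
proof -
  have "y - z \<in> adjoin R x" if "y \<in> adjoin R x" "z \<in> adjoin R x" for y z
    using adjoin_add[OF that(1) adjoin_smult[OF _ that(2), of "-1"]] subringD(1,5)[OF R] by simp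
  then show ?thesis unfolding subring_def using adjoin_base adjoin_mult subringD(1)[OF R] by blast
qed

lemma ideal_of_leading_coeffs:
  assumes I: "ideal_of (adjoin R x) I"
  shows "ideal_of R (leading_coeffs R x d I)"
proof -
  have "a + b \<in> leading_coeffs R x d I"
    if "a \<in> leading_coeffs R x d I" "b \<in> leading_coeffs R x d I" for a b
  proof -
    from that obtain y z where "a \<in> R" "b \<in> R" "y \<in> deg_less R x d" "a * x ^ d + y \<in> I"
      "z \<in> deg_less R x d" "b * x ^ d + z \<in> I" by (auto simp: leading_coeffs_def)
    moreover then have "(a + b) * x ^ d + (y + z) \<in> I"
      using ideal_ofD(3)[OF I, of "a * x ^ d + y" "b * x ^ d + z"] by (simp add: algebra_simps)
    ultimately show ?thesis
      using deg_less_add subringD(6)[OF R] unfolding leading_coeffs_def by blast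
  qed
  moreover have "r * a \<in> leading_coeffs R x d I"
    if "r \<in> R" "a \<in> leading_coeffs R x d I" for r a
  proof -
    from that obtain y where "a \<in> R" "y \<in> deg_less R x d" "a * x ^ d + y \<in> I"
      by (auto simp: leading_coeffs_def)
    moreover then have "(r * a) * x ^ d + r * y \<in> I"
      using ideal_ofD(4)[OF I adjoin_base[OF that(1)], of "a * x ^ d + y"] by (simp add: algebra_simps)
    ultimately show ?thesis
      using that(1) deg_less_smult subringD(4)[OF R] unfolding leading_coeffs_def by blast
  qed
  moreover have "0 * x ^ d + 0 \<in> I" using ideal_ofD(2)[OF I] by simp
  then have "0 \<in> leading_coeffs R x d I"
    unfolding leading_coeffs_def using deg_less_zero subringD(2)[OF R] by blast
  ultimately show ?thesis by (auto simp: ideal_of_def leading_coeffs_def)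
qed

lemma leading_coeffs_mono:
  assumes I: "ideal_of (adjoin R x) I" and "I \<subseteq> J" and "d \<le> e"
  shows "leading_coeffs R x d I \<subseteq> leading_coeffs R x e J"
proof -
  have "leading_coeffs R x d I \<subseteq> leading_coeffs R x e I"
  proof (rule lift_Suc_mono_le[OF _ \<open>d \<le> e\<close>], rule subsetI)
    fix d a assume "a \<in> leading_coeffs R x d I"
    then obtain y where "a \<in> R" "y \<in> deg_less R x d" "a * x ^ d + y \<in> I" by (auto simp: leading_coeffs_def)
    moreover then have "a * x ^ Suc d + x * y \<in> I"
      using ideal_ofD(4)[OF I adjoin_gen, of "a * x ^ d + y"] by (simp add: algebra_simps)
    ultimately show "a \<in> leading_coeffs R x (Suc d) I"
      unfolding leading_coeffs_def using deg_less_times_x by blast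
  qed
  then show ?thesis using \<open>I \<subseteq> J\<close> by (fastforce simp: leading_coeffs_def)
qed

lemma ideal_eq_if_leading_coeffs_eq:
  assumes I: "ideal_of (adjoin R x) I" and J: "ideal_of (adjoin R x) J" and "I \<subseteq> J"
    and eq: "\<And>d. leading_coeffs R x d J \<subseteq> leading_coeffs R x d I"
  shows "I = J"
proof -
  have "z \<in> J \<Longrightarrow> z \<in> deg_less R x d \<Longrightarrow> z \<in> I" for z d
  proof (induction d arbitrary: z)
    case 0
    then show ?case using ideal_ofD(2)[OF I] by simp
  next
    case (Suc d)
    then obtain a y where a: "a \<in> R" "y \<in> deg_less R x d" "z = a * x ^ d + y" by auto
    with Suc.prems(1) have "a \<in> leading_coeffs R x d J" unfolding leading_coeffs_def by blast
    with eq have "a \<in> leading_coeffs R x d I" by blast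
    then obtain y' where y': "y' \<in> deg_less R x d" "a * x ^ d + y' \<in> I" by (auto simp: leading_coeffs_def)
    let ?v = "a * x ^ d + y'"
    have "z - ?v \<in> J"
      using ideal_of_diff[OF J subring_adjoin] Suc.prems(1) y'(2) \<open>I \<subseteq> J\<close> by blast
    moreover have eq': "z - ?v = y + (- 1) * y'" using a by simp
    have "z - ?v \<in> deg_less R x d"
      unfolding eq' by (intro deg_less_add[OF a(2) deg_less_smult[OF _ y'(1)]] subringD(1,5)[OF R])
    ultimately have "z - ?v \<in> I" by (rule Suc.IH)
    from ideal_ofD(3)[OF I this y'(2)] show ?case by simp
  qed
  then show ?thesis using \<open>I \<subseteq> J\<close> ideal_ofD(1)[OF J] unfolding adjoin_def by blast
qed

text \<open>This is Hilbert's basis theorem.  A chain of ideals of \<open>R[x]\<close> is controlled by its ideals of leading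
  coefficients: these stabilize along the diagonal, which settles all large degrees at once, and
  then separately in each of the finitely many remaining degrees.\<close>

lemma noetherian_adjoin:
  assumes "noetherian R"
  shows "noetherian (adjoin R x)"
proof (rule noetherianI_chain)
  fix I assume I: "\<And>n. ideal_of (adjoin R x) (I n)" and inc: "\<And>n::nat. I n \<subseteq> I (Suc n)"
  let ?L = "\<lambda>d n. leading_coeffs R x d (I n)"
  have mono: "?L d n \<subseteq> ?L e m" if "d \<le> e" "n \<le> m" for d e n m
    by (rule leading_coeffs_mono[OF I lift_Suc_mono_le[of I, OF inc that(2)] that(1)])
  have L: "ideal_of R (?L d n)" for d n by (rule ideal_of_leading_coeffs[OF I])
  have "?L n n \<subseteq> ?L (Suc n) (Suc n)" for n by (rule mono) simp_all
  from noetherian_chain[of R "\<lambda>n. ?L n n", OF assms L this]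
  obtain M where M: "\<forall>n\<ge>M. ?L n n = ?L M M" ..
  have "\<exists>N. \<forall>n\<ge>N. ?L d n = ?L d N" for d
  proof -
    have "?L d n \<subseteq> ?L d (Suc n)" for n by (rule mono) simp_all
    from noetherian_chain[of R "\<lambda>n. ?L d n", OF assms L this] show ?thesis .
  qed
  then have "\<forall>d. \<exists>N. \<forall>n\<ge>N. ?L d n = ?L d N" ..
  from choice[OF this] obtain N where N: "\<forall>d. \<forall>n\<ge>N d. ?L d n = ?L d (N d)" ..
  define K where "K = Max (insert M (N ` {..<M}))"
  have K: "M \<le> K" "d < M \<Longrightarrow> N d \<le> K" for d
    unfolding K_def by (auto intro!: Max_ge)
  have "I K = I (Suc K)"
  proof (rule ideal_eq_if_leading_coeffs_eq[OF I I inc])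
    fix d
    show "?L d (Suc K) \<subseteq> ?L d K"
    proof (cases "d < M")
      case True
      then have "N d \<le> K" "N d \<le> Suc K" using K(2)[of d] by auto
      then have "?L d (Suc K) = ?L d (N d)" "?L d K = ?L d (N d)" using N by blast+
      then show ?thesis by simp
    next
      case False
      have "?L d (Suc K) \<subseteq> ?L (max d (Suc K)) (max d (Suc K))" by (rule mono) auto
      also have "\<dots> = ?L M M" using K False by (intro M[rule_format]) auto
      also have "\<dots> \<subseteq> ?L d K" using K False by (intro mono) auto
      finally show ?thesis .
    qed
  qed
  then show "\<exists>N. I (Suc N) = I N" by metis
qed

end

text \<open>The ideal \<open>\<mm>\<^sup>i + I\<close>, where \<open>\<mm>\<close> is generated by \<open>B\<close>.  The inductive form is made for proofs that
  a derivation respects these ideals.\<close>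

inductive in_ideal_power :: "'a::comm_ring_1 set \<Rightarrow> 'a set \<Rightarrow> 'a set \<Rightarrow> nat \<Rightarrow> 'a \<Rightarrow> bool"
  for R B I where
  base: "p \<in> R \<Longrightarrow> in_ideal_power R B I 0 p"
| ideal: "p \<in> I \<Longrightarrow> in_ideal_power R B I i p"
| gen: "b \<in> B \<Longrightarrow> in_ideal_power R B I i p \<Longrightarrow> in_ideal_power R B I (Suc i) (b * p)"
| add: "in_ideal_power R B I i p \<Longrightarrow> in_ideal_power R B I i q \<Longrightarrow> in_ideal_power R B I i (p + q)"

definition ideal_power :: "'a::comm_ring_1 set \<Rightarrow> 'a set \<Rightarrow> 'a set \<Rightarrow> nat \<Rightarrow> 'a set" where
  "ideal_power R B I i = {p. in_ideal_power R B I i p}"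

lemma ideal_power_base: "p \<in> R \<Longrightarrow> p \<in> ideal_power R B I 0"
  and ideal_power_ideal: "p \<in> I \<Longrightarrow> p \<in> ideal_power R B I i"
  and ideal_power_gen: "b \<in> B \<Longrightarrow> p \<in> ideal_power R B I i \<Longrightarrow> b * p \<in> ideal_power R B I (Suc i)"
  and ideal_power_add: "p \<in> ideal_power R B I i \<Longrightarrow> q \<in> ideal_power R B I i \<Longrightarrow> p + q \<in> ideal_power R B I i"
  by (simp_all add: ideal_power_def in_ideal_power.intros)

lemmas ideal_power_intros = ideal_power_base ideal_power_ideal ideal_power_gen ideal_power_add

lemma ideal_power_induct [consumes 1, case_names base ideal gen add]:
  assumes "p \<in> ideal_power R B I i"
    and "\<And>p. p \<in> R \<Longrightarrow> P 0 p" and "\<And>p i. p \<in> I \<Longrightarrow> P i p"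
    and "\<And>b p i. b \<in> B \<Longrightarrow> p \<in> ideal_power R B I i \<Longrightarrow> P i p \<Longrightarrow> P (Suc i) (b * p)"
    and "\<And>p i q. p \<in> ideal_power R B I i \<Longrightarrow> P i p \<Longrightarrow> q \<in> ideal_power R B I i \<Longrightarrow> P i q \<Longrightarrow> P i (p + q)"
  shows "P i p"
  using assms(1) unfolding ideal_power_def mem_Collect_eq
  by (induction rule: in_ideal_power.induct) (use assms(2-) in \<open>auto simp: ideal_power_def\<close>)

context
  fixes R B I :: "'a::comm_ring_1 set"
  assumes R: "subring R" and B: "B \<subseteq> R" and I: "ideal_of R I"
begin

lemma ideal_power_closed: "p \<in> ideal_power R B I i \<Longrightarrow> p \<in> R"
  by (induction rule: ideal_power_induct) (use B in \<open>auto intro: ideal_ofD(1)[OF I] subringD[OF R]\<close>)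

lemma ideal_power_mult: "p \<in> ideal_power R B I i \<Longrightarrow> r \<in> R \<Longrightarrow> r * p \<in> ideal_power R B I i"
proof (induction rule: ideal_power_induct)
  case (gen b p i)
  then show ?case using ideal_power_gen[of b B "r * p" R I i] by (simp add: mult.left_commute)
qed (auto intro: ideal_power_intros ideal_ofD[OF I] subringD[OF R] simp: distrib_left)

lemma ideal_of_ideal_power: "ideal_of R (ideal_power R B I i)"
  unfolding ideal_of_def
  using ideal_power_closed ideal_power_mult ideal_power_add ideal_power_ideal ideal_ofD(2)[OF I] by blast

lemma ideal_power_Suc: "p \<in> ideal_power R B I (Suc i) \<Longrightarrow> p \<in> ideal_power R B I i"
proof (induction i arbitrary: p)
  case 0
  then show ?case by (auto intro: ideal_power_base ideal_power_closed)
next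
  case (Suc i)
  have "p \<in> ideal_power R B I j \<Longrightarrow> j = Suc (Suc i) \<Longrightarrow> p \<in> ideal_power R B I (Suc i)" for j p
    by (induction rule: ideal_power_induct) (auto intro: ideal_power_intros Suc.IH)
  with Suc.prems show ?case by blast
qed

lemma ideal_power_subset:
  assumes "ideal_of R Q" "I \<subseteq> Q" "\<And>xs. set xs \<subseteq> B \<Longrightarrow> length xs = i \<Longrightarrow> prod_list xs \<in> Q"
  shows "ideal_power R B I i \<subseteq> Q"
  using assms
proof (induction i arbitrary: Q)
  case 0
  from 0(3)[of "[]"] have "1 \<in> Q" by simp
  then have "R \<subseteq> Q" using ideal_ofD(4)[OF 0(1), of _ 1] by auto
  then show ?case using ideal_power_closed by blast
next
  case (Suc i)
  have "p \<in> ideal_power R B I j \<Longrightarrow> j = Suc i \<Longrightarrow> p \<in> Q" for j p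
  proof (induction rule: ideal_power_induct)
    case (gen b p j)
    let ?Q = "{y \<in> R. b * y \<in> Q}"
    have bR: "b \<in> R" using gen B by blast
    have "ideal_of R ?Q"
      using Suc.prems(1) R bR by (auto simp: ideal_of_def distrib_left mult.left_commute intro: subringD)
    moreover have "I \<subseteq> ?Q" using Suc.prems(2) ideal_ofD(1)[OF I] ideal_ofD(4)[OF Suc.prems(1) bR] by blast
    moreover have "prod_list xs \<in> ?Q" if "set xs \<subseteq> B" "length xs = i" for xs
    proof -
      have "prod_list xs \<in> R"
        using that(1) B by (induction xs arbitrary: i) (auto intro: subringD[OF R])
      then show ?thesis using Suc.prems(3)[of "b # xs"] that gen(1) by simp
    qed
    ultimately have "ideal_power R B I i \<subseteq> ?Q" by (rule Suc.IH)
    then show ?case using gen by blast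
  qed (use Suc.prems(2) ideal_ofD(3)[OF Suc.prems(1)] in auto)
  then show ?case by blast
qed

lemma ideal_power_subset_if_nilpotent:
  assumes Q: "ideal_of R Q" "I \<subseteq> Q" and fin: "finite B" and nil: "\<And>b. b \<in> B \<Longrightarrow> \<exists>j. b ^ j \<in> Q"
  shows "\<exists>i. ideal_power R B I i \<subseteq> Q"
proof -
  from nil obtain j where j: "\<And>b. b \<in> B \<Longrightarrow> b ^ j b \<in> Q" by metis
  define N where "N = Suc (\<Sum>b\<in>B. j b)"
  have "ideal_power R B I N \<subseteq> Q"
  proof (rule ideal_power_subset[OF Q])
    fix xs assume xs: "set xs \<subseteq> B" "length xs = N"
    \<comment> \<open>A word that is long enough repeats some letter \<open>b\<close> at least \<open>j b\<close> times.\<close>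
    have "\<exists>b\<in>B. j b \<le> count_list xs b"
    proof (rule ccontr)
      assume "\<not> ?thesis"
      then have "count_list xs b \<le> j b" if "b \<in> B" for b using that by force
      then have "(\<Sum>b\<in>B. count_list xs b) \<le> (\<Sum>b\<in>B. j b)" by (intro sum_mono)
      moreover have "(\<Sum>b\<in>B. count_list xs b) = length xs"
        using sum_count_set[OF xs(1) fin] .
      ultimately show False using xs(2) by (simp add: N_def)
    qed
    then obtain b where b: "b \<in> B" "j b \<le> count_list xs b" by blast
    have "\<exists>r\<in>R. prod_list xs = b ^ count_list xs b * r"
      using xs(1)
    proof (induction xs arbitrary: N)
      case Nil
      then show ?case using subringD(1)[OF R] by auto
    next
      case (Cons x xs)
      then obtain r where r: "r \<in> R" "prod_list xs = b ^ count_list xs b * r" by auto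
      show ?case
      proof (cases "x = b")
        case True
        then show ?thesis using r by (auto simp: mult.assoc)
      next
        case False
        have "x * r \<in> R" using r(1) Cons(2) B subringD(4)[OF R, of x r] by auto
        moreover have "prod_list (x # xs) = b ^ count_list (x # xs) b * (x * r)"
          using False r(2) by (simp add: mult.left_commute)
        ultimately show ?thesis by blast
      qed
    qed
    then obtain r where r: "r \<in> R" "prod_list xs = b ^ count_list xs b * r" by blast
    obtain m where m: "count_list xs b = j b + m" using b(2) le_Suc_ex by blast
    have "b ^ m * r \<in> R" using r(1) b(1) B by (auto intro: subringD[OF R])
    then show "prod_list xs \<in> Q"
      using ideal_ofD(5)[OF Q(1) _ j[OF b(1)]] r(2) m by (simp add: power_add mult.assoc)
  qed
  then show ?thesis by blast
qed

text \<open>Among the ideals that contain \<open>F = \<mm> f + I\<close> and meet \<open>R f + I\<close> only in \<open>F\<close>, let \<open>Q\<close> be a maximal one.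
  For \<open>b \<in> B\<close> the ideals \<open>(Q : b\<^sup>j)\<close> become stationary at some \<open>j\<close>, and then \<open>Q + b\<^sup>j R\<close> still belongs to
  the family, so that \<open>b\<^sup>j \<in> Q\<close>.  Hence \<open>Q\<close> contains a power of \<open>\<mm>\<close>, and with it \<open>f\<close>; but then \<open>f \<in> F\<close>.\<close>

theorem krull_intersection:
  assumes noeth: "noetherian R" and fin: "finite B"
    and f: "f \<in> R" "\<And>i. f \<in> ideal_power R B I i"
  shows "\<exists>q\<in>ideal_power R B I 1. f - q * f \<in> I"
proof -
  let ?m = "ideal_power R B I 1"
  note m = ideal_of_ideal_power[of 1]
  define F where "F = {q * f + \<iota> | q \<iota>. q \<in> ?m \<and> \<iota> \<in> I}"
  define Fam where "Fam = {Q. ideal_of R Q \<and> F \<subseteq> Q \<and> (\<forall>r\<in>R. \<forall>\<iota>\<in>I. r * f + \<iota> \<in> Q \<longrightarrow> r * f + \<iota> \<in> F)}"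
  have F: "ideal_of R F"
    unfolding ideal_of_def
  proof (intro conjI ballI)
    show "F \<subseteq> R" unfolding F_def
      using f(1) ideal_ofD(1)[OF I] ideal_ofD(1)[OF m] by (auto intro!: subringD[OF R])
    have "0 = 0 * f + 0" by simp
    then show "0 \<in> F" unfolding F_def using ideal_ofD(2)[OF I] ideal_ofD(2)[OF m] by blast
  next
    fix x y assume "x \<in> F" "y \<in> F"
    then obtain q \<iota> q' \<iota>' where "x = q * f + \<iota>" "y = q' * f + \<iota>'" "q \<in> ?m" "q' \<in> ?m" "\<iota> \<in> I" "\<iota>' \<in> I"
      by (auto simp: F_def)
    moreover then have "x + y = (q + q') * f + (\<iota> + \<iota>')" by (simp add: algebra_simps)
    ultimately show "x + y \<in> F" unfolding F_def using ideal_ofD(3)[OF I] ideal_ofD(3)[OF m] by blast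
  next
    fix r x assume r: "r \<in> R" and "x \<in> F"
    then obtain q \<iota> where "x = q * f + \<iota>" "q \<in> ?m" "\<iota> \<in> I" by (auto simp: F_def)
    moreover then have "r * x = (r * q) * f + r * \<iota>" by (simp add: algebra_simps)
    ultimately show "r * x \<in> F" unfolding F_def using r ideal_ofD(4)[OF I] ideal_ofD(4)[OF m] by blast
  qed
  then have "F \<in> Fam" by (auto simp: Fam_def)
  then obtain Q where Q: "Q \<in> Fam"
    and max: "\<And>Y. ideal_of R Q \<Longrightarrow> ideal_of R Y \<Longrightarrow> Q \<subset> Y \<Longrightarrow> Y \<notin> Fam"
    using wfE_min[OF noeth[unfolded noetherian_def], of F Fam] by (metis (mono_tags, lifting) case_prodI mem_Collect_eq)
  have Qi: "ideal_of R Q" and FQ: "F \<subseteq> Q"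
    and QF: "\<And>r \<iota>. r \<in> R \<Longrightarrow> \<iota> \<in> I \<Longrightarrow> r * f + \<iota> \<in> Q \<Longrightarrow> r * f + \<iota> \<in> F"
    using Q by (auto simp: Fam_def)
  have IQ: "I \<subseteq> Q"
  proof
    fix \<iota> assume "\<iota> \<in> I"
    moreover have "\<iota> = 0 * f + \<iota>" by simp
    ultimately have "\<iota> \<in> F" unfolding F_def using ideal_ofD(2)[OF m] by blast
    then show "\<iota> \<in> Q" using FQ by blast
  qed
  have "\<exists>j. b ^ j \<in> Q" if bB: "b \<in> B" for b
  proof -
    have b: "b \<in> R" using bB B by blast
    define C where "C j = {y \<in> R. b ^ j * y \<in> Q}" for j
    have C: "ideal_of R (C j)" for j
      unfolding C_def ideal_of_def using ideal_ofD[OF Qi] subringD[OF R] by (auto simp: distrib_left mult.left_commute)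
    have "C j \<subseteq> C (Suc j)" for j
      unfolding C_def using ideal_ofD(4)[OF Qi b] by (auto simp: mult.assoc)
    from noetherian_chain[of R C, OF noeth C this] obtain j where j: "\<forall>n\<ge>j. C n = C j" ..
    have Cj: "C (Suc j) = C j" by (rule j[rule_format]) simp
    define Y where "Y = {q + b ^ j * r | q r. q \<in> Q \<and> r \<in> R}"
    have bj: "b ^ j \<in> R" by (rule subringD(7)[OF R b])
    have Y: "ideal_of R Y"
      unfolding ideal_of_def
    proof (intro conjI ballI)
      show "Y \<subseteq> R" unfolding Y_def using ideal_ofD(1)[OF Qi] bj by (auto intro!: subringD[OF R])
      have "0 = 0 + b ^ j * 0" by simp
      then show "0 \<in> Y" unfolding Y_def using ideal_ofD(2)[OF Qi] subringD(2)[OF R] by blast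
    next
      fix x y assume "x \<in> Y" "y \<in> Y"
      then obtain q r q' r' where "x = q + b ^ j * r" "y = q' + b ^ j * r'" "q \<in> Q" "q' \<in> Q" "r \<in> R" "r' \<in> R"
        by (auto simp: Y_def)
      moreover then have "x + y = (q + q') + b ^ j * (r + r')" by (simp add: algebra_simps)
      ultimately show "x + y \<in> Y" unfolding Y_def using ideal_ofD(3)[OF Qi] subringD(6)[OF R] by blast
    next
      fix s x assume s: "s \<in> R" and "x \<in> Y"
      then obtain q r where "x = q + b ^ j * r" "q \<in> Q" "r \<in> R" by (auto simp: Y_def)
      moreover then have "s * x = s * q + b ^ j * (s * r)" by (simp add: algebra_simps)
      ultimately show "s * x \<in> Y" unfolding Y_def using s ideal_ofD(4)[OF Qi] subringD(4)[OF R] by blast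
    qed
    have QY: "Q \<subseteq> Y"
    proof
      fix q assume "q \<in> Q"
      moreover have "q = q + b ^ j * 0" by simp
      ultimately show "q \<in> Y" unfolding Y_def using subringD(2)[OF R] by blast
    qed
    have "r * f + \<iota> \<in> F" if r: "r \<in> R" and \<iota>: "\<iota> \<in> I" and y: "r * f + \<iota> \<in> Y" for r \<iota>
    proof -
      from y obtain q s where q: "q \<in> Q" "s \<in> R" "r * f + \<iota> = q + b ^ j * s" by (auto simp: Y_def)
      have "b \<in> ?m" using ideal_power_gen[OF bB ideal_power_base[OF subringD(1)[OF R]]] by simp
      then have "(r * b) * f + b * \<iota> \<in> F"
        unfolding F_def using ideal_ofD(4)[OF m r] ideal_ofD(4)[OF I b \<iota>] by blast
      moreover have "(r * b) * f + b * \<iota> = b * q + b ^ Suc j * s"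
        using arg_cong[OF q(3), of "\<lambda>y. b * y"] by (simp add: algebra_simps)
      ultimately have "b * q + b ^ Suc j * s \<in> Q" using FQ by auto
      then have "(b * q + b ^ Suc j * s) - b * q \<in> Q"
        using ideal_of_diff[OF Qi R] ideal_ofD(4)[OF Qi b q(1)] by blast
      then have "s \<in> C (Suc j)" using q(2) by (simp add: C_def)
      then have "s \<in> C j" by (simp only: Cj)
      then have "b ^ j * s \<in> Q" by (simp add: C_def)
      then have "r * f + \<iota> \<in> Q" using q ideal_ofD(3)[OF Qi] by simp
      with r \<iota> show ?thesis by (rule QF)
    qed
    then have "Y \<in> Fam" unfolding Fam_def using Y QY FQ by blast
    then have "Y = Q" using max[OF Qi Y] QY by blast
    moreover have "0 + b ^ j * 1 \<in> Y" unfolding Y_def using ideal_ofD(2)[OF Qi] subringD(1)[OF R] by blast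
    ultimately show ?thesis by auto
  qed
  from ideal_power_subset_if_nilpotent[OF Qi IQ fin this] obtain i where "ideal_power R B I i \<subseteq> Q" by blast
  then have "1 * f + 0 \<in> Q" using f(2) by auto
  then have "1 * f + 0 \<in> F" by (intro QF subringD(1)[OF R] ideal_ofD(2)[OF I])
  then obtain q \<iota> where "q \<in> ?m" "\<iota> \<in> I" "f = q * f + \<iota>" by (auto simp: F_def)
  moreover then have "f - q * f = \<iota>" by (metis add_diff_cancel_left')
  ultimately show ?thesis by auto
qed

end

section \<open>Polynomial functions on matrices\<close>

lemma subring_poly_fun: "subring (poly_fun :: ('k::field ^ 'n ^ 'n \<Rightarrow> 'k) set)"
  unfolding subring_def
proof (intro conjI ballI)
  show "1 \<in> (poly_fun :: ('k ^ 'n ^ 'n \<Rightarrow> 'k) set)"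
    using poly_fun.const[of 1] by (simp add: one_fun_def)
  fix p q :: "'k ^ 'n ^ 'n \<Rightarrow> 'k" assume pq: "p \<in> poly_fun" "q \<in> poly_fun"
  have "(\<lambda>A. p A + (- 1) * q A) \<in> poly_fun"
    by (intro poly_fun.intros pq)
  then show "p - q \<in> poly_fun" by (simp add: fun_diff_def)
  show "p * q \<in> poly_fun" using poly_fun.mult[OF pq] by (simp add: times_fun_def)
qed

lemma poly_fun_minus: "p \<in> poly_fun \<Longrightarrow> q \<in> poly_fun \<Longrightarrow> (\<lambda>A. p A - q A) \<in> poly_fun"
  using subringD(3)[OF subring_poly_fun, of p q] by (simp add: fun_diff_def)

lemma poly_fun_sum: "(\<And>a. a \<in> S \<Longrightarrow> p a \<in> poly_fun) \<Longrightarrow> (\<lambda>A. \<Sum>a\<in>S. p a A) \<in> poly_fun"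
  by (induction S rule: infinite_finite_induct) (auto intro: poly_fun.intros)

lemma poly_fun_prod: "(\<And>a. a \<in> S \<Longrightarrow> p a \<in> poly_fun) \<Longrightarrow> (\<lambda>A. \<Prod>a\<in>S. p a A) \<in> poly_fun"
  by (induction S rule: infinite_finite_induct) (auto intro: poly_fun.intros)

lemma poly_fun_power: "p \<in> poly_fun \<Longrightarrow> (\<lambda>A. p A ^ m) \<in> poly_fun"
  by (induction m) (auto intro: poly_fun.intros)

lemma poly_fun_subst:
  assumes "p \<in> poly_fun" "\<And>i j. (\<lambda>A. F A $ i $ j) \<in> poly_fun"
  shows "(\<lambda>A. p (F A)) \<in> poly_fun"
  using assms(1) by induction (auto intro: poly_fun.intros assms(2))

lemma poly_fun_matrix_mult:
  assumes "\<And>i j. (\<lambda>A. F A $ i $ j) \<in> poly_fun" "\<And>i j. (\<lambda>A. H A $ i $ j) \<in> poly_fun"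
  shows "(\<lambda>A. (F A ** H A) $ i $ j) \<in> poly_fun"
  unfolding matrix_matrix_mult_def by (simp, intro poly_fun_sum poly_fun.mult assms)

lemma poly_fun_translate:
  assumes "p \<in> poly_fun" shows "(\<lambda>A. p (L ** A ** R)) \<in> poly_fun"
  by (rule poly_fun_subst[OF assms]) (intro poly_fun_matrix_mult poly_fun.const poly_fun.coord)

lemma poly_fun_translate_left:
  assumes "p \<in> poly_fun" shows "(\<lambda>A. p (L ** A)) \<in> poly_fun"
  using poly_fun_translate[OF assms, of L "mat 1"] by simp

lemma poly_fun_det:
  assumes "\<And>i j. (\<lambda>A. F A $ i $ j) \<in> poly_fun"
  shows "(\<lambda>A. det (F A)) \<in> poly_fun"
  unfolding det_def by (intro poly_fun_sum poly_fun.mult poly_fun_prod poly_fun.const assms)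

lemma noetherian_field:
  fixes R :: "'a::comm_ring_1 set"
  assumes "\<And>r. r \<in> R \<Longrightarrow> r \<noteq> 0 \<Longrightarrow> \<exists>s\<in>R. s * r = 1"
  shows "noetherian R"
proof (rule noetherianI_chain)
  fix I assume I: "\<And>n::nat. ideal_of R (I n)" and inc: "\<And>n. I n \<subseteq> I (Suc n)"
  have all: "I n = R" if x: "x \<in> I n" "x \<noteq> 0" for n x
  proof -
    obtain s where "s \<in> R" "s * x = 1" using assms ideal_ofD(1)[OF I x(1)] x(2) by blast
    then have "1 \<in> I n" using ideal_ofD(4)[OF I _ x(1)] by metis
    then show ?thesis using ideal_ofD(1,4)[OF I[of n]] by (metis mult.right_neutral subsetI subset_antisym)
  qed
  show "\<exists>N. I (Suc N) = I N"
  proof (cases "\<exists>N. \<exists>x\<in>I N. x \<noteq> 0")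
    case True
    then obtain N x where "x \<in> I N" "x \<noteq> 0" by blast
    then have "I N = R" "I (Suc N) = R" using all inc by blast+
    then show ?thesis by blast
  next
    case False
    then have "I 0 = {0}" "I (Suc 0) = {0}" using ideal_ofD(2)[OF I] by blast+
    then show ?thesis by metis
  qed
qed

lemma noetherian_poly_fun: "noetherian (poly_fun :: ('k::field ^ 'n ^ 'n \<Rightarrow> 'k) set)"
proof -
  let ?x = "\<lambda>(i, j) A. A $ i $ j :: 'k"
  let ?C = "range (\<lambda>(c :: 'k) (_ :: 'k ^ 'n ^ 'n). c)"
  have "\<exists>R. ?C \<subseteq> R \<and> ?x ` S \<subseteq> R \<and> R \<subseteq> poly_fun \<and> subring R \<and> noetherian R"
    if "finite S" for S :: "('n \<times> 'n) set"
    using that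
  proof induction
    case empty
    have "subring ?C" unfolding subring_def
      by (auto simp: one_fun_def fun_diff_def times_fun_def)
    moreover have "noetherian ?C"
    proof (rule noetherian_field)
      fix r :: "'k ^ 'n ^ 'n \<Rightarrow> 'k" assume r: "r \<in> ?C" "r \<noteq> 0"
      then obtain c where "r = (\<lambda>_. c)" by blast
      with r(2) have "c \<noteq> 0" by (auto simp: zero_fun_def)
      then show "\<exists>s\<in>?C. s * r = 1"
        using \<open>r = _\<close> by (intro bexI[of _ "\<lambda>_. inverse c"]) (auto simp: times_fun_def one_fun_def)
    qed
    ultimately show ?case by (intro exI[of _ ?C]) (auto intro: poly_fun.const)
  next
    case (insert s S)
    then obtain R where R: "?C \<subseteq> R" "?x ` S \<subseteq> R" "R \<subseteq> poly_fun" "subring R" "noetherian R" by blast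
    have "?x s \<in> poly_fun" by (cases s) (auto intro: poly_fun.coord)
    have "deg_less R (?x s) d \<subseteq> poly_fun" for d
    proof (induction d)
      case 0
      show ?case using subringD(2)[OF subring_poly_fun] by simp
    next
      case (Suc d)
      show ?case
      proof
        fix p assume "p \<in> deg_less R (?x s) (Suc d)"
        then obtain a y where "p = a * ?x s ^ d + y" "a \<in> R" "y \<in> deg_less R (?x s) d" by auto
        then show "p \<in> poly_fun"
          using Suc R(3) subringD(4,6,7)[OF subring_poly_fun] \<open>?x s \<in> poly_fun\<close> by (metis (no_types, lifting) subsetD)
      qed
    qed
    then have "adjoin R (?x s) \<subseteq> poly_fun" by (auto simp: adjoin_def)
    moreover have "?C \<union> ?x ` insert s S \<subseteq> adjoin R (?x s)"
      using R(1,2) adjoin_base[OF R(4), of _ "?x s"] adjoin_gen[OF R(4), of "?x s"] by blast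
    ultimately show ?case
      using subring_adjoin[OF R(4)] noetherian_adjoin[OF R(4,5)]
      by (intro exI[of _ "adjoin R (?x s)"]) auto
  qed
  from this[OF finite, of UNIV]
  obtain R where R: "?C \<subseteq> R" "range ?x \<subseteq> R" "R \<subseteq> poly_fun" "subring R" "noetherian R" by blast
  have "p \<in> R" if "p \<in> poly_fun" for p
    using that
  proof induction
    case (coord i j)
    then show ?case using R(2) by (auto simp: image_subset_iff)
  next
    case (add p q)
    then show ?case using subringD(6)[OF R(4), of p q] by (simp add: plus_fun_def)
  next
    case (mult p q)
    then show ?case using subringD(4)[OF R(4), of p q] by (simp add: times_fun_def)
  qed (use R(1) in auto)
  then have "R = poly_fun" using R(3) by blast
  then show ?thesis using R(5) by simp
qed

definition matrix_group :: "('k::field ^ 'n ^ 'n) set \<Rightarrow> bool" where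
  "matrix_group G \<longleftrightarrow> mat 1 \<in> G \<and> (\<forall>A\<in>G. \<forall>B\<in>G. A ** B \<in> G) \<and>
     (\<forall>A\<in>G. invertible A \<and> matrix_inv A \<in> G)"

lemma matrix_groupD:
  assumes "matrix_group G"
  shows "mat 1 \<in> G" "A \<in> G \<Longrightarrow> B \<in> G \<Longrightarrow> A ** B \<in> G" "A \<in> G \<Longrightarrow> invertible A" "A \<in> G \<Longrightarrow> matrix_inv A \<in> G"
  using assms by (auto simp: matrix_group_def)

lemma matrix_inv_cancel [simp]:
  fixes A :: "'k::field ^ 'n ^ 'n"
  assumes "invertible A"
  shows "A ** matrix_inv A = mat 1" "matrix_inv A ** A = mat 1"
    "A ** (matrix_inv A ** B) = B" "matrix_inv A ** (A ** B) = B"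
    "B ** A ** matrix_inv A = B" "B ** matrix_inv A ** A = B"
proof -
  have *: "A ** matrix_inv A = mat 1 \<and> matrix_inv A ** A = mat 1"
    using assms unfolding invertible_def matrix_inv_def by (rule someI_ex)
  then show "A ** matrix_inv A = mat 1" "matrix_inv A ** A = mat 1" by auto
  from * show "A ** (matrix_inv A ** B) = B" "matrix_inv A ** (A ** B) = B"
    by (simp_all add: matrix_mul_assoc)
  from * show "B ** A ** matrix_inv A = B" "B ** matrix_inv A ** A = B"
    by (simp_all flip: matrix_mul_assoc)
qed

definition vanishing_ideal :: "('k::field ^ 'n ^ 'n) set \<Rightarrow> ('k ^ 'n ^ 'n \<Rightarrow> 'k) set" where
  "vanishing_ideal G = {p \<in> poly_fun. \<forall>A\<in>G. p A = 0}"

lemma ideal_of_vanishing_ideal: "ideal_of poly_fun (vanishing_ideal G)"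
  unfolding ideal_of_def vanishing_ideal_def
  using subringD(2,4,6)[OF subring_poly_fun] by auto

text \<open>Let \<open>J\<close> be the ideal of the functions that vanish on
  \<open>G\<close> near the identity, so that \<open>J\<close> translated by \<open>h\<close> belongs to the functions vanishing near \<open>h\<close>.
  By the ascending chain condition one neighbourhood \<open>U\<close> of the identity serves all of \<open>J\<close>; hence
  translation by \<open>h \<in> U\<close> maps \<open>J\<close> into itself, and onto itself by the chain condition again.  So
  the stabilizer of \<open>J\<close> is an open subgroup, which is \<open>G\<close> by connectedness; and
  a function that vanishes near the identity vanishes near every point of the stabilizer.\<close>

lemma connected_group_irreducible:
  fixes G :: "('k::field ^ 'n ^ 'n) set"
  assumes G: "matrix_group G" and conn: "connectedin zariski G"
    and p: "p \<in> poly_fun" and r: "r \<in> poly_fun" "r (mat 1) \<noteq> 0"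
    and pr: "\<And>A. A \<in> G \<Longrightarrow> p A * r A = 0"
    and A: "A \<in> G"
  shows "p A = 0"
proof -
  note G = matrix_groupD[OF G]
  define units where "units = {r \<in> (poly_fun :: ('k ^ 'n ^ 'n \<Rightarrow> 'k) set). r (mat 1) \<noteq> 0}"
  define Ann where "Ann r = {p \<in> (poly_fun :: ('k ^ 'n ^ 'n \<Rightarrow> 'k) set). \<forall>A\<in>G. p A * r A = 0}" for r
  have Ann: "ideal_of poly_fun (Ann r)" for r
    unfolding ideal_of_def Ann_def
    using subringD(2,4,6)[OF subring_poly_fun] by auto (metis add.left_neutral)
  have wf: "wf {(J, I). ideal_of poly_fun I \<and> ideal_of poly_fun J \<and> I \<subset> (J :: ('k ^ 'n ^ 'n \<Rightarrow> 'k) set)}"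
    using noetherian_poly_fun by (simp add: noetherian_def)
  have "Ann r \<in> Ann ` units" using r by (simp add: units_def)
  then obtain J where J: "J \<in> Ann ` units"
    "\<And>Y. (Y, J) \<in> {(J, I). ideal_of poly_fun I \<and> ideal_of poly_fun J \<and> I \<subset> J} \<Longrightarrow> Y \<notin> Ann ` units"
    by (rule wfE_min[OF wf]) blast
  then obtain u where u: "J = Ann u" "u \<in> units" by blast
  have Ann_le: "Ann v \<subseteq> J" if v: "v \<in> units" for v
  proof -
    have uv: "u * v \<in> units" using u(2) v by (simp add: units_def subringD(4)[OF subring_poly_fun])
    have "Ann u \<subseteq> Ann (u * v)" by (auto simp: Ann_def simp flip: mult.assoc)
    moreover have "\<not> J \<subset> Ann (u * v)" using J(2)[of "Ann (u * v)"] uv Ann u(1) by auto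
    ultimately have "Ann (u * v) = J" using u(1) by blast
    moreover have "Ann v \<subseteq> Ann (u * v)"
      by (auto simp: Ann_def mult.left_commute)
    ultimately show ?thesis by simp
  qed
  have Ji: "ideal_of poly_fun J" using Ann u(1) by simp
  define tr where "tr h p = (\<lambda>A. p (h ** A))" for h :: "'k ^ 'n ^ 'n" and p :: "'k ^ 'n ^ 'n \<Rightarrow> 'k"
  have tr_poly: "tr h p \<in> poly_fun" if "p \<in> poly_fun" for h p
    unfolding tr_def by (rule poly_fun_translate_left[OF that])
  have tr_tr: "tr h (tr k p) = tr (k ** h) p" for h k p
    by (simp add: tr_def matrix_mul_assoc)
  have tr_1: "tr (mat 1) p = p" for p by (simp add: tr_def)
  define H where "H = {h \<in> G. \<forall>p\<in>poly_fun. tr h p \<in> J \<longleftrightarrow> p \<in> J}"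
  have H_mult: "h ** k \<in> H" if "h \<in> H" "k \<in> H" for h k
    using that G(2) tr_poly by (auto simp: H_def simp flip: tr_tr)
  have H_inv: "matrix_inv h \<in> H" if "h \<in> H" for h
  proof -
    have h: "h \<in> G" using that by (simp add: H_def)
    have "tr (matrix_inv h) p \<in> J \<longleftrightarrow> p \<in> J" if "p \<in> poly_fun" for p
    proof -
      have "tr h (tr (matrix_inv h) p) \<in> J \<longleftrightarrow> tr (matrix_inv h) p \<in> J"
        using \<open>h \<in> H\<close> tr_poly[OF that, of "matrix_inv h"] unfolding H_def by blast
      moreover have "tr h (tr (matrix_inv h) p) = p" using G(3)[OF h] by (simp add: tr_tr tr_1)
      ultimately show ?thesis by simp
    qed
    then show ?thesis using G(4)[OF h] by (simp add: H_def)
  qed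
  \<comment> \<open>The open neighbourhood of the identity on which the single function \<open>u\<close> is nonzero.\<close>
  have H_near: "h \<in> H" if h: "h \<in> G" "u h \<noteq> 0" for h
  proof -
    have sub: "tr h p \<in> J" if "p \<in> J" for p
    proof -
      have "tr h u \<in> units" using h(2) u(2) tr_poly by (simp add: units_def tr_def)
      moreover have "tr h p \<in> Ann (tr h u)"
        using that h(1) G(2) tr_poly unfolding u(1) by (auto simp: Ann_def tr_def)
      ultimately show ?thesis using Ann_le by blast
    qed
    define C where "C n = {p \<in> poly_fun. (tr h ^^ n) p \<in> J}" for n
    have tr_n: "(tr h ^^ n) p \<in> poly_fun" if "p \<in> poly_fun" for n p
      using that by (induction n) (auto intro: tr_poly)
    have tr_n_hom: "(tr h ^^ n) 0 = 0" "(tr h ^^ n) (p + q) = (tr h ^^ n) p + (tr h ^^ n) q"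
      "(tr h ^^ n) (p * q) = (tr h ^^ n) p * (tr h ^^ n) q" for n p q
      by (induction n) (auto simp: tr_def)
    have "ideal_of poly_fun (C n)" for n
      unfolding ideal_of_def C_def
      using ideal_ofD[OF Ji] subringD(2,4,6)[OF subring_poly_fun] tr_n by (auto simp: tr_n_hom)
    moreover have "C n \<subseteq> C (Suc n)" for n unfolding C_def using sub by auto
    ultimately obtain n where n: "\<forall>m\<ge>n. C m = C n"
      using noetherian_chain[OF noetherian_poly_fun, of C] by blast
    have "p \<in> J" if p: "p \<in> poly_fun" "tr h p \<in> J" for p
    proof -
      define q where "q = (tr (matrix_inv h) ^^ n) p"
      have "q \<in> poly_fun" unfolding q_def using p(1) by (induction n) (auto intro: tr_poly)
      have hinv: "tr h (tr (matrix_inv h) p) = p" for p using G(3)[OF h(1)] by (simp add: tr_tr tr_1)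
      have q: "(tr h ^^ n) q = p" unfolding q_def
        by (induction n arbitrary: p) (simp_all add: funpow_swap1 hinv)
      have "q \<in> C (Suc n)" using q p \<open>q \<in> poly_fun\<close> by (simp add: C_def)
      moreover have "C (Suc n) = C n" by (rule n[rule_format]) simp
      ultimately have "q \<in> C n" by (simp only:)
      then show ?thesis using q by (simp add: C_def)
    qed
    with sub show ?thesis using h(1) by (auto simp: H_def)
  qed
  have H1: "mat 1 \<in> H" by (rule H_near) (use G(1) u(2) in \<open>auto simp: units_def\<close>)
  have H_sub: "H \<subseteq> G" by (auto simp: H_def)
  define nbhd where "nbhd K = {A. \<exists>p\<in>(\<lambda>k. tr (matrix_inv k) u) ` K. p A \<noteq> 0}" for K
  have open_nbhd: "openin zariski (nbhd K)" for K
    unfolding openin_zariski zariski_open_def nbhd_def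
    using u(2) tr_poly by (intro exI[of _ "(\<lambda>k. tr (matrix_inv k) u) ` K"]) (auto simp: units_def)
  have nbhd_self: "k \<in> nbhd K" if "k \<in> K" "K \<subseteq> G" for k K
  proof -
    have "invertible k" using that G(3) by blast
    then show ?thesis using that(1) u(2) unfolding nbhd_def by (auto simp: tr_def units_def intro!: bexI[of _ k])
  qed
  have nbhdE: "\<exists>k\<in>K. \<exists>h\<in>H. A = k ** h" if "A \<in> nbhd K" "A \<in> G" "K \<subseteq> G" for A K
  proof -
    from that(1) obtain k where k: "k \<in> K" "u (matrix_inv k ** A) \<noteq> 0" by (auto simp: nbhd_def tr_def)
    then have kG: "k \<in> G" using that(3) by blast
    have "matrix_inv k ** A \<in> H" using k(2) G(2,4) kG that(2) by (intro H_near) auto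
    moreover have "A = k ** (matrix_inv k ** A)" using G(3)[OF kG] by simp
    ultimately show ?thesis using k(1) by blast
  qed
  have "G \<subseteq> H"
  proof (rule ccontr)
    assume "\<not> G \<subseteq> H"
    then have ne: "nbhd (G - H) \<inter> G \<noteq> {}" using nbhd_self[of _ "G - H"] by blast
    have "nbhd H \<inter> G \<noteq> {}" using nbhd_self[OF H1 H_sub] G(1) by blast
    moreover have "G \<subseteq> nbhd H \<union> nbhd (G - H)" using nbhd_self[of _ "G - H"] nbhd_self[OF _ H_sub] by blast
    moreover have "nbhd H \<inter> nbhd (G - H) \<inter> G = {}"
    proof (rule ccontr)
      assume "\<not> ?thesis"
      then obtain A where A: "A \<in> nbhd H" "A \<in> nbhd (G - H)" "A \<in> G" by blast
      obtain k h where kh: "k \<in> H" "h \<in> H" "A = k ** h" using nbhdE[OF A(1,3) H_sub] by blast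
      obtain k' h' where kh': "k' \<in> G - H" "h' \<in> H" "A = k' ** h'" using nbhdE[OF A(2,3)] by blast
      have "k' = A ** matrix_inv h'" using kh' H_sub G(3) by auto
      then have "k' \<in> H" using kh kh' H_mult H_inv by simp
      then show False using kh'(1) by blast
    qed
    ultimately show False using conn ne open_nbhd unfolding connectedin by blast
  qed
  have pJ: "p \<in> J" using Ann_le[of r] r p pr by (auto simp: units_def Ann_def)
  have "tr A p \<in> J" using \<open>G \<subseteq> H\<close> A p pJ by (auto simp: H_def)
  then have "tr A p (mat 1) * u (mat 1) = 0" using G(1) unfolding u(1) Ann_def by blast
  then show ?thesis using u(2) by (simp add: tr_def units_def)
qed

section \<open>Directional derivatives and invariant derivations\<close>

text \<open>The derivative of \<open>p\<close> at \<open>A\<close> in the direction \<open>X\<close>.  At the identity it is \<open>dderiv\<close>; the other base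
  points serve to differentiate along invariant vector fields.\<close>

definition deriv_at :: "('k::field_char_0 ^ 'n ^ 'n \<Rightarrow> 'k) \<Rightarrow> 'k ^ 'n ^ 'n \<Rightarrow> 'k ^ 'n ^ 'n \<Rightarrow> 'k" where
  "deriv_at p A X = coeff (THE q. \<forall>s. poly q s = p (A + smult_mat s X)) 1"

lemma dderiv_eq_deriv_at: "dderiv p X = deriv_at p (mat 1) X"
  by (simp add: dderiv_def deriv_at_def)

lemma deriv_at_eqI:
  assumes "\<And>s. p (A + smult_mat s X) = poly q s"
  shows "deriv_at p A X = coeff q 1"
proof -
  have "(THE q. \<forall>s. poly q s = p (A + smult_mat s X)) = q"
    using assms by (intro the_equality) (auto simp: poly_eq_poly_eq_iff[symmetric])
  then show ?thesis by (simp add: deriv_at_def)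
qed

lemma along_line:
  assumes "p \<in> poly_fun"
  obtains q where "\<And>s. p (A + smult_mat s X) = poly q s" "deriv_at p A X = coeff q 1" "coeff q 0 = p A"
proof -
  from poly_fun_along_line[OF assms] obtain q where q: "\<forall>s. poly q s = p (A + smult_mat s X)" by blast
  have "smult_mat 0 X = 0" by (simp add: vec_eq_iff)
  with q have "poly q 0 = p A" by simp
  then show ?thesis using q deriv_at_eqI[of p A X q] that by (metis poly_0_coeff_0)
qed

lemma deriv_at_const [simp]: "deriv_at (\<lambda>_. c) A X = 0"
  using deriv_at_eqI[of "\<lambda>_. c" A X "[:c:]"] by simp

lemma deriv_at_coord [simp]: "deriv_at (\<lambda>A. A $ i $ j) A X = X $ i $ j"
  using deriv_at_eqI[of "\<lambda>A. A $ i $ j" A X "[:A $ i $ j, X $ i $ j:]"] by simp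

lemma deriv_at_add:
  assumes "p \<in> poly_fun" "q \<in> poly_fun"
  shows "deriv_at (\<lambda>A. p A + q A) A X = deriv_at p A X + deriv_at q A X"
proof -
  obtain p' where p': "\<And>s. p (A + smult_mat s X) = poly p' s" "deriv_at p A X = coeff p' 1"
    by (rule along_line[OF assms(1), of A X]) blast
  obtain q' where q': "\<And>s. q (A + smult_mat s X) = poly q' s" "deriv_at q A X = coeff q' 1"
    by (rule along_line[OF assms(2), of A X]) blast
  show ?thesis by (subst deriv_at_eqI[of _ _ _ "p' + q'"]) (simp_all add: p' q')
qed

lemma deriv_at_mult:
  assumes "p \<in> poly_fun" "q \<in> poly_fun"
  shows "deriv_at (\<lambda>A. p A * q A) A X = p A * deriv_at q A X + q A * deriv_at p A X"
proof -
  obtain p' where p': "\<And>s. p (A + smult_mat s X) = poly p' s" "deriv_at p A X = coeff p' 1" "coeff p' 0 = p A"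
    by (rule along_line[OF assms(1), of A X]) blast
  obtain q' where q': "\<And>s. q (A + smult_mat s X) = poly q' s" "deriv_at q A X = coeff q' 1" "coeff q' 0 = q A"
    by (rule along_line[OF assms(2), of A X]) blast
  show ?thesis
    by (subst deriv_at_eqI[of _ _ _ "p' * q'"]) (simp_all add: p' q' coeff_mult algebra_simps)
qed

lemma deriv_at_linear_comb:
  assumes "p \<in> poly_fun"
  shows "deriv_at p A (\<Sum>a\<in>S. smult_mat (c a) (X a)) = (\<Sum>a\<in>S. c a * deriv_at p A (X a))"
  using assms
proof induction
  case (mult p q)
  then show ?case by (simp add: deriv_at_mult sum.distrib sum_distrib_left algebra_simps)
qed (simp_all add: deriv_at_add sum.distrib distrib_left)

lemma deriv_at_add_dir:
  assumes "p \<in> poly_fun"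
  shows "deriv_at p A (X + Y) = deriv_at p A X + deriv_at p A Y"
  using assms
  by induction (simp_all add: deriv_at_add deriv_at_mult algebra_simps)

lemma deriv_at_zero_dir [simp]: "p \<in> poly_fun \<Longrightarrow> deriv_at p A 0 = 0"
  using deriv_at_add_dir[of p A 0 0] by simp

lemma deriv_at_smult_dir:
  assumes "p \<in> poly_fun"
  shows "deriv_at p A (smult_mat c X) = c * deriv_at p A X"
  using deriv_at_linear_comb[OF assms, where S = "{()}" and c = "\<lambda>_. c" and X = "\<lambda>_. X"] by simp

definition unit_mat :: "'n \<Rightarrow> 'n \<Rightarrow> 'k::field ^ 'n ^ 'n" where
  "unit_mat i j = (\<chi> i' j'. if i' = i \<and> j' = j then 1 else 0)"

lemma unit_mat_nth [simp]: "unit_mat i j $ i' $ j' = (if i' = i \<and> j' = j then 1 else 0)"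
  by (simp add: unit_mat_def)

lemma matrix_eq_sum_unit_mat:
  "X = (\<Sum>a\<in>UNIV. smult_mat (X $ fst a $ snd a) (unit_mat (fst a) (snd a)))"
proof -
  have "(\<Sum>a\<in>UNIV. X $ fst a $ snd a * (if i = fst a \<and> j = snd a then 1 else 0)) = X $ i $ j" for i j
  proof -
    have "(\<Sum>a\<in>UNIV. X $ fst a $ snd a * (if i = fst a \<and> j = snd a then 1 else 0)) =
        (\<Sum>a\<in>UNIV. if a = (i, j) then X $ i $ j else 0)"
      by (intro sum.cong) auto
    then show ?thesis by simp
  qed
  then show ?thesis by (simp add: vec_eq_iff)
qed

lemma deriv_at_expand:
  assumes "p \<in> poly_fun"
  shows "deriv_at p A X = (\<Sum>a\<in>UNIV. X $ fst a $ snd a * deriv_at p A (unit_mat (fst a) (snd a)))"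
  by (subst matrix_eq_sum_unit_mat[of X]) (rule deriv_at_linear_comb[OF assms])

lemma deriv_at_comp_linear:
  assumes "p \<in> poly_fun"
  shows "deriv_at (\<lambda>A. p (L ** A ** R)) A X = deriv_at p (L ** A ** R) (L ** X ** R)"
proof -
  have "L ** (A + smult_mat s X) ** R = L ** A ** R + smult_mat s (L ** X ** R)" for s
    by (simp add: vec_eq_iff matrix_matrix_mult_def sum.distrib sum_distrib_left sum_distrib_right algebra_simps)
  then show ?thesis
    using along_line[OF assms, of "L ** A ** R" "L ** X ** R"]
    by (metis (no_types, lifting) deriv_at_eqI)
qed

lemma poly_fun_deriv_at:
  assumes "p \<in> poly_fun" "\<And>i j. (\<lambda>A. F A $ i $ j) \<in> poly_fun"
  shows "(\<lambda>A. deriv_at p A (F A)) \<in> poly_fun"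
  using assms(1)
proof induction
  case (add p q)
  then show ?case by (simp add: deriv_at_add poly_fun.add)
next
  case (mult p q)
  then show ?case by (simp add: deriv_at_mult poly_fun.add poly_fun.mult)
qed (simp_all add: poly_fun.const assms(2))

lemma matrix_mult_diff_right:
  fixes A X Y :: "'k::field ^ 'n ^ 'n"
  shows "A ** (X - Y) = A ** X - A ** Y"
  by (simp add: vec_eq_iff matrix_matrix_mult_def right_diff_distrib sum_subtractf)

text \<open>Left and right translations of a tangent vector at the identity give invariant vector fields.\<close>

definition left_field :: "'k::field_char_0 ^ 'n ^ 'n \<Rightarrow> ('k ^ 'n ^ 'n \<Rightarrow> 'k) \<Rightarrow> 'k ^ 'n ^ 'n \<Rightarrow> 'k" where
  "left_field X p A = deriv_at p A (A ** X)"

definition right_field :: "'k::field_char_0 ^ 'n ^ 'n \<Rightarrow> ('k ^ 'n ^ 'n \<Rightarrow> 'k) \<Rightarrow> 'k ^ 'n ^ 'n \<Rightarrow> 'k" where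
  "right_field X p A = deriv_at p A (X ** A)"

definition derivation :: "(('k::field_char_0 ^ 'n ^ 'n \<Rightarrow> 'k) \<Rightarrow> ('k ^ 'n ^ 'n \<Rightarrow> 'k)) \<Rightarrow> bool" where
  "derivation \<delta> \<longleftrightarrow> (\<forall>p\<in>poly_fun. \<delta> p \<in> poly_fun) \<and> (\<forall>c. \<delta> (\<lambda>_. c) = 0) \<and>
     (\<forall>p\<in>poly_fun. \<forall>q\<in>poly_fun. \<delta> (p + q) = \<delta> p + \<delta> q \<and> \<delta> (p * q) = p * \<delta> q + q * \<delta> p)"

lemma derivationD:
  assumes "derivation \<delta>"
  shows "p \<in> poly_fun \<Longrightarrow> \<delta> p \<in> poly_fun" "\<delta> (\<lambda>_. c) = 0"
    "p \<in> poly_fun \<Longrightarrow> q \<in> poly_fun \<Longrightarrow> \<delta> (p + q) = \<delta> p + \<delta> q"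
    "p \<in> poly_fun \<Longrightarrow> q \<in> poly_fun \<Longrightarrow> \<delta> (p * q) = p * \<delta> q + q * \<delta> p"
  using assms by (auto simp: derivation_def)

lemma derivation_eqI:
  assumes "derivation \<delta>" "derivation \<delta>'"
    and "\<And>i j. \<delta> (\<lambda>A. A $ i $ j) = \<delta>' (\<lambda>A. A $ i $ j)" and "p \<in> poly_fun"
  shows "\<delta> p = \<delta>' p"
  using assms(4)
proof induction
  case (const c)
  then show ?case using derivationD(2)[OF assms(1)] derivationD(2)[OF assms(2)] by simp
next
  case (add p q)
  then show ?case using derivationD(3)[OF assms(1) add(1,2)] derivationD(3)[OF assms(2) add(1,2)]
    by (simp add: plus_fun_def)
next
  case (mult p q)
  then show ?case using derivationD(4)[OF assms(1) mult(1,2)] derivationD(4)[OF assms(2) mult(1,2)]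
    by (simp add: times_fun_def)
qed (rule assms(3))

lemma derivation_deriv_at:
  assumes "\<And>i j. (\<lambda>A. F A $ i $ j) \<in> poly_fun"
  shows "derivation (\<lambda>p A. deriv_at p A (F A))"
  unfolding derivation_def
  using poly_fun_deriv_at[OF _ assms]
  by (auto simp: fun_eq_iff plus_fun_def times_fun_def deriv_at_add deriv_at_mult)

lemma poly_fun_mult_const:
  "(\<lambda>A. (A ** X) $ i $ j) \<in> poly_fun" "(\<lambda>A. (X ** A) $ i $ j) \<in> poly_fun"
  by (intro poly_fun_matrix_mult poly_fun.const poly_fun.coord)+

lemma derivation_left_field: "derivation (left_field X)"
  and derivation_right_field: "derivation (right_field X)"
  using derivation_deriv_at[of "\<lambda>A. A ** X"] derivation_deriv_at[of "\<lambda>A. X ** A"] poly_fun_mult_const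
  unfolding left_field_def[abs_def] right_field_def[abs_def] by blast+

lemma derivation_diff:
  assumes "derivation \<delta>" "derivation \<delta>'"
  shows "derivation (\<lambda>p. \<delta> p - \<delta>' p)"
  unfolding derivation_def using derivationD[OF assms(1)] derivationD[OF assms(2)]
  by (auto simp: algebra_simps intro!: subringD(3)[OF subring_poly_fun])

lemma derivation_commutator:
  assumes "derivation \<delta>" "derivation \<delta>'"
  shows "derivation (\<lambda>p. \<delta> (\<delta>' p) - \<delta>' (\<delta> p))"
proof -
  have 0: "\<delta> 0 = 0" "\<delta>' 0 = 0"
    using derivationD(2)[OF assms(1), of 0] derivationD(2)[OF assms(2), of 0] by (simp_all add: zero_fun_def)
  note * = subringD(4)[OF subring_poly_fun] derivationD[OF assms(1)] derivationD[OF assms(2)]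
  show ?thesis
    unfolding derivation_def by (auto simp: * 0 algebra_simps intro!: subringD(3)[OF subring_poly_fun])
qed

lemma left_field_coord: "left_field X (\<lambda>A. A $ i $ j) = (\<lambda>A. (A ** X) $ i $ j)"
  by (simp add: left_field_def fun_eq_iff)

lemma right_field_coord: "right_field X (\<lambda>A. A $ i $ j) = (\<lambda>A. (X ** A) $ i $ j)"
  by (simp add: right_field_def fun_eq_iff)

lemma deriv_at_linear_form:
  fixes L R :: "'k::field_char_0 ^ 'n ^ 'n"
  shows
  "deriv_at (\<lambda>A. (L ** A ** R) $ i $ j) A X = (L ** X ** R) $ i $ j"
  using deriv_at_comp_linear[of "\<lambda>A. A $ i $ j" L R A X] by (simp add: poly_fun.coord)

lemma left_field_commutator:
  fixes X Y :: "'k::field_char_0 ^ 'n ^ 'n"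
  assumes "p \<in> poly_fun"
  shows "left_field X (left_field Y p) = left_field Y (left_field X p) + left_field (X ** Y - Y ** X) p"
proof -
  have "left_field X (left_field Y p) - left_field Y (left_field X p) = left_field (X ** Y - Y ** X) p"
  proof (rule derivation_eqI[OF derivation_commutator[OF derivation_left_field derivation_left_field]
        derivation_left_field _ assms])
    fix i j :: 'n
    have "left_field X (\<lambda>A. (A ** Y) $ i $ j) = (\<lambda>A. (A ** X ** Y) $ i $ j)" for X Y :: "'k ^ 'n ^ 'n"
      using deriv_at_linear_form[of "mat 1" Y i j] by (simp add: left_field_def fun_eq_iff)
    then show "left_field X (left_field Y (\<lambda>A. A $ i $ j)) - left_field Y (left_field X (\<lambda>A. A $ i $ j)) =
        left_field (X ** Y - Y ** X) (\<lambda>A. A $ i $ j)"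
      by (simp add: left_field_coord fun_eq_iff matrix_mult_diff_right flip: matrix_mul_assoc)
  qed
  then show ?thesis by (simp add: algebra_simps)
qed

lemma left_right_field_commute:
  fixes X Y :: "'k::field_char_0 ^ 'n ^ 'n"
  assumes "p \<in> poly_fun"
  shows "right_field X (left_field Y p) = left_field Y (right_field X p)"
proof -
  have "right_field X (left_field Y p) - left_field Y (right_field X p) = left_field 0 p"
  proof (rule derivation_eqI[OF derivation_commutator[OF derivation_right_field derivation_left_field]
        derivation_left_field _ assms])
    fix i j :: 'n
    have "right_field X (\<lambda>A. (A ** Y) $ i $ j) = (\<lambda>A. (X ** A ** Y) $ i $ j)"
      using deriv_at_linear_form[of "mat 1" Y i j] by (simp add: right_field_def fun_eq_iff)
    moreover have "left_field Y (\<lambda>A. (X ** A) $ i $ j) = (\<lambda>A. (X ** A ** Y) $ i $ j)"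
      using deriv_at_linear_form[of X "mat 1" i j] by (simp add: left_field_def fun_eq_iff matrix_mul_assoc)
    ultimately show "right_field X (left_field Y (\<lambda>A. A $ i $ j)) - left_field Y (right_field X (\<lambda>A. A $ i $ j)) =
        left_field 0 (\<lambda>A. A $ i $ j)"
      by (simp add: left_field_coord right_field_coord fun_eq_iff)
  qed
  moreover have "left_field 0 p = 0" using assms by (simp add: left_field_def fun_eq_iff)
  ultimately show ?thesis by simp
qed

lemma lie_algebra_iff:
  "X \<in> lie_algebra G \<longleftrightarrow> (\<forall>p\<in>vanishing_ideal G. deriv_at p (mat 1) X = 0)"
  by (auto simp: lie_algebra_def vanishing_ideal_def dderiv_eq_deriv_at)

lemma lie_algebra_lincomb:
  "(\<And>a. a \<in> S \<Longrightarrow> X a \<in> lie_algebra G) \<Longrightarrow> (\<Sum>a\<in>S. smult_mat (c a) (X a)) \<in> lie_algebra G"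
  by (auto simp: lie_algebra_iff deriv_at_linear_comb vanishing_ideal_def)

lemma lie_algebra_closed:
  shows "0 \<in> lie_algebra G" "X \<in> lie_algebra G \<Longrightarrow> Y \<in> lie_algebra G \<Longrightarrow> X + Y \<in> lie_algebra G"
    "X \<in> lie_algebra G \<Longrightarrow> smult_mat c X \<in> lie_algebra G"
  by (auto simp: lie_algebra_iff deriv_at_add_dir deriv_at_smult_dir vanishing_ideal_def)

lemma field_vanishing_ideal:
  assumes G: "matrix_group G" and X: "X \<in> lie_algebra G" and p: "p \<in> vanishing_ideal G"
  shows "left_field X p \<in> vanishing_ideal G" "right_field X p \<in> vanishing_ideal G"
proof -
  have pf: "p \<in> poly_fun" using p by (simp add: vanishing_ideal_def)
  have "deriv_at p A (A ** X) = 0 \<and> deriv_at p A (X ** A) = 0" if A: "A \<in> G" for A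
  proof -
    have "(\<lambda>B. p (A ** B ** mat 1)) \<in> vanishing_ideal G" "(\<lambda>B. p (mat 1 ** B ** A)) \<in> vanishing_ideal G"
      using p A poly_fun_translate[OF pf] matrix_groupD(2)[OF G] by (auto simp: vanishing_ideal_def simp del: matrix_mul_lid matrix_mul_rid) simp_all
    then have "deriv_at (\<lambda>B. p (A ** B ** mat 1)) (mat 1) X = 0" "deriv_at (\<lambda>B. p (mat 1 ** B ** A)) (mat 1) X = 0"
      using X by (auto simp: lie_algebra_iff)
    then show ?thesis unfolding deriv_at_comp_linear[OF pf] by simp
  qed
  then show "left_field X p \<in> vanishing_ideal G" "right_field X p \<in> vanishing_ideal G"
    using derivationD(1)[OF derivation_left_field pf] derivationD(1)[OF derivation_right_field pf]
    by (auto simp: vanishing_ideal_def left_field_def right_field_def)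
qed

section \<open>Independence of characters and additive functions\<close>

text \<open>Artin's argument: comparing the relation at \<open>b a\<close> with \<open>\<psi>(b)\<close> times the relation at \<open>a\<close> eliminates the
  character \<open>\<psi>\<close>.\<close>

lemma characters_independent:
  fixes X :: "('a \<Rightarrow> 'k::field) set"
  assumes "finite X" "X \<subseteq> extensional M" "e \<in> M" "\<And>a b. a \<in> M \<Longrightarrow> b \<in> M \<Longrightarrow> mul a b \<in> M"
    and "\<And>\<eta> a b. \<eta> \<in> X \<Longrightarrow> a \<in> M \<Longrightarrow> b \<in> M \<Longrightarrow> \<eta> (mul a b) = \<eta> a * \<eta> b"
    and "\<And>\<eta>. \<eta> \<in> X \<Longrightarrow> \<eta> e = 1"
    and "\<And>a. a \<in> M \<Longrightarrow> (\<Sum>\<eta>\<in>X. c \<eta> * \<eta> a) = 0"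
    and "\<eta> \<in> X"
  shows "c \<eta> = 0"
  using assms(1,2,5-8)
proof (induction X arbitrary: c \<eta> rule: finite_induct)
  case (insert \<psi> X)
  note mult = insert.prems(2) and one = insert.prems(3) and rel = insert.prems(4)
  have X: "c \<eta> = 0" if \<eta>: "\<eta> \<in> X" for \<eta>
  proof -
    have "\<eta> \<noteq> \<psi>" using \<eta> insert.hyps by blast
    then obtain b where b: "b \<in> M" "\<eta> b \<noteq> \<psi> b"
      using insert.prems(1) \<eta> by (metis extensionalityI insertCI subsetD)
    have "(c \<eta> * (\<eta> b - \<psi> b)) = 0"
    proof (rule insert.IH[OF _ _ _ _ \<eta>])
      fix a assume a: "a \<in> M"
      have "(\<Sum>\<eta>\<in>insert \<psi> X. c \<eta> * \<eta> (mul b a)) = 0"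
        using rel assms(4)[OF b(1) a] by blast
      moreover have "(\<Sum>\<eta>\<in>insert \<psi> X. c \<eta> * \<eta> (mul b a)) = (\<Sum>\<eta>\<in>insert \<psi> X. c \<eta> * \<eta> b * \<eta> a)"
        using mult[OF _ b(1) a] by (intro sum.cong) (auto simp: mult.assoc)
      ultimately have 1: "(\<Sum>\<eta>\<in>insert \<psi> X. c \<eta> * \<eta> b * \<eta> a) = 0" by simp
      have 2: "(\<Sum>\<eta>\<in>insert \<psi> X. c \<eta> * \<psi> b * \<eta> a) = 0"
        using arg_cong[OF rel[OF a], of "\<lambda>z. \<psi> b * z"]
        by (simp add: sum_distrib_left algebra_simps)
      have "(\<Sum>\<eta>\<in>insert \<psi> X. c \<eta> * (\<eta> b - \<psi> b) * \<eta> a) = 0"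
        using 1 2 by (simp add: algebra_simps sum_subtractf)
      then show "(\<Sum>\<eta>\<in>X. c \<eta> * (\<eta> b - \<psi> b) * \<eta> a) = 0"
        using insert.hyps by simp
    qed (use insert.prems in auto)
    then show ?thesis using b(2) by simp
  qed
  then have "c \<psi> * \<psi> e = 0" using rel[OF assms(3)] insert.hyps by simp
  then have "c \<psi> = 0" using one[of \<psi>] by simp
  then show ?case using X insert.prems(5) by blast
qed simp

text \<open>The form in which Dedekind's theorem is used: in a linear relation between characters the
  coefficients of equal characters add up to zero, and so does any weighted sum of coefficients
  whose weights depend on the character only.\<close>

lemma characters_relation_weighted:
  fixes \<eta> :: "'i \<Rightarrow> 'a \<Rightarrow> 'k::field"
  assumes fin: "finite S" and M: "e \<in> M" "\<And>a b. a \<in> M \<Longrightarrow> b \<in> M \<Longrightarrow> mul a b \<in> M"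
    and mult: "\<And>i a b. i \<in> S \<Longrightarrow> a \<in> M \<Longrightarrow> b \<in> M \<Longrightarrow> \<eta> i (mul a b) = \<eta> i a * \<eta> i b"
    and one: "\<And>i. i \<in> S \<Longrightarrow> \<eta> i e = 1"
    and rel: "\<And>a. a \<in> M \<Longrightarrow> (\<Sum>i\<in>S. c i * \<eta> i a) = 0"
    and h: "\<And>i j. i \<in> S \<Longrightarrow> j \<in> S \<Longrightarrow> (\<And>a. a \<in> M \<Longrightarrow> \<eta> i a = \<eta> j a) \<Longrightarrow> h i = h j"
  shows "(\<Sum>i\<in>S. h i * c i) = 0"
proof -
  define \<kappa> where "\<kappa> i = restrict (\<eta> i) M" for i
  define C where "C y = (\<Sum>i\<in>{i\<in>S. \<kappa> i = y}. c i)" for y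
  have C: "C y = 0" if "y \<in> \<kappa> ` S" for y
  proof (rule characters_independent[where X = "\<kappa> ` S" and c = C and \<eta> = y and M = M and e = e and mul = mul])
    fix a assume a: "a \<in> M"
    have "(\<Sum>y\<in>\<kappa> ` S. C y * y a) = (\<Sum>y\<in>\<kappa> ` S. \<Sum>i\<in>{i\<in>S. \<kappa> i = y}. c i * \<eta> i a)"
      unfolding C_def sum_distrib_right using a by (intro sum.cong refl) (auto simp: \<kappa>_def)
    also have "\<dots> = (\<Sum>i\<in>S. c i * \<eta> i a)" by (rule sum.image_gen[OF fin, symmetric])
    finally show "(\<Sum>y\<in>\<kappa> ` S. C y * y a) = 0" using rel[OF a] by simp
  qed (use that fin M mult one in \<open>auto simp: \<kappa>_def\<close>)
  have "(\<Sum>i\<in>S. h i * c i) = (\<Sum>y\<in>\<kappa> ` S. \<Sum>i\<in>{i\<in>S. \<kappa> i = y}. h i * c i)"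
    by (rule sum.image_gen[OF fin])
  also have "\<dots> = 0"
  proof (rule sum.neutral, rule ballI)
    fix y assume y: "y \<in> \<kappa> ` S"
    then obtain j where j: "j \<in> S" "y = \<kappa> j" by blast
    have "h i = h j" if "i \<in> S" "\<kappa> i = y" for i
      using that j by (intro h) (auto simp: \<kappa>_def restrict_def fun_eq_iff split: if_splits)
    then have "(\<Sum>i\<in>{i\<in>S. \<kappa> i = y}. h i * c i) = h j * C y"
      unfolding C_def sum_distrib_left by (intro sum.cong) auto
    then show "(\<Sum>i\<in>{i\<in>S. \<kappa> i = y}. h i * c i) = 0" using C[OF y] by simp
  qed
  finally show ?thesis .
qed

text \<open>For \<open>f\<close> and \<open>g\<close> without a common zero at \<open>d\<close>, the value \<open>f d + m g d\<close> vanishes for at most one natural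
  number \<open>m\<close>; so some \<open>m\<close> works for all \<open>d\<close> at once.\<close>

lemma exists_nonvanishing_on_finite:
  fixes F :: "('a \<Rightarrow> 'k::field_char_0) set"
  assumes "finite D" "F \<noteq> {}" "\<And>d. d \<in> D \<Longrightarrow> \<exists>f\<in>F. f d \<noteq> 0"
    and comb: "\<And>f g m. f \<in> F \<Longrightarrow> g \<in> F \<Longrightarrow> (\<lambda>x. f x + of_nat m * g x) \<in> F"
  shows "\<exists>f\<in>F. \<forall>d\<in>D. f d \<noteq> 0"
  using assms(1,3)
proof (induction D rule: finite_induct)
  case empty
  then show ?case using assms(2) by auto
next
  case (insert d D)
  then obtain f g where f: "f \<in> F" "\<forall>d\<in>D. f d \<noteq> 0" and g: "g \<in> F" "g d \<noteq> 0" by blast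
  have "finite {m. f d' + of_nat m * g d' = 0}" if "f d' \<noteq> 0 \<or> g d' \<noteq> 0" for d'
  proof (rule finite_subset)
    show "{m. f d' + of_nat m * g d' = 0} \<subseteq> {m. of_nat m = - f d' / g d'}"
    proof (rule subsetI, unfold mem_Collect_eq)
      fix m :: nat assume m: "f d' + of_nat m * g d' = 0"
      then have "g d' \<noteq> 0" using that by auto
      moreover have "of_nat m * g d' = - f d'" using m by (simp add: eq_neg_iff_add_eq_0 add.commute)
      ultimately show "of_nat m = - f d' / g d'" by (simp add: eq_divide_eq del: divide_minus_left minus_divide_left)
    qed
    have "inj_on (of_nat :: nat \<Rightarrow> 'k) UNIV" by (simp add: inj_of_nat)
    then show "finite {m::nat. of_nat m = - f d' / g d'}"
      using finite_vimageI[of "{- f d' / g d'}" "of_nat :: nat \<Rightarrow> 'k"] by (simp add: vimage_def)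
  qed
  then have "finite (\<Union>d'\<in>insert d D. {m. f d' + of_nat m * g d' = 0})"
    using insert.hyps(1) f(2) g(2) by (intro finite_UN_I) auto
  from ex_new_if_finite[OF infinite_UNIV_nat this]
  obtain m :: nat where "\<forall>d'\<in>insert d D. f d' + of_nat m * g d' \<noteq> 0" by blast
  then show ?case by (intro bexI[OF _ comb[OF f(1) g(1), of m]]) simp
qed

interpretation rat_space: vector_space "\<lambda>(q::rat) (x::'k::field_char_0). of_rat q * x"
  by unfold_locales (simp_all add: algebra_simps of_rat_add of_rat_mult)

text \<open>Here \<open>\<phi> b\<close> is the coordinate function of \<open>b\<close> for a Hamel basis of the field over the rationals,
  and 0 if \<open>b\<close> is not in the basis.\<close>

lemma rational_coordinates:
  obtains \<phi> :: "'k::field_char_0 \<Rightarrow> 'k \<Rightarrow> rat"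
  where "\<And>b x y. \<phi> b (x + y) = \<phi> b x + \<phi> b y"
    and "\<And>x. finite {b. \<phi> b x \<noteq> 0}" "\<And>x. (\<Sum>b | \<phi> b x \<noteq> 0. of_rat (\<phi> b x) * b) = x"
proof -
  obtain B :: "'k set" where B: "rat_space.independent B" "UNIV \<subseteq> rat_space.span B"
    using rat_space.maximal_independent_subset[of UNIV] by metis
  have span: "x \<in> rat_space.span B" for x using B(2) by blast
  let ?\<phi> = "\<lambda>b x. rat_space.representation B x b"
  show ?thesis
  proof (rule that[of ?\<phi>])
    fix b x y show "?\<phi> b (x + y) = ?\<phi> b x + ?\<phi> b y"
      by (subst rat_space.representation_add[OF B(1) span span]) (rule refl)
  next
    fix x show "finite {b. ?\<phi> b x \<noteq> 0}" by (rule rat_space.finite_representation)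
    show "(\<Sum>b | ?\<phi> b x \<noteq> 0. of_rat (?\<phi> b x) * b) = x"
      by (rule rat_space.sum_nonzero_representation_eq[OF B(1) span])
  qed
qed

lemma exists_rational_additive_nonvanishing:
  fixes D :: "'k::field_char_0 set"
  assumes "finite D" "0 \<notin> D"
  shows "\<exists>\<phi> :: 'k \<Rightarrow> rat. (\<forall>x y. \<phi> (x + y) = \<phi> x + \<phi> y) \<and> (\<forall>d\<in>D. \<phi> d \<noteq> 0)"
proof -
  let ?F = "{\<phi> :: 'k \<Rightarrow> rat. \<forall>x y. \<phi> (x + y) = \<phi> x + \<phi> y}"
  obtain \<phi> :: "'k \<Rightarrow> 'k \<Rightarrow> rat" where \<phi>: "\<And>b x y. \<phi> b (x + y) = \<phi> b x + \<phi> b y"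
      "\<And>x. (\<Sum>b | \<phi> b x \<noteq> 0. of_rat (\<phi> b x) * b) = x"
    by (rule rational_coordinates) blast
  have "\<exists>f\<in>?F. f d \<noteq> 0" if "d \<in> D" for d
  proof -
    have "d \<noteq> 0" using that assms(2) by auto
    then have "\<exists>b. \<phi> b d \<noteq> 0" using \<phi>(2)[of d] by (metis (mono_tags, lifting) empty_Collect_eq sum.empty)
    then obtain b where "\<phi> b d \<noteq> 0" ..
    then show ?thesis using \<phi>(1) by (intro bexI[of _ "\<phi> b"]) simp_all
  qed
  moreover have "\<phi> 0 \<in> ?F" using \<phi>(1) by simp
  then have "?F \<noteq> {}" by blast
  moreover have "(\<lambda>x. f x + of_nat m * g x) \<in> ?F" if "f \<in> ?F" "g \<in> ?F" for f g m
    using that by (simp add: distrib_left)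
  ultimately have "\<exists>f\<in>?F. \<forall>d\<in>D. f d \<noteq> 0"
    by (intro exists_nonvanishing_on_finite[OF assms(1)])
  then show ?thesis by auto
qed

section \<open>Functions vanishing to high order at the identity\<close>

definition shifted_coord :: "'n \<times> 'n \<Rightarrow> 'k::field ^ 'n ^ 'n \<Rightarrow> 'k" where
  "shifted_coord a A = A $ fst a $ snd a - mat 1 $ fst a $ snd a"

text \<open>These are the polynomial functions whose restriction to \<open>G\<close> vanishes to order \<open>i\<close> at the identity.\<close>

definition order_ideal :: "('k::field ^ 'n ^ 'n) set \<Rightarrow> nat \<Rightarrow> ('k ^ 'n ^ 'n \<Rightarrow> 'k) set" where
  "order_ideal G = ideal_power poly_fun (range shifted_coord) (vanishing_ideal G)"

lemma shifted_coord_poly_fun: "shifted_coord a \<in> poly_fun"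
  unfolding shifted_coord_def[abs_def] by (intro poly_fun_minus poly_fun.coord poly_fun.const)

lemma shifted_coord_one [simp]: "shifted_coord a (mat 1) = 0"
  by (simp add: shifted_coord_def)

lemma range_shifted_coord_poly_fun: "range shifted_coord \<subseteq> poly_fun"
  using shifted_coord_poly_fun by blast

lemmas ideal_of_order_ideal = ideal_of_ideal_power[OF subring_poly_fun range_shifted_coord_poly_fun
    ideal_of_vanishing_ideal, folded order_ideal_def]

lemmas order_ideal_Suc = ideal_power_Suc[OF subring_poly_fun range_shifted_coord_poly_fun
    ideal_of_vanishing_ideal, folded order_ideal_def]

lemma order_ideal_0: "p \<in> poly_fun \<Longrightarrow> p \<in> order_ideal G 0"
  unfolding order_ideal_def by (rule ideal_power_base)

lemma order_ideal_gen: "p \<in> order_ideal G i \<Longrightarrow> shifted_coord a * p \<in> order_ideal G (Suc i)"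
  unfolding order_ideal_def by (intro ideal_power_gen) auto

lemma vanishing_ideal_order_ideal: "p \<in> vanishing_ideal G \<Longrightarrow> p \<in> order_ideal G i"
  unfolding order_ideal_def by (rule ideal_power_ideal)

lemma order_ideal_diff: "p \<in> order_ideal G i \<Longrightarrow> q \<in> order_ideal G i \<Longrightarrow> p - q \<in> order_ideal G i"
  by (rule ideal_of_diff[OF ideal_of_order_ideal subring_poly_fun])

lemma order_ideal_poly_fun: "p \<in> order_ideal G i \<Longrightarrow> p \<in> poly_fun"
  by (rule ideal_ofD(1)[OF ideal_of_order_ideal])

lemma order_ideal_cmult: "p \<in> order_ideal G i \<Longrightarrow> (\<lambda>_. c) * p \<in> order_ideal G i"
  by (rule ideal_ofD(4)[OF ideal_of_order_ideal poly_fun.const])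

lemma order_ideal_mult_vanishing:
  assumes "p \<in> poly_fun" "p (mat 1) = 0" "y \<in> order_ideal G i"
  shows "p * y \<in> order_ideal G (Suc i)"
proof -
  note I = ideal_ofD[OF ideal_of_order_ideal]
  have "(p - (\<lambda>_. p (mat 1))) * y \<in> order_ideal G (Suc i)"
    using assms(1)
  proof induction
    case (const c)
    have "((\<lambda>_. c) - (\<lambda>_. c)) * y = 0" by (simp add: fun_eq_iff)
    then show ?case by (simp only: I(2))
  next
    case (coord i j)
    have "((\<lambda>A. A $ i $ j) - (\<lambda>_. mat 1 $ i $ j)) * y = shifted_coord (i, j) * y"
      by (simp add: fun_eq_iff shifted_coord_def)
    then show ?case by (simp only: order_ideal_gen[OF assms(3)])
  next
    case (add p q)
    then have "(p - (\<lambda>_. p (mat 1))) * y + (q - (\<lambda>_. q (mat 1))) * y \<in> order_ideal G (Suc i)"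
      by (intro I(3))
    also have "(p - (\<lambda>_. p (mat 1))) * y + (q - (\<lambda>_. q (mat 1))) * y =
        ((\<lambda>A. p A + q A) - (\<lambda>_. p (mat 1) + q (mat 1))) * y"
      by (simp add: fun_eq_iff algebra_simps)
    finally show ?case .
  next
    case (mult p q)
    have "p * ((q - (\<lambda>_. q (mat 1))) * y) + (\<lambda>_. q (mat 1)) * ((p - (\<lambda>_. p (mat 1))) * y)
        \<in> order_ideal G (Suc i)"
      by (rule I(3)[OF I(4)[OF mult.hyps(1) mult.IH(2)] I(4)[OF poly_fun.const mult.IH(1)]])
    also have "p * ((q - (\<lambda>_. q (mat 1))) * y) + (\<lambda>_. q (mat 1)) * ((p - (\<lambda>_. p (mat 1))) * y) =
        ((\<lambda>A. p A * q A) - (\<lambda>_. p (mat 1) * q (mat 1))) * y"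
      by (simp add: fun_eq_iff algebra_simps)
    finally show ?case .
  qed
  moreover have "p - (\<lambda>_. p (mat 1)) = p" using assms(2) by (simp add: fun_eq_iff)
  ultimately show ?thesis by (simp only:)
qed

lemma order_ideal_1I: "p \<in> poly_fun \<Longrightarrow> p (mat 1) = 0 \<Longrightarrow> p \<in> order_ideal G 1"
  using order_ideal_mult_vanishing[OF _ _ order_ideal_0[OF subringD(1)[OF subring_poly_fun]], of p G]
  by (simp only: mult_1_right One_nat_def)

lemma order_ideal_1D:
  assumes "mat 1 \<in> G" "p \<in> order_ideal G (Suc i)"
  shows "p (mat 1) = 0"
proof -
  have "p \<in> ideal_power poly_fun (range shifted_coord) (vanishing_ideal G) j \<Longrightarrow> j = Suc i \<Longrightarrow> p (mat 1) = 0" for j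
    by (induction rule: ideal_power_induct) (use assms(1) in \<open>auto simp: vanishing_ideal_def\<close>)
  then show ?thesis using assms(2) by (simp add: order_ideal_def)
qed

lemma order_ideal_mult:
  assumes "p \<in> order_ideal G i" "y \<in> order_ideal G j"
  shows "p * y \<in> order_ideal G (i + j)"
proof -
  note I = ideal_ofD[OF ideal_of_order_ideal]
  have "p \<in> ideal_power poly_fun (range shifted_coord) (vanishing_ideal G) i \<Longrightarrow> p * y \<in> order_ideal G (i + j)"
    for i
  proof (induction rule: ideal_power_induct)
    case (base p)
    then show ?case by (simp only: I(4)[OF _ assms(2)] add_0)
  next
    case (ideal p i)
    then show ?case
      using ideal_ofD(5)[OF ideal_of_vanishing_ideal order_ideal_poly_fun[OF assms(2)]]
      by (intro vanishing_ideal_order_ideal)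
  next
    case (gen b p i)
    then obtain a where b: "b = shifted_coord a" by blast
    have "b * (p * y) \<in> order_ideal G (Suc (i + j))" unfolding b by (rule order_ideal_gen[OF gen.IH])
    then show ?case by (simp only: mult.assoc add_Suc)
  next
    case (add p i q)
    show ?case unfolding distrib_right by (rule I(3)[OF add.IH])
  qed
  then show ?thesis using assms(1) by (simp add: order_ideal_def)
qed

text \<open>A derivation in general lowers the order of vanishing by one.  The order is preserved if the
  corresponding vector field vanishes at the identity.\<close>

lemma derivation_order_ideal:
  assumes \<delta>: "derivation \<delta>" and I: "\<And>p. p \<in> vanishing_ideal G \<Longrightarrow> \<delta> p \<in> vanishing_ideal G"
    and one: "\<And>a. \<delta> (shifted_coord a) (mat 1) = 0" and p: "p \<in> order_ideal G i"
  shows "\<delta> p \<in> order_ideal G i"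
proof -
  have "p \<in> ideal_power poly_fun (range shifted_coord) (vanishing_ideal G) i \<Longrightarrow> \<delta> p \<in> order_ideal G i"
  proof (induction rule: ideal_power_induct)
    case (base p)
    then show ?case by (intro order_ideal_0 derivationD(1)[OF \<delta>])
  next
    case (ideal p i)
    then show ?case by (intro vanishing_ideal_order_ideal I)
  next
    case (gen b p i)
    then obtain a where b: "b = shifted_coord a" by blast
    have p: "p \<in> order_ideal G i" using gen by (simp add: order_ideal_def)
    have "b * \<delta> p + \<delta> b * p \<in> order_ideal G (Suc i)"
      unfolding b
      by (intro ideal_ofD(3)[OF ideal_of_order_ideal] order_ideal_gen gen
          order_ideal_mult_vanishing derivationD(1)[OF \<delta>] shifted_coord_poly_fun one p)
    moreover have "\<delta> (b * p) = b * \<delta> p + \<delta> b * p"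
      using derivationD(4)[OF \<delta> shifted_coord_poly_fun order_ideal_poly_fun[OF p], of a] b by (simp add: mult.commute)
    ultimately show ?case by (simp only:)
  next
    case (add p i q)
    then have "p \<in> poly_fun" "q \<in> poly_fun"
      using order_ideal_poly_fun unfolding order_ideal_def by blast+
    then have "\<delta> (p + q) = \<delta> p + \<delta> q" by (rule derivationD(3)[OF \<delta>])
    then show ?case using ideal_ofD(3)[OF ideal_of_order_ideal add.IH] by (simp only:)
  qed
  then show ?thesis using p by (simp add: order_ideal_def)
qed

text \<open>A derivation that is the identity on \<open>\<mm>/\<mm>\<^sup>2\<close> multiplies \<open>\<mm>\<^sup>i/\<mm>\<^sup>i\<^sup>+\<^sup>1\<close> by \<open>i\<close>, for \<open>\<mm>\<close> the maximal ideal of the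
  identity on \<open>G\<close>.\<close>

lemma euler_derivation:
  assumes \<delta>: "derivation \<delta>" and I: "\<And>p. p \<in> vanishing_ideal G \<Longrightarrow> \<delta> p \<in> vanishing_ideal G"
    and gen2: "\<And>a. \<delta> (shifted_coord a) - shifted_coord a \<in> order_ideal G 2" and p: "p \<in> order_ideal G i"
  shows "\<delta> p - of_nat i * p \<in> order_ideal G (Suc i)"
proof -
  note O = ideal_ofD[OF ideal_of_order_ideal]
  have "p \<in> ideal_power poly_fun (range shifted_coord) (vanishing_ideal G) i \<Longrightarrow>
      \<delta> p - of_nat i * p \<in> order_ideal G (Suc i)"
  proof (induction rule: ideal_power_induct)
    case (base p)
    have "\<delta> (shifted_coord a) \<in> order_ideal G 1" for a
    proof -
      have "\<delta> (shifted_coord a) - shifted_coord a \<in> order_ideal G 1"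
        using order_ideal_Suc gen2[of a] by (simp add: numeral_2_eq_2)
      then have "(\<delta> (shifted_coord a) - shifted_coord a) + shifted_coord a \<in> order_ideal G 1"
        by (intro O(3) order_ideal_1I[OF shifted_coord_poly_fun shifted_coord_one])
      then show ?thesis by simp
    qed
    note gen1 = this
    from base have "\<delta> p \<in> order_ideal G 1"
    proof induction
      case (const c)
      show ?case unfolding derivationD(2)[OF \<delta>] by (rule O(2))
    next
      case (coord i j)
      have eq: "(\<lambda>A. A $ i $ j) = shifted_coord (i, j) + (\<lambda>_. mat 1 $ i $ j)"
        by (simp add: fun_eq_iff shifted_coord_def)
      show ?case
        unfolding eq using gen1 by (simp add: derivationD(2,3)[OF \<delta>] shifted_coord_poly_fun poly_fun.const)
    next
      case (add p q)
      have eq: "(\<lambda>A. p A + q A) = p + q" by (simp add: fun_eq_iff)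
      show ?case unfolding eq derivationD(3)[OF \<delta> add.hyps] by (rule O(3)[OF add.IH])
    next
      case (mult p q)
      have eq: "(\<lambda>A. p A * q A) = p * q" by (simp add: fun_eq_iff)
      show ?case unfolding eq derivationD(4)[OF \<delta> mult.hyps]
        by (rule O(3)[OF O(4)[OF mult.hyps(1) mult.IH(2)] O(4)[OF mult.hyps(2) mult.IH(1)]])
    qed
    moreover have "\<delta> p - of_nat 0 * p = \<delta> p" by simp
    ultimately show ?case by (simp only: One_nat_def)
  next
    case (ideal p i)
    have "\<delta> p - of_nat i * p \<in> vanishing_ideal G"
      unfolding of_nat_fun
      by (rule ideal_of_diff[OF ideal_of_vanishing_ideal subring_poly_fun I[OF ideal]
            ideal_ofD(4)[OF ideal_of_vanishing_ideal poly_fun.const ideal]])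
    then show ?case by (rule vanishing_ideal_order_ideal)
  next
    case (gen b p i)
    then obtain a where b: "b = shifted_coord a" by blast
    have p: "p \<in> order_ideal G i" using gen by (simp add: order_ideal_def)
    have "b * (\<delta> p - of_nat i * p) + (\<delta> b - b) * p \<in> order_ideal G (Suc (Suc i))"
      unfolding b using order_ideal_mult[OF gen2 p]
      by (intro O(3) order_ideal_gen gen) simp
    also have "b * (\<delta> p - of_nat i * p) + (\<delta> b - b) * p = \<delta> (b * p) - of_nat (Suc i) * (b * p)"
      using derivationD(4)[OF \<delta> shifted_coord_poly_fun order_ideal_poly_fun[OF p], of a] b
      by (simp add: algebra_simps)
    finally show ?case .
  next
    case (add p i q)
    have pq: "p \<in> poly_fun" "q \<in> poly_fun"
      using add order_ideal_poly_fun unfolding order_ideal_def by blast+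
    have "(\<delta> p - of_nat i * p) + (\<delta> q - of_nat i * q) \<in> order_ideal G (Suc i)"
      by (intro O(3) add)
    moreover have "\<delta> (p + q) - of_nat i * (p + q) = (\<delta> p - of_nat i * p) + (\<delta> q - of_nat i * q)"
      unfolding derivationD(3)[OF \<delta> pq] by (simp add: algebra_simps)
    ultimately show ?case by (simp only:)
  qed
  then show ?thesis using p by (simp add: order_ideal_def)
qed

lemma taylor_first_order:
  assumes "p \<in> poly_fun"
  shows "(\<lambda>A. p A - p (mat 1) - deriv_at p (mat 1) (A - mat 1)) \<in> order_ideal G 2"
  using assms
proof induction
  case (const c)
  then show ?case using ideal_ofD(2)[OF ideal_of_order_ideal] by (simp add: zero_fun_def)
next
  case (coord i j)
  then show ?case using ideal_ofD(2)[OF ideal_of_order_ideal] by (simp add: zero_fun_def)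
next
  case (add p q)
  have "(\<lambda>A. p A - p (mat 1) - deriv_at p (mat 1) (A - mat 1)) +
      (\<lambda>A. q A - q (mat 1) - deriv_at q (mat 1) (A - mat 1)) \<in> order_ideal G 2"
    by (intro ideal_ofD(3)[OF ideal_of_order_ideal] add.IH)
  also have "(\<lambda>A. p A - p (mat 1) - deriv_at p (mat 1) (A - mat 1)) +
      (\<lambda>A. q A - q (mat 1) - deriv_at q (mat 1) (A - mat 1)) =
      (\<lambda>A. p A + q A - (p (mat 1) + q (mat 1)) - deriv_at (\<lambda>A. p A + q A) (mat 1) (A - mat 1))"
    by (simp add: fun_eq_iff deriv_at_add[OF add.hyps] algebra_simps)
  finally show ?case .
next
  case (mult p q)
  let ?p = "\<lambda>A. p A - p (mat 1)" and ?q = "\<lambda>A. q A - q (mat 1)"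
  let ?R = "\<lambda>p A. p A - p (mat 1) - deriv_at p (mat 1) (A - mat 1)"
  have pf: "?p \<in> poly_fun" "?q \<in> poly_fun"
    by (rule poly_fun_minus[OF mult.hyps(1) poly_fun.const], rule poly_fun_minus[OF mult.hyps(2) poly_fun.const])
  have "?p * ?q \<in> order_ideal G 2"
    using order_ideal_mult_vanishing[OF pf(1) _ order_ideal_1I[OF pf(2)]] by (simp add: numeral_2_eq_2)
  then have "?p * ?q + (\<lambda>_. p (mat 1)) * ?R q + (\<lambda>_. q (mat 1)) * ?R p \<in> order_ideal G 2"
    by (intro ideal_ofD(3)[OF ideal_of_order_ideal] order_ideal_cmult mult.IH)
  also have "?p * ?q + (\<lambda>_. p (mat 1)) * ?R q + (\<lambda>_. q (mat 1)) * ?R p = ?R (\<lambda>A. p A * q A)"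
    by (simp add: fun_eq_iff deriv_at_mult[OF mult.hyps] algebra_simps)
  finally show ?case .
qed

text \<open>The Lie algebra is the annihilator of the space \<open>N\<close> of the differentials at the identity of the
  functions vanishing on \<open>G\<close>.  If \<open>R\<close> is a linear projection of the covectors onto \<open>N\<close>, then
  \<open>1 - R\<close> is the transpose of a projection of the matrices onto the Lie algebra, here
  described by the images \<open>Q a\<close> of the elementary matrices.\<close>

lemma lie_algebra_projection:
  fixes G :: "('k::field_char_0 ^ 'n ^ 'n) set"
  obtains Q :: "'n \<times> 'n \<Rightarrow> 'k ^ 'n ^ 'n"
  where "\<And>a. Q a \<in> lie_algebra G"
    and "\<And>b. \<exists>p\<in>vanishing_ideal G. \<forall>a.
      deriv_at p (mat 1) (unit_mat (fst a) (snd a)) = (if a = b then 1 else 0) - Q a $ fst b $ snd b"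
proof -
  define D :: "('k ^ 'n ^ 'n \<Rightarrow> 'k) \<Rightarrow> 'k ^ ('n \<times> 'n)" where
    "D p = (\<chi> a. deriv_at p (mat 1) (unit_mat (fst a) (snd a)))" for p
  define N where "N = D ` vanishing_ideal G"
  have pf: "p \<in> poly_fun" if "p \<in> vanishing_ideal G" for p using that by (simp add: vanishing_ideal_def)
  note I = ideal_ofD[OF ideal_of_vanishing_ideal]
  have D0: "D 0 = 0" by (simp add: D_def vec_eq_iff zero_fun_def)
  have D_add: "D (p + q) = D p + D q" if "p \<in> poly_fun" "q \<in> poly_fun" for p q
    using that by (simp add: D_def vec_eq_iff plus_fun_def deriv_at_add)
  have D_mult: "D ((\<lambda>_. c) * p) = c *s D p" if "p \<in> poly_fun" for c p
    using that by (simp add: D_def vec_eq_iff times_fun_def deriv_at_mult poly_fun.const)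
  have "vec.subspace N"
    unfolding vec.subspace_def
  proof (intro conjI ballI allI)
    show "0 \<in> N" using D0 I(2) unfolding N_def by (metis imageI)
    show "x + y \<in> N" if "x \<in> N" "y \<in> N" for x y
      using that D_add[OF pf pf] I(3) unfolding N_def by (smt (verit) imageE imageI)
    show "c *s x \<in> N" if "x \<in> N" for c x
      using that D_mult[OF pf] I(4)[OF poly_fun.const] unfolding N_def by (smt (verit) imageE imageI)
  qed
  then obtain R where R: "range R \<subseteq> N" "Vector_Spaces.linear (*s) (*s) R" "\<forall>v\<in>N. R v = v"
    using vec.linear_exists_left_inverse_on[OF vec.linear_id, of N] by auto
  interpret R: Vector_Spaces.linear "(*s)" "(*s)" R by (rule R(2))
  define Q :: "'n \<times> 'n \<Rightarrow> 'k ^ 'n ^ 'n" where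
    "Q a = (\<chi> i j. (if a = (i, j) then 1 else 0) - R (axis (i, j) 1) $ a)" for a
  have "Q a \<in> lie_algebra G" for a
    unfolding lie_algebra_iff
  proof
    fix p assume p: "p \<in> vanishing_ideal G"
    have "deriv_at p (mat 1) (Q a) = (\<Sum>b\<in>UNIV. Q a $ fst b $ snd b * D p $ b)"
      by (subst deriv_at_expand[OF pf[OF p]]) (simp add: D_def)
    also have "\<dots> = (\<Sum>b\<in>UNIV. (if a = b then 1 else 0) * D p $ b) - (\<Sum>b\<in>UNIV. D p $ b * R (axis b 1) $ a)"
      by (simp add: Q_def algebra_simps sum_subtractf)
    also have "(\<Sum>b\<in>UNIV. (if a = b then 1 else 0) * D p $ b) = (\<Sum>b\<in>UNIV. if b = a then D p $ a else 0)"
      by (intro sum.cong) auto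
    also have "\<dots> = D p $ a" by simp
    also have "(\<Sum>b\<in>UNIV. D p $ b * R (axis b 1) $ a) = R (\<Sum>b\<in>UNIV. D p $ b *s axis b 1) $ a"
      by (simp add: R.sum R.scale)
    also have "(\<Sum>b\<in>UNIV. D p $ b *s axis b 1) = D p" by (rule basis_expansion)
    also have "R (D p) = D p" using R(3) p by (auto simp: N_def)
    finally show "deriv_at p (mat 1) (Q a) = 0" by simp
  qed
  moreover have "\<exists>p\<in>vanishing_ideal G. \<forall>a.
      deriv_at p (mat 1) (unit_mat (fst a) (snd a)) = (if a = b then 1 else 0) - Q a $ fst b $ snd b" for b
  proof -
    have "R (axis b 1) \<in> N" using R(1) by blast
    then obtain p where p: "p \<in> vanishing_ideal G" "R (axis b 1) = D p" by (auto simp: N_def)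
    have "deriv_at p (mat 1) (unit_mat (fst a) (snd a)) = D p $ a" for a by (simp add: D_def)
    then show ?thesis using p by (intro bexI[of _ p]) (auto simp: Q_def)
  qed
  ultimately show ?thesis by (rule that)
qed

text \<open>With \<open>Q\<close> as in the projection lemma, the derivation \<open>\<Sum>\<^sub>a x\<^sub>a Q\<^sub>a\<close> is tangent to \<open>G\<close>.  It maps the shifted
  coordinate \<open>x\<^sub>b\<close> to \<open>\<Sum>\<^sub>a x\<^sub>a (Q\<^sub>a)\<^sub>b\<close> in first order.  This differs from \<open>x\<^sub>b\<close> by the linear part of a
  function that vanishes on \<open>G\<close>, hence by a function of order 2 on \<open>G\<close>.\<close>

lemma euler_field:
  fixes G :: "('k::field_char_0 ^ 'n ^ 'n) set"
  assumes G: "matrix_group G"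
  obtains Q :: "'n \<times> 'n \<Rightarrow> 'k ^ 'n ^ 'n"
  where "\<And>a. Q a \<in> lie_algebra G"
    and "\<And>p i. p \<in> order_ideal G i \<Longrightarrow>
      (\<Sum>a\<in>UNIV. shifted_coord a * left_field (Q a) p) - of_nat i * p \<in> order_ideal G (Suc i)"
proof -
  obtain Q :: "'n \<times> 'n \<Rightarrow> 'k ^ 'n ^ 'n" where Q: "\<And>a. Q a \<in> lie_algebra G"
    "\<And>b. \<exists>p\<in>vanishing_ideal G. \<forall>a.
      deriv_at p (mat 1) (unit_mat (fst a) (snd a)) = (if a = b then 1 else 0) - Q a $ fst b $ snd b"
    by (rule lie_algebra_projection[of G]) blast
  define E where "E p = (\<Sum>a\<in>UNIV. shifted_coord a * left_field (Q a) p)" for p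
  note O = ideal_ofD[OF ideal_of_order_ideal]
  have fs: "(\<Sum>a\<in>S. f a) x = (\<Sum>a\<in>S. f a x)" for f :: "'n \<times> 'n \<Rightarrow> 'k ^ 'n ^ 'n \<Rightarrow> 'k" and S x
    by (induction S rule: infinite_finite_induct) auto
  have "derivation E"
    unfolding derivation_def
  proof (intro conjI ballI allI)
    fix p q :: "'k ^ 'n ^ 'n \<Rightarrow> 'k" assume pq: "p \<in> poly_fun" "q \<in> poly_fun"
    note D = derivationD[OF derivation_left_field]
    show "E p \<in> poly_fun"
      unfolding E_def fs[abs_def] using poly_fun_sum[of UNIV "\<lambda>a. shifted_coord a * left_field (Q a) p"]
        subringD(4)[OF subring_poly_fun shifted_coord_poly_fun D(1)[OF pq(1)]] by (simp add: fs[abs_def, symmetric])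
    show "E (p + q) = E p + E q" unfolding E_def by (simp add: D(3)[OF pq] distrib_left sum.distrib)
    show "E (p * q) = p * E q + q * E p"
      unfolding E_def by (simp add: D(4)[OF pq] distrib_left sum.distrib sum_distrib_left mult.left_commute)
  next
    show "E (\<lambda>_. c) = 0" for c unfolding E_def by (simp add: derivationD(2)[OF derivation_left_field])
  qed
  moreover have "E p \<in> vanishing_ideal G" if "p \<in> vanishing_ideal G" for p
    unfolding E_def
    by (intro ideal_of_sum[OF ideal_of_vanishing_ideal] ideal_ofD(4)[OF ideal_of_vanishing_ideal]
        shifted_coord_poly_fun field_vanishing_ideal[OF G Q(1) that])
  moreover have "E (shifted_coord b) - shifted_coord b \<in> order_ideal G 2" for b
  proof -
    obtain p where p: "p \<in> vanishing_ideal G" "\<And>a.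
      deriv_at p (mat 1) (unit_mat (fst a) (snd a)) = (if a = b then 1 else 0) - Q a $ fst b $ snd b"
      using Q(2)[of b] by blast
    have p0: "p (mat 1) = 0" "p \<in> poly_fun" using p(1) matrix_groupD(1)[OF G] by (auto simp: vanishing_ideal_def)
    let ?d = "\<lambda>a A. (A ** Q a) $ fst b $ snd b - Q a $ fst b $ snd b"
    have d: "?d a \<in> order_ideal G 1" for a
      by (rule order_ideal_1I) (intro poly_fun_minus poly_fun.const poly_fun_mult_const, simp)
    have "(\<Sum>a\<in>UNIV. shifted_coord a * ?d a) \<in> order_ideal G 2"
      using order_ideal_gen[OF d] by (intro ideal_of_sum[OF ideal_of_order_ideal]) (simp add: numeral_2_eq_2)
    moreover have "(\<lambda>A. p A - p (mat 1) - deriv_at p (mat 1) (A - mat 1)) \<in> order_ideal G 2"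
      by (rule taylor_first_order[OF p0(2)])
    ultimately have "(\<Sum>a\<in>UNIV. shifted_coord a * ?d a) +
        ((\<lambda>A. p A - p (mat 1) - deriv_at p (mat 1) (A - mat 1)) - p) \<in> order_ideal G 2"
      by (rule O(3)[OF _ order_ideal_diff[OF _ vanishing_ideal_order_ideal[OF p(1)]]])
    also have "(\<Sum>a\<in>UNIV. shifted_coord a * ?d a) +
        ((\<lambda>A. p A - p (mat 1) - deriv_at p (mat 1) (A - mat 1)) - p) = E (shifted_coord b) - shifted_coord b"
    proof
      fix A
      have "deriv_at p (mat 1) (A - mat 1) = (\<Sum>a\<in>UNIV. shifted_coord a A * ((if a = b then 1 else 0) - Q a $ fst b $ snd b))"
        by (subst deriv_at_expand[OF p0(2)]) (simp add: p(2) shifted_coord_def)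
      also have "\<dots> = shifted_coord b A - (\<Sum>a\<in>UNIV. shifted_coord a A * Q a $ fst b $ snd b)"
      proof -
        have "(\<Sum>a\<in>UNIV. shifted_coord a A * (if a = b then 1 else 0)) = (\<Sum>a\<in>UNIV. if a = b then shifted_coord b A else 0)"
          by (intro sum.cong) auto
        then show ?thesis by (simp add: right_diff_distrib sum_subtractf)
      qed
      finally have 1: "deriv_at p (mat 1) (A - mat 1) = \<dots>" .
      have "left_field (Q a) (shifted_coord b) = (\<lambda>A. (A ** Q a) $ fst b $ snd b)" for a
      proof -
        have "(shifted_coord b :: 'k ^ 'n ^ 'n \<Rightarrow> 'k) = (\<lambda>A. A $ fst b $ snd b) + (\<lambda>_. - mat 1 $ fst b $ snd b)"
          by (simp add: fun_eq_iff shifted_coord_def)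
        then show ?thesis
          by (simp only: derivationD(2,3)[OF derivation_left_field] poly_fun.coord poly_fun.const
              left_field_coord add_0_right)
      qed
      then have 2: "E (shifted_coord b) A = (\<Sum>a\<in>UNIV. shifted_coord a A * (A ** Q a) $ fst b $ snd b)"
        by (simp add: E_def fs)
      show "((\<Sum>a\<in>UNIV. shifted_coord a * ?d a) +
        ((\<lambda>A. p A - p (mat 1) - deriv_at p (mat 1) (A - mat 1)) - p)) A = (E (shifted_coord b) - shifted_coord b) A"
        by (simp add: fs p0(1) 1 2 right_diff_distrib sum_subtractf)
    qed
    finally show ?thesis .
  qed
  ultimately have euler: "E p - of_nat i * p \<in> order_ideal G (Suc i)" if "p \<in> order_ideal G i" for p i
    using euler_derivation[OF _ _ _ that] by blast
  show ?thesis by (rule that[of Q, OF Q(1) euler[unfolded E_def]])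
qed

section \<open>Diagonal matrices\<close>

definition diag_mat :: "('n \<Rightarrow> 'k::field) \<Rightarrow> 'k ^ 'n ^ 'n" where
  "diag_mat d = (\<chi> i j. if i = j then d i else 0)"

lemma diag_mat_nth [simp]: "diag_mat d $ i $ j = (if i = j then d i else 0)"
  by (simp add: diag_mat_def)

lemma diag_mat_mult_left [simp]: "(diag_mat d ** A) $ i $ j = d i * A $ i $ j"
proof -
  have "(diag_mat d ** A) $ i $ j = (\<Sum>k\<in>UNIV. if k = i then d i * A $ i $ j else 0)"
    unfolding matrix_matrix_mult_def vec_lambda_beta by (intro sum.cong) auto
  then show ?thesis by simp
qed

lemma diag_mat_mult_right [simp]: "(A ** diag_mat d) $ i $ j = A $ i $ j * d j"
proof -
  have "(A ** diag_mat d) $ i $ j = (\<Sum>k\<in>UNIV. if k = j then A $ i $ j * d j else 0)"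
    unfolding matrix_matrix_mult_def vec_lambda_beta by (intro sum.cong) auto
  then show ?thesis by simp
qed

lemma diagonal_matrix_eq: "diagonal_matrix A \<Longrightarrow> diag_mat (\<lambda>i. A $ i $ i) = A"
  by (auto simp: diagonal_matrix_def vec_eq_iff)

lemma diagonal_matrix_mult_nth:
  assumes "diagonal_matrix A"
  shows "(A ** X) $ i $ j = A $ i $ i * X $ i $ j" "(X ** A) $ i $ j = X $ i $ j * A $ j $ j"
  using diag_mat_mult_left[of "\<lambda>i. A $ i $ i" X i j] diag_mat_mult_right[of X "\<lambda>i. A $ i $ i" i j]
  by (simp_all add: diagonal_matrix_eq[OF assms])

lemma diagonal_invertible:
  assumes "diagonal_matrix A" "invertible A"
  shows "A $ i $ i \<noteq> 0" "matrix_inv A = diag_mat (\<lambda>i. inverse (A $ i $ i))"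
proof -
  have *: "A $ i $ i * matrix_inv A $ i $ j = mat 1 $ i $ j" for i j
    using diagonal_matrix_mult_nth(1)[OF assms(1), of "matrix_inv A" i j] assms(2) by simp
  from *[of i i] show "A $ i $ i \<noteq> 0" by (auto simp: mat_def)
  have nz: "A $ i $ i \<noteq> 0" for i using *[of i i] by (auto simp: mat_def)
  show "matrix_inv A = diag_mat (\<lambda>i. inverse (A $ i $ i))"
  proof -
    have "matrix_inv A $ i $ j = (if i = j then inverse (A $ i $ i) else 0)" for i j
      using *[of i j] nz[of i] by (cases "i = j") (auto simp: mat_def field_simps)
    then show ?thesis by (simp add: vec_eq_iff)
  qed
qed

lemma conj_by_diagonal_nth:
  assumes "diagonal_matrix A" "invertible A"
  shows "conj_by A X $ i $ j = A $ i $ i / A $ j $ j * X $ i $ j"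
  by (simp add: conj_by_def diagonal_invertible(2)[OF assms] diagonal_matrix_mult_nth[OF assms(1)] field_simps)

lemma det_diag_mat: "det (diag_mat d) = (\<Prod>i\<in>UNIV. d i)"
  by (subst det_diagonal) auto

lemma det_elementary:
  assumes "i \<noteq> j"
  shows "det (mat 1 + smult_mat s (unit_mat i j) :: 'k::field ^ 'n ^ 'n) = 1"
proof -
  have "mat 1 + smult_mat s (unit_mat i j) =
      (\<chi> k. if k = i then row i (mat 1) + s *s row j (mat 1) else row k (mat 1 :: 'k ^ 'n ^ 'n))"
    using assms by (auto simp: vec_eq_iff mat_def row_def)
  then show ?thesis using det_row_operation[OF assms, of "mat 1 :: 'k ^ 'n ^ 'n" s] by simp
qed

lemma unit_mat_mult [simp]:
  fixes A :: "'k::field ^ 'n ^ 'n"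
  shows "(A ** unit_mat p q) $ i $ j = (if j = q then A $ i $ p else 0)"
    and "(unit_mat p q ** A) $ i $ j = (if i = p then A $ q $ j else 0)"
proof -
  have "(A ** unit_mat p q) $ i $ j = (\<Sum>k\<in>UNIV. if k = p then (if j = q then A $ i $ p else 0) else 0)"
    unfolding matrix_matrix_mult_def vec_lambda_beta by (intro sum.cong) auto
  then show "(A ** unit_mat p q) $ i $ j = (if j = q then A $ i $ p else 0)" by simp
  have "(unit_mat p q ** A) $ i $ j = (\<Sum>k\<in>UNIV. if k = q then (if i = p then A $ q $ j else 0) else 0)"
    unfolding matrix_matrix_mult_def vec_lambda_beta by (intro sum.cong) auto
  then show "(unit_mat p q ** A) $ i $ j = (if i = p then A $ q $ j else 0)" by simp
qed

lemma matrix_mult_add_smult: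
  fixes A X Y :: "'k::field ^ 'n ^ 'n"
  shows "A ** (X + smult_mat s Y) = A ** X + smult_mat s (A ** Y)"
    "(X + smult_mat s Y) ** A = X ** A + smult_mat s (Y ** A)"
  by (simp_all add: vec_eq_iff matrix_matrix_mult_def sum.distrib sum_distrib_left algebra_simps)

section \<open>The minors attached to a graded decomposition\<close>

text \<open>Let the index set be graded by \<open>n\<close>.  For indices \<open>i\<close> and \<open>j\<close> of the same degree, the minor of
  \<open>A\<close> with rows \<open>{r. n r > n j} \<union> {i}\<close> and columns \<open>{s. n s > n j} \<union> {j}\<close> does not change when \<open>A\<close> is
  multiplied on the right by matrices \<open>1 + s E p q\<close> with \<open>n p > n q\<close> or on the left by those with
  \<open>n p < n q\<close>.  On the block diagonal matrices it is the \<open>(i, j)\<close> entry times the determinant of the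
  blocks of larger degree.\<close>

definition block_minor_matrix :: "('n \<Rightarrow> rat) \<Rightarrow> 'n \<Rightarrow> 'n \<Rightarrow> 'k::field ^ 'n ^ 'n \<Rightarrow> 'k ^ 'n ^ 'n" where
  "block_minor_matrix n i j A = (\<chi> r s.
     if (n r > n j \<or> r = j) \<and> (n s > n j \<or> s = j) then A $ (if r = j then i else r) $ s
     else if r = s then 1 else 0)"

definition block_minor :: "('n \<Rightarrow> rat) \<Rightarrow> 'n \<Rightarrow> 'n \<Rightarrow> 'k::field ^ 'n ^ 'n \<Rightarrow> 'k" where
  "block_minor n i j A = det (block_minor_matrix n i j A)"

context
  fixes n :: "'n::finite \<Rightarrow> rat" and i j :: 'n
  assumes deg: "n i = n j"
begin

lemma poly_fun_block_minor: "(block_minor n i j :: 'k::field ^ 'n ^ 'n \<Rightarrow> 'k) \<in> poly_fun"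
proof -
  have "(\<lambda>A :: 'k ^ 'n ^ 'n. block_minor_matrix n i j A $ r $ s) \<in> poly_fun" for r s
  proof -
    have eq: "(\<lambda>A :: 'k ^ 'n ^ 'n. block_minor_matrix n i j A $ r $ s) =
        (if (n r > n j \<or> r = j) \<and> (n s > n j \<or> s = j) then (\<lambda>A. A $ (if r = j then i else r) $ s)
         else (\<lambda>_. if r = s then 1 else 0))"
      by (simp add: block_minor_matrix_def fun_eq_iff)
    show ?thesis unfolding eq by (simp add: poly_fun.const poly_fun.coord)
  qed
  then show ?thesis unfolding block_minor_def[abs_def] by (rule poly_fun_det)
qed

lemma block_minor_column_operation:
  fixes A :: "'k::field ^ 'n ^ 'n"
  assumes pq: "n p > n q"
  shows "block_minor n i j (A + smult_mat s (A ** unit_mat p q)) = block_minor n i j A"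
proof -
  have "p \<noteq> q" using pq by auto
  show ?thesis
  proof (cases "n q > n j \<or> q = j")
    case True
    then have p: "n p > n j" using pq by auto
    have "block_minor_matrix n i j (A + smult_mat s (A ** unit_mat p q)) =
        block_minor_matrix n i j A ** (mat 1 + smult_mat s (unit_mat p q))"
      unfolding matrix_mult_add_smult using True p \<open>p \<noteq> q\<close>
      by (auto simp: vec_eq_iff block_minor_matrix_def)
    then show ?thesis by (simp add: block_minor_def det_mul det_elementary[OF \<open>p \<noteq> q\<close>])
  next
    case False
    then have "block_minor_matrix n i j (A + smult_mat s (A ** unit_mat p q)) = block_minor_matrix n i j A"
      by (auto simp: vec_eq_iff block_minor_matrix_def)
    then show ?thesis by (simp add: block_minor_def)
  qed
qed

lemma block_minor_row_operation:
  fixes A :: "'k::field ^ 'n ^ 'n"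
  assumes pq: "n p < n q"
  shows "block_minor n i j (A + smult_mat s (unit_mat p q ** A)) = block_minor n i j A"
proof -
  have "p \<noteq> q" using pq by auto
  show ?thesis
  proof (cases "n p > n j \<and> p \<noteq> j \<or> p = i")
    case True
    \<comment> \<open>The row of the minor in which row \<open>p\<close> of \<open>A\<close> stands.\<close>
    define r where "r = (if p = i then j else p)"
    have q: "n q > n j" using pq True deg by auto
    have r: "r \<noteq> q" "(n r > n j \<or> r = j)" "(if r = j then i else r) = p" using True q pq deg by (auto simp: r_def)
    have uniq: "(if r' = j then i else r') = p \<longleftrightarrow> r' = r" if "n r' > n j \<or> r' = j" for r'
      using that True deg by (auto simp: r_def)
    have "block_minor_matrix n i j (A + smult_mat s (unit_mat p q ** A)) $ a $ b =
        (block_minor_matrix n i j A + smult_mat s (unit_mat r q ** block_minor_matrix n i j A)) $ a $ b" for a b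
    proof (cases "(n a > n j \<or> a = j) \<and> (n b > n j \<or> b = j)")
      case True
      have "block_minor_matrix n i j A $ q $ b = A $ q $ b"
        using True q by (auto simp: block_minor_matrix_def)
      moreover have "block_minor_matrix n i j B $ a $ b = B $ (if a = j then i else a) $ b" for B :: "'k ^ 'n ^ 'n"
        using True by (simp add: block_minor_matrix_def)
      ultimately show ?thesis using uniq[of a] True by simp
    next
      case False
      have "block_minor_matrix n i j B $ a $ b = (if a = b then 1 else 0)" for B :: "'k ^ 'n ^ 'n"
        unfolding block_minor_matrix_def vec_lambda_beta by (rule if_not_P[OF False])
      moreover have "block_minor_matrix n i j A $ q $ b = 0" if "a = r"
        using False that r(2) q by (auto simp: block_minor_matrix_def)
      ultimately show ?thesis by simp
    qed
    then have "block_minor_matrix n i j (A + smult_mat s (unit_mat p q ** A)) =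
        (mat 1 + smult_mat s (unit_mat r q)) ** block_minor_matrix n i j A"
      unfolding matrix_mult_add_smult matrix_mul_lid by (simp only: vec_eq_iff) blast
    then show ?thesis by (simp add: block_minor_def det_mul det_elementary[OF r(1)])
  next
    case False
    then have "block_minor_matrix n i j (A + smult_mat s (unit_mat p q ** A)) = block_minor_matrix n i j A"
      by (auto simp: vec_eq_iff block_minor_matrix_def)
    then show ?thesis by (simp add: block_minor_def)
  qed
qed

lemma block_minor_conj_diagonal:
  fixes A :: "'k::field ^ 'n ^ 'n"
  assumes t: "diagonal_matrix t" "invertible t"
  shows "block_minor n i j (conj_by t A) = t $ i $ i / t $ j $ j * block_minor n i j A"
proof -
  let ?K = "{s. n s > n j \<or> s = j}"
  let ?d = "\<lambda>r. if r \<in> ?K then (if r = j then t $ i $ i else t $ r $ r) else 1"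
  let ?e = "\<lambda>s. if s \<in> ?K then inverse (t $ s $ s) else 1"
  have "block_minor_matrix n i j (conj_by t A) = diag_mat ?d ** block_minor_matrix n i j A ** diag_mat ?e"
    by (auto simp: vec_eq_iff block_minor_matrix_def conj_by_diagonal_nth[OF t] field_simps)
  then have "block_minor n i j (conj_by t A) = (\<Prod>r\<in>UNIV. ?d r * ?e r) * block_minor n i j A"
    by (simp add: block_minor_def det_mul det_diag_mat prod.distrib)
  also have "(\<Prod>r\<in>UNIV. ?d r * ?e r) = (\<Prod>r\<in>UNIV. if r = j then t $ i $ i / t $ j $ j else 1)"
    using diagonal_invertible(1)[OF t] by (intro prod.cong) (auto simp: field_simps)
  also have "\<dots> = t $ i $ i / t $ j $ j" by simp
  finally show ?thesis .
qed

lemma block_minor_nonzero: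
  fixes g :: "'k::field ^ 'n ^ 'n"
  assumes "invertible g" and block: "\<And>r s. g $ r $ s \<noteq> 0 \<Longrightarrow> n r = n s" and nz: "g $ i $ j \<noteq> 0"
  shows "block_minor n i j g \<noteq> 0"
proof -
  let ?M = "block_minor_matrix n i j g"
  have block': "g $ r $ s = 0 \<or> n r = n s" for r s using block by blast
  have "x = 0" if x: "?M *v x = 0" for x
  proof -
    have Mx: "(\<Sum>s\<in>UNIV. ?M $ r $ s * x $ s) = 0" for r
      using arg_cong[OF x, of "\<lambda>v. v $ r"] by (simp add: matrix_vector_mult_def)
    have out: "x $ s = 0" if "\<not> (n s > n j \<or> s = j)" for s
    proof -
      have "(\<Sum>s'\<in>UNIV. ?M $ s $ s' * x $ s') = (\<Sum>s'\<in>UNIV. if s' = s then x $ s else 0)"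
        using that by (intro sum.cong) (auto simp: block_minor_matrix_def)
      then show ?thesis using Mx[of s] by simp
    qed
    have xj: "x $ j = 0"
    proof -
      have "?M $ j $ s * x $ s = (if s = j then g $ i $ j * x $ j else 0)" for s
        using block'[of i s] deg out[of s] by (auto simp: block_minor_matrix_def)
      then show ?thesis using Mx[of j] nz by simp
    qed
    have "g *v x = 0"
    proof (subst vec_eq_iff, rule allI)
      fix r
      show "(g *v x) $ r = 0 $ r"
      proof (cases "n r > n j")
        case True
        have "?M $ r $ s * x $ s = g $ r $ s * x $ s" for s
          using True out[of s] xj by (auto simp: block_minor_matrix_def)
        then have "(\<Sum>s\<in>UNIV. g $ r $ s * x $ s) = (\<Sum>s\<in>UNIV. ?M $ r $ s * x $ s)" by (intro sum.cong) metis+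
        then show ?thesis using Mx[of r] by (simp add: matrix_vector_mult_def)
      next
        case False
        have "g $ r $ s * x $ s = 0" for s
          using False block'[of r s] out[of s] xj by (cases "s = j") auto
        then show ?thesis by (simp only: matrix_vector_mult_def vec_lambda_beta sum.neutral_const zero_index)
      qed
    qed
    then have "matrix_inv g *v (g *v x) = 0" by simp
    then show ?thesis using assms(1) by (simp add: matrix_vector_mul_assoc)
  qed
  then have "invertible ?M"
    unfolding invertible_left_inverse matrix_left_invertible_ker by blast
  then show ?thesis by (simp add: block_minor_def invertible_det_nz)
qed

end

section \<open>Elements of a connected group that fix a regular semisimple element\<close>

text \<open>The projection of the Lie algebra onto a set of weights of \<open>T\<close> stays in the Lie algebra:
  apply the independence of characters to the relation
  \<open>\<Sum> (t\<^sub>i / t\<^sub>j) X\<^sub>i\<^sub>j (\<partial>p / \<partial>x\<^sub>i\<^sub>j) = 0\<close>, which holds because the Lie algebra is stable under \<open>T\<close>.\<close>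

lemma lie_algebra_weight_projection:
  fixes G T :: "('k::field_char_0 ^ 'n ^ 'n) set" and h :: "'n \<Rightarrow> 'n \<Rightarrow> 'k"
  assumes G: "matrix_group G" and T: "matrix_group T" "T \<subseteq> G" "\<And>t. t \<in> T \<Longrightarrow> diagonal_matrix t"
    and X: "X \<in> lie_algebra G"
    and h: "\<And>i j i' j'. (\<And>t. t \<in> T \<Longrightarrow> t $ i $ i / t $ j $ j = t $ i' $ i' / t $ j' $ j') \<Longrightarrow> h i j = h i' j'"
  shows "(\<chi> i j. h i j * X $ i $ j) \<in> lie_algebra G"
  unfolding lie_algebra_iff
proof
  fix p assume p: "p \<in> vanishing_ideal G"
  then have pf: "p \<in> poly_fun" by (simp add: vanishing_ideal_def)
  note inv = matrix_groupD(3)[OF T(1)]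
  let ?d = "\<lambda>a. deriv_at p (mat 1) (unit_mat (fst a) (snd a))"
  have "(\<Sum>a\<in>UNIV. h (fst a) (snd a) * (X $ fst a $ snd a * ?d a)) = 0"
  proof (rule characters_relation_weighted[where M = T and e = "mat 1" and mul = "(**)"
        and \<eta> = "\<lambda>a t. t $ fst a $ fst a / t $ snd a $ snd a"])
    fix t assume t: "t \<in> T"
    have "(\<lambda>A. p (t ** A ** matrix_inv t)) \<in> vanishing_ideal G"
      using p t T(2) poly_fun_translate[OF pf] matrix_groupD(2,4)[OF G] by (auto simp: vanishing_ideal_def subset_iff)
    then have "deriv_at (\<lambda>A. p (t ** A ** matrix_inv t)) (mat 1) X = 0"
      using X by (simp add: lie_algebra_iff)
    then have "deriv_at p (mat 1) (conj_by t X) = 0"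
      unfolding deriv_at_comp_linear[OF pf] using inv[OF t] by (simp add: conj_by_def)
    then show "(\<Sum>a\<in>UNIV. X $ fst a $ snd a * ?d a * (t $ fst a $ fst a / t $ snd a $ snd a)) = 0"
      unfolding deriv_at_expand[OF pf, of _ "conj_by t X"] conj_by_diagonal_nth[OF T(3)[OF t] inv[OF t]]
      by (simp only: mult_ac)
  next
    fix a :: "'n \<times> 'n" and s t assume "s \<in> T" "t \<in> T"
    then show "(s ** t) $ fst a $ fst a / (s ** t) $ snd a $ snd a =
        s $ fst a $ fst a / s $ snd a $ snd a * (t $ fst a $ fst a / t $ snd a $ snd a)"
      by (simp add: diagonal_matrix_mult_nth[OF T(3)])
  next
    fix a b :: "'n \<times> 'n"
    assume "\<And>t. t \<in> T \<Longrightarrow> t $ fst a $ fst a / t $ snd a $ snd a = t $ fst b $ fst b / t $ snd b $ snd b"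
    then show "h (fst a) (snd a) = h (fst b) (snd b)" by (rule h)
  qed (use matrix_groupD(1,2)[OF T(1)] in \<open>simp_all add: mat_def\<close>)
  then show "deriv_at p (mat 1) (\<chi> i j. h i j * X $ i $ j) = 0"
    by (subst deriv_at_expand[OF pf]) (simp add: mult.assoc)
qed

text \<open>The functions to which the argument applies: eigenfunctions of an element \<open>t\<close> that are
  invariant on either side under the infinitesimal unipotent transformations of the grading.\<close>

definition graded_invariants ::
    "('n \<Rightarrow> rat) \<Rightarrow> 'k::field_char_0 ^ 'n ^ 'n \<Rightarrow> 'k \<Rightarrow> ('k ^ 'n ^ 'n \<Rightarrow> 'k) set" where
  "graded_invariants n t c = {f \<in> poly_fun.
     (\<forall>X. (\<forall>p q. X $ p $ q \<noteq> 0 \<longrightarrow> n p > n q) \<longrightarrow> left_field X f = 0) \<and>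
     (\<forall>X. (\<forall>p q. X $ p $ q \<noteq> 0 \<longrightarrow> n p < n q) \<longrightarrow> right_field X f = 0) \<and>
     (\<forall>A. f (conj_by t A) = c * f A)}"

lemma block_minor_graded_invariant:
  fixes t :: "'k::field_char_0 ^ 'n ^ 'n"
  assumes deg: "n i = n j" and t: "diagonal_matrix t" "invertible t"
  shows "block_minor n i j \<in> graded_invariants n t (t $ i $ i / t $ j $ j)"
proof -
  let ?f = "block_minor n i j :: 'k ^ 'n ^ 'n \<Rightarrow> 'k"
  note pf = poly_fun_block_minor[OF deg]
  have L: "deriv_at ?f A (A ** unit_mat p q) = 0" if "n p > n q" for A p q
    using deriv_at_eqI[of ?f A "A ** unit_mat p q" "[:?f A:]"] by (simp add: block_minor_column_operation[OF deg that])
  have R: "deriv_at ?f A (unit_mat p q ** A) = 0" if "n p < n q" for A p q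
    using deriv_at_eqI[of ?f A "unit_mat p q ** A" "[:?f A:]"] by (simp add: block_minor_row_operation[OF deg that])
  have sumL: "A ** X = (\<Sum>a\<in>UNIV. smult_mat (X $ fst a $ snd a) (A ** unit_mat (fst a) (snd a)))"
    and sumR: "X ** A = (\<Sum>a\<in>UNIV. smult_mat (X $ fst a $ snd a) (unit_mat (fst a) (snd a) ** A))"
    for A X :: "'k ^ 'n ^ 'n"
  proof -
    have 1: "A ** (\<Sum>a\<in>S. smult_mat (c a) (Y a)) = (\<Sum>a\<in>S. smult_mat (c a) (A ** Y a))"
      and 2: "(\<Sum>a\<in>S. smult_mat (c a) (Y a)) ** A = (\<Sum>a\<in>S. smult_mat (c a) (Y a ** A))"
      if "finite S" for S :: "('n \<times> 'n) set" and c Y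
    proof -
      have smult: "A ** smult_mat s Y = smult_mat s (A ** Y)" "smult_mat s Y ** A = smult_mat s (Y ** A)" for s Y
        by (simp_all add: vec_eq_iff matrix_matrix_mult_def sum_distrib_left mult_ac)
      have add: "(Y + Z) ** A = Y ** A + Z ** A" for Y Z
        by (simp add: vec_eq_iff matrix_matrix_mult_def distrib_right sum.distrib)
      show "A ** (\<Sum>a\<in>S. smult_mat (c a) (Y a)) = (\<Sum>a\<in>S. smult_mat (c a) (A ** Y a))"
        "(\<Sum>a\<in>S. smult_mat (c a) (Y a)) ** A = (\<Sum>a\<in>S. smult_mat (c a) (Y a ** A))"
        using that by (induction S) (simp_all add: matrix_add_ldistrib add smult)
    qed
    show "A ** X = (\<Sum>a\<in>UNIV. smult_mat (X $ fst a $ snd a) (A ** unit_mat (fst a) (snd a)))"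
      by (subst matrix_eq_sum_unit_mat[of X]) (simp only: 1 finite)
    show "X ** A = (\<Sum>a\<in>UNIV. smult_mat (X $ fst a $ snd a) (unit_mat (fst a) (snd a) ** A))"
      by (subst matrix_eq_sum_unit_mat[of X]) (simp only: 2 finite)
  qed
  have "left_field X ?f = 0" if X: "\<forall>p q. X $ p $ q \<noteq> 0 \<longrightarrow> n p > n q" for X
  proof
    fix A
    have "X $ fst a $ snd a * deriv_at ?f A (A ** unit_mat (fst a) (snd a)) = 0" for a
      using X L by (metis mult_eq_0_iff)
    then show "left_field X ?f A = 0 A"
      unfolding left_field_def sumL[of A X]
      by (simp only: deriv_at_linear_comb[OF pf] sum.neutral_const zero_fun_apply)
  qed
  moreover have "right_field X ?f = 0" if X: "\<forall>p q. X $ p $ q \<noteq> 0 \<longrightarrow> n p < n q" for X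
  proof
    fix A
    have "X $ fst a $ snd a * deriv_at ?f A (unit_mat (fst a) (snd a) ** A) = 0" for a
      using X R by (metis mult_eq_0_iff)
    then show "right_field X ?f A = 0 A"
      unfolding right_field_def sumR[of X A]
      by (simp only: deriv_at_linear_comb[OF pf] sum.neutral_const zero_fun_apply)
  qed
  ultimately show ?thesis
    using pf by (simp add: graded_invariants_def block_minor_conj_diagonal[OF deg t])
qed

lemma left_field_graded_invariant:
  fixes X :: "'k::field_char_0 ^ 'n ^ 'n"
  assumes f: "f \<in> graded_invariants n t c" and t: "invertible t" and X: "conj_by t X = X"
    and deg: "\<And>p q. X $ p $ q \<noteq> 0 \<Longrightarrow> n p = n q"
  shows "left_field X f \<in> graded_invariants n t c"
proof -
  have pf: "f \<in> poly_fun" using f by (simp add: graded_invariants_def)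
  have "left_field Y (left_field X f) = 0" if Y: "\<forall>p q. Y $ p $ q \<noteq> 0 \<longrightarrow> n p > n q" for Y
  proof -
    have "n p > n q" if nz: "(Y ** X - X ** Y) $ p $ q \<noteq> 0" for p q
    proof -
      have "(Y ** X) $ p $ q \<noteq> 0 \<or> (X ** Y) $ p $ q \<noteq> 0" using nz by auto
      then obtain r where "Y $ p $ r * X $ r $ q \<noteq> 0 \<or> X $ p $ r * Y $ r $ q \<noteq> 0"
        unfolding matrix_matrix_mult_def vec_lambda_beta by (metis (no_types, lifting) sum.neutral)
      then show ?thesis using Y deg by (metis mult_eq_0_iff)
    qed
    then have "left_field (Y ** X - X ** Y) f = 0" "left_field Y f = 0"
      using f Y by (auto simp: graded_invariants_def)
    moreover have "left_field X 0 = 0"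
      using derivationD(2)[OF derivation_left_field, of X 0] by (simp add: zero_fun_def)
    ultimately show ?thesis using left_field_commutator[OF pf, of Y X] by simp
  qed
  moreover have "right_field Y (left_field X f) = 0" if "\<forall>p q. Y $ p $ q \<noteq> 0 \<longrightarrow> n p < n q" for Y
  proof -
    have "right_field Y f = 0" using f that by (auto simp: graded_invariants_def)
    moreover have "left_field X 0 = 0"
      using derivationD(2)[OF derivation_left_field, of X 0] by (simp add: zero_fun_def)
    ultimately show ?thesis using left_right_field_commute[OF pf, of Y X] by simp
  qed
  moreover have "left_field X f (conj_by t A) = c * left_field X f A" for A
  proof -
    have "conj_by t A ** X = conj_by t (A ** X)"
      using arg_cong[OF X, of "\<lambda>Y. conj_by t A ** Y"] t
      by (simp add: conj_by_def matrix_mul_assoc)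
    then have "left_field X f (conj_by t A) = deriv_at (\<lambda>A. f (t ** A ** matrix_inv t)) A (A ** X)"
      unfolding deriv_at_comp_linear[OF pf] by (simp add: left_field_def conj_by_def)
    also have "(\<lambda>A. f (t ** A ** matrix_inv t)) = (\<lambda>A. c * f A)"
      using f by (simp add: graded_invariants_def conj_by_def fun_eq_iff)
    also have "deriv_at (\<lambda>A. c * f A) A (A ** X) = c * left_field X f A"
      using deriv_at_mult[OF poly_fun.const pf] by (simp add: left_field_def)
    finally show ?thesis .
  qed
  ultimately show ?thesis
    using derivationD(1)[OF derivation_left_field pf] by (simp add: graded_invariants_def)
qed

text \<open>By induction on \<open>i\<close>, via Euler's formula \<open>i f = \<Sum> x\<^sub>a \<cdot> Q\<^sub>a f\<close> in leading order with tangent fields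
  \<open>Q\<^sub>a\<close>.  The part of \<open>Q\<^sub>a\<close> of positive degree kills \<open>f\<close>.  On the part of negative degree the left and
  right invariant fields agree in leading order, and the latter kills \<open>f\<close>.  The part of degree 0
  commutes with \<open>t\<close>, so it maps \<open>f\<close> to a function of the same kind, to which the induction
  hypothesis applies.\<close>

lemma graded_invariants_vanish:
  fixes G :: "('k::field_char_0 ^ 'n ^ 'n) set"
  assumes G: "matrix_group G" and t: "invertible t" and c: "c \<noteq> 1"
    and split: "\<And>X. X \<in> lie_algebra G \<Longrightarrow> \<exists>Y Z H. X = Y + Z + H \<and> Z \<in> lie_algebra G \<and>
      (\<forall>p q. Y $ p $ q \<noteq> 0 \<longrightarrow> n p > n q) \<and> (\<forall>p q. Z $ p $ q \<noteq> 0 \<longrightarrow> n p < n q) \<and>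
      (\<forall>p q. H $ p $ q \<noteq> 0 \<longrightarrow> n p = n q) \<and> conj_by t H = H"
    and f: "f \<in> graded_invariants n t c"
  shows "f \<in> order_ideal G i"
  using f
proof (induction i arbitrary: f)
  case 0
  then show ?case by (intro order_ideal_0) (simp add: graded_invariants_def)
next
  case (Suc i)
  have pf: "f \<in> poly_fun" using Suc.prems by (simp add: graded_invariants_def)
  note O = ideal_ofD[OF ideal_of_order_ideal]
  show ?case
  proof (cases i)
    case 0
    have "f (conj_by t (mat 1)) = c * f (mat 1)" using Suc.prems by (simp add: graded_invariants_def)
    then have "(1 - c) * f (mat 1) = 0" using t by (simp add: conj_by_def algebra_simps)
    then have "f (mat 1) = 0" using c by simp
    then show ?thesis using order_ideal_1I[OF pf] 0 by simp
  next
    case (Suc i')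
    have f: "f \<in> order_ideal G i" by (rule Suc.IH[OF Suc.prems])
    obtain Q :: "'n \<times> 'n \<Rightarrow> 'k ^ 'n ^ 'n" where Q: "\<And>a. Q a \<in> lie_algebra G"
      and E: "\<And>p i. p \<in> order_ideal G i \<Longrightarrow>
      (\<Sum>a\<in>UNIV. shifted_coord a * left_field (Q a) p) - of_nat i * p \<in> order_ideal G (Suc i)"
      by (rule euler_field[OF G]) blast
    have field: "left_field X f \<in> order_ideal G i" if X: "X \<in> lie_algebra G" for X
    proof -
      obtain Y Z H where XYZ: "X = Y + Z + H" and Z: "Z \<in> lie_algebra G"
        and deg: "\<forall>p q. Y $ p $ q \<noteq> 0 \<longrightarrow> n p > n q" "\<forall>p q. Z $ p $ q \<noteq> 0 \<longrightarrow> n p < n q"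
          "\<forall>p q. H $ p $ q \<noteq> 0 \<longrightarrow> n p = n q"
        and H: "conj_by t H = H"
        using split[OF X] by blast
      have "left_field X f = left_field Y f + left_field Z f + left_field H f"
        by (simp add: XYZ fun_eq_iff left_field_def matrix_add_ldistrib deriv_at_add_dir[OF pf])
      also have "left_field Y f = 0" "right_field Z f = 0"
        using Suc.prems deg by (auto simp: graded_invariants_def)
      then have "left_field Y f + left_field Z f + left_field H f =
          (left_field Z f - right_field Z f) + left_field H f" by simp
      also have "left_field Z f - right_field Z f \<in> order_ideal G i"
      proof (rule derivation_order_ideal[OF derivation_diff[OF derivation_left_field derivation_right_field] _ _ f])
        fix p assume "p \<in> vanishing_ideal G"
        then show "left_field Z p - right_field Z p \<in> vanishing_ideal G"
          by (intro ideal_of_diff[OF ideal_of_vanishing_ideal subring_poly_fun] field_vanishing_ideal[OF G Z])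
      qed (simp add: left_field_def right_field_def)
      then have "(left_field Z f - right_field Z f) + left_field H f \<in> order_ideal G i"
        using Suc.IH[OF left_field_graded_invariant[OF Suc.prems t H]] deg(3) by (intro O(3)) auto
      finally show ?thesis .
    qed
    have "(\<Sum>a\<in>UNIV. shifted_coord a * left_field (Q a) f) \<in> order_ideal G (Suc i)"
      by (intro ideal_of_sum[OF ideal_of_order_ideal] order_ideal_gen field Q)
    from order_ideal_diff[OF this E[OF f]]
    have "of_nat i * f \<in> order_ideal G (Suc i)" by simp
    then have "(\<lambda>_. inverse (of_nat i)) * (of_nat i * f) \<in> order_ideal G (Suc i)" by (rule order_ideal_cmult)
    also have "(of_nat i :: 'k) \<noteq> 0" using Suc by (simp only: of_nat_eq_0_iff)
    then have "(\<lambda>_. inverse (of_nat i)) * (of_nat i * f) = f"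
      by (simp add: fun_eq_iff flip: mult.assoc)
    finally show ?thesis .
  qed
qed

text \<open>If \<open>g\<close> did not commute with some \<open>t\<close> in \<open>T\<close>, then a block minor that does not vanish at \<open>g\<close>
  would be an eigenfunction of \<open>t\<close> with eigenvalue different from 1.  It vanishes on \<open>G\<close> to
  infinite order at the identity, hence near the identity by Krull's theorem, and so on all of the
  irreducible group \<open>G\<close>.\<close>

theorem centralizer_of_regular_diagonal:
  fixes G T :: "('k::field_char_0 ^ 'n ^ 'n) set" and u :: "'n \<Rightarrow> 'k"
  assumes G: "matrix_group G" and conn: "connectedin zariski G"
    and T: "matrix_group T" "T \<subseteq> G" "\<And>t. t \<in> T \<Longrightarrow> diagonal_matrix t"
    and compat: "\<And>p q p' q'. (\<And>t. t \<in> T \<Longrightarrow> t $ p $ p / t $ q $ q = t $ p' $ p' / t $ q' $ q') \<Longrightarrow>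
      u p - u q = u p' - u q'"
    and regular: "\<And>X p q. X \<in> lie_algebra G \<Longrightarrow> X \<noteq> 0 \<Longrightarrow>
      (\<And>t. t \<in> T \<Longrightarrow> conj_by t X = smult_mat (t $ p $ p / t $ q $ q) X) \<Longrightarrow>
      \<exists>t\<in>T. t $ p $ p \<noteq> t $ q $ q \<Longrightarrow> u p \<noteq> u q"
    and g: "g \<in> G" "\<And>i j. g $ i $ j \<noteq> 0 \<Longrightarrow> u i = u j"
    and t: "t \<in> T"
  shows "g ** t = t ** g"
proof (rule ccontr)
  assume "g ** t \<noteq> t ** g"
  note Tinv = matrix_groupD(3)[OF T(1)] and Tdiag = T(3)
  then obtain i j where "(g ** t) $ i $ j \<noteq> (t ** g) $ i $ j"
    using \<open>g ** t \<noteq> t ** g\<close> by (auto simp: vec_eq_iff)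
  then have gij: "g $ i $ j \<noteq> 0" and tij: "t $ i $ i \<noteq> t $ j $ j"
    by (auto simp: diagonal_matrix_mult_nth[OF Tdiag[OF t]])
  define D where "D = range (\<lambda>(p, q). u p - u q) - {0}"
  have "finite D" "0 \<notin> D" by (auto simp: D_def)
  from exists_rational_additive_nonvanishing[OF this] obtain \<phi> :: "'k \<Rightarrow> rat"
    where \<phi>: "\<And>x y. \<phi> (x + y) = \<phi> x + \<phi> y" "\<And>d. d \<in> D \<Longrightarrow> \<phi> d \<noteq> 0" by blast
  \<comment> \<open>Additivity of the grading makes its sign constant on the entries of equal weight.\<close>
  define n where "n = (\<lambda>i. \<phi> (u i))"
  have n_diff: "n p - n q = \<phi> (u p - u q)" for p q
    using \<phi>(1)[of "u p - u q" "u q"] by (simp add: n_def)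
  have n_eq: "n p = n q \<longleftrightarrow> u p = u q" for p q
  proof -
    have "u p - u q \<in> D" if "u p \<noteq> u q" using that by (auto simp: D_def)
    then have "n p - n q \<noteq> 0" if "u p \<noteq> u q" using \<phi>(2) that by (simp add: n_diff)
    then show ?thesis by (auto simp: n_def)
  qed
  have n_class: "n p - n q = n p' - n q'"
    if "\<And>t. t \<in> T \<Longrightarrow> t $ p $ p / t $ q $ q = t $ p' $ p' / t $ q' $ q'" for p q p' q'
    using compat[OF that] by (simp add: n_diff)
  have deg: "n i = n j" using g(2)[OF gij] by (simp add: n_eq)
  let ?f = "block_minor n i j :: 'k ^ 'n ^ 'n \<Rightarrow> 'k" and ?c = "t $ i $ i / t $ j $ j"
  have c: "?c \<noteq> 1" using tij diagonal_invertible(1)[OF Tdiag[OF t] Tinv[OF t], of j] by auto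
  have split: "\<exists>Y Z H. X = Y + Z + H \<and> Z \<in> lie_algebra G \<and>
      (\<forall>p q. Y $ p $ q \<noteq> 0 \<longrightarrow> n p > n q) \<and> (\<forall>p q. Z $ p $ q \<noteq> 0 \<longrightarrow> n p < n q) \<and>
      (\<forall>p q. H $ p $ q \<noteq> 0 \<longrightarrow> n p = n q) \<and> conj_by t H = H"
    if X: "X \<in> lie_algebra G" for X
  proof -
    define part where "part P = (\<chi> p q. (if P (n p - n q) then 1 else 0) * X $ p $ q)" for P :: "rat \<Rightarrow> bool"
    have part: "part P \<in> lie_algebra G" for P
      unfolding part_def
    proof (rule lie_algebra_weight_projection[OF G T X, where h = "\<lambda>p q. if P (n p - n q) then 1 else 0"])
      fix p q p' q'
      assume "\<And>t. t \<in> T \<Longrightarrow> t $ p $ p / t $ q $ q = t $ p' $ p' / t $ q' $ q'"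
      then have "n p - n q = n p' - n q'" by (rule n_class)
      then show "(if P (n p - n q) then 1 else 0) = (if P (n p' - n q') then 1 else 0 :: 'k)" by simp
    qed
    let ?H = "part (\<lambda>d. d = 0)"
    have "t $ p $ p = t $ q $ q" if H: "?H $ p $ q \<noteq> 0" for p q
    proof (rule ccontr)
      assume ne: "t $ p $ p \<noteq> t $ q $ q"
      have pq: "n p = n q" "X $ p $ q \<noteq> 0" using H by (auto simp: part_def split: if_splits)
      \<comment> \<open>Otherwise the projection \<open>W\<close> of \<open>X\<close> to the weight of the entry \<open>(p, q)\<close> is a root vector, and
        regularity of \<open>u\<close> gives this entry a nonzero degree.\<close>
      define same where "same p' q' \<longleftrightarrow> (\<forall>t\<in>T. t $ p' $ p' / t $ q' $ q' = t $ p $ p / t $ q $ q)" for p' q'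
      define W where "W = (\<chi> p q. (if same p q then 1 else 0) * X $ p $ q)"
      have "W \<in> lie_algebra G"
        unfolding W_def
        by (rule lie_algebra_weight_projection[OF G T X, where h = "\<lambda>p q. if same p q then 1 else 0"])
          (auto simp: same_def)
      moreover have "W $ p $ q \<noteq> 0" using pq(2) by (simp add: W_def same_def)
      then have "W \<noteq> 0" by auto
      moreover have "conj_by s W = smult_mat (s $ p $ p / s $ q $ q) W" if s: "s \<in> T" for s
      proof -
        have "conj_by s W $ p' $ q' = s $ p $ p / s $ q $ q * W $ p' $ q'" for p' q'
        proof (cases "same p' q'")
          case True
          then have "s $ p' $ p' / s $ q' $ q' = s $ p $ p / s $ q $ q" using s by (simp add: same_def)
          then show ?thesis by (simp only: conj_by_diagonal_nth[OF Tdiag[OF s] Tinv[OF s]])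
        next
          case False
          then show ?thesis by (simp add: conj_by_diagonal_nth[OF Tdiag[OF s] Tinv[OF s]] W_def)
        qed
        then show ?thesis by (simp add: vec_eq_iff)
      qed
      ultimately have "u p \<noteq> u q" using regular[of W p q] ne t by blast
      then show False using pq(1) n_eq by simp
    qed
    then have "conj_by t ?H $ p $ q = ?H $ p $ q" for p q
      using diagonal_invertible(1)[OF Tdiag[OF t] Tinv[OF t]]
      by (cases "?H $ p $ q = 0") (simp_all add: conj_by_diagonal_nth[OF Tdiag[OF t] Tinv[OF t]])
    then have "conj_by t ?H = ?H" by (simp add: vec_eq_iff)
    moreover have "X = part (\<lambda>d. d > 0) + part (\<lambda>d. d < 0) + ?H"
      by (auto simp: vec_eq_iff part_def)
    moreover have "P (n p - n q)" if "part P $ p $ q \<noteq> 0" for P p q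
      using that by (simp add: part_def split: if_splits)
    from this[of "\<lambda>d. d > 0"] this[of "\<lambda>d. d < 0"] this[of "\<lambda>d. d = 0"]
    have "\<forall>p q. part (\<lambda>d. d > 0) $ p $ q \<noteq> 0 \<longrightarrow> n p > n q"
      "\<forall>p q. part (\<lambda>d. d < 0) $ p $ q \<noteq> 0 \<longrightarrow> n p < n q"
      "\<forall>p q. ?H $ p $ q \<noteq> 0 \<longrightarrow> n p = n q"
      by simp_all
    ultimately show ?thesis using part by blast
  qed
  have "?f \<in> order_ideal G m" for m
    by (rule graded_invariants_vanish[OF G Tinv[OF t] c split
          block_minor_graded_invariant[where n = n, OF deg Tdiag[OF t] Tinv[OF t]]])
  then have "\<exists>q\<in>order_ideal G 1. ?f - q * ?f \<in> vanishing_ideal G"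
    unfolding order_ideal_def
    by (intro krull_intersection[OF subring_poly_fun range_shifted_coord_poly_fun
          ideal_of_vanishing_ideal noetherian_poly_fun _ poly_fun_block_minor[where n = n, OF deg]]) auto
  then obtain q where q: "q \<in> order_ideal G 1" "?f - q * ?f \<in> vanishing_ideal G" by blast
  have "?f g = 0"
  proof (rule connected_group_irreducible[OF G conn poly_fun_block_minor[where n = n, OF deg] _ _ _ g(1)])
    show "(\<lambda>A. 1 - q A) \<in> poly_fun"
      by (intro poly_fun_minus poly_fun.const order_ideal_poly_fun[OF q(1)])
    show "1 - q (mat 1) \<noteq> 0"
      using order_ideal_1D[OF matrix_groupD(1)[OF G], of q 0] q(1) by simp
    fix A assume "A \<in> G"
    then have "(?f - q * ?f) A = 0" using q(2) by (simp add: vanishing_ideal_def)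
    then show "?f A * (1 - q A) = 0" by (simp add: algebra_simps)
  qed
  moreover have "?f g \<noteq> 0"
    using block_minor_nonzero[where n = n, OF deg matrix_groupD(3)[OF G g(1)] _ gij] g(2) n_eq by blast
  ultimately show False by simp
qed

section \<open>Change of coordinates\<close>

lemma matrix_inv_unique_right:
  fixes A B :: "'k::field ^ 'n ^ 'n"
  assumes "A ** B = mat 1" shows "invertible A" "matrix_inv A = B"
proof -
  show inv: "invertible A" using assms matrix_left_right_inverse unfolding invertible_def by blast
  have "matrix_inv A ** (A ** B) = matrix_inv A" using assms by simp
  then show "matrix_inv A = B" using inv by simp
qed

lemma invertible_matrix_inv: "invertible A \<Longrightarrow> invertible (matrix_inv A)"
  and matrix_inv_matrix_inv: "invertible A \<Longrightarrow> matrix_inv (matrix_inv A) = A"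
  for A :: "'k::field ^ 'n ^ 'n"
  by (rule matrix_inv_unique_right[of "matrix_inv A" A], simp)+

lemma matrix_inv_mult:
  fixes A B :: "'k::field ^ 'n ^ 'n"
  assumes "invertible A" "invertible B"
  shows "matrix_inv (A ** B) = matrix_inv B ** matrix_inv A"
proof (rule matrix_inv_unique_right)
  have "A ** B ** (matrix_inv B ** matrix_inv A) = A ** (B ** (matrix_inv B ** matrix_inv A))"
    by (simp only: matrix_mul_assoc)
  then show "A ** B ** (matrix_inv B ** matrix_inv A) = mat 1" using assms by simp
qed

context
  fixes P :: "'k::field ^ 'n ^ 'n"
  assumes P: "invertible P"
begin

lemma conj_by_mult: "conj_by P (A ** B) = conj_by P A ** conj_by P B"
proof -
  have "conj_by P A ** conj_by P B = P ** (A ** (matrix_inv P ** (P ** (B ** matrix_inv P))))"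
    by (simp only: conj_by_def matrix_mul_assoc)
  then show ?thesis using P by (simp add: conj_by_def matrix_mul_assoc)
qed

lemma conj_by_one [simp]: "conj_by P (mat 1) = mat 1"
  using P by (simp add: conj_by_def)

lemma conj_by_inverse [simp]:
  "conj_by (matrix_inv P) (conj_by P X) = X" "conj_by P (conj_by (matrix_inv P) X) = X"
proof -
  have "conj_by (matrix_inv P) (conj_by P X) = matrix_inv P ** (P ** (X ** matrix_inv P ** P))"
    using P by (simp only: conj_by_def matrix_inv_matrix_inv matrix_mul_assoc)
  then show "conj_by (matrix_inv P) (conj_by P X) = X" using P by simp
  have "conj_by P (conj_by (matrix_inv P) X) = P ** (matrix_inv P ** (X ** P ** matrix_inv P))"
    using P by (simp only: conj_by_def matrix_inv_matrix_inv matrix_mul_assoc)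
  then show "conj_by P (conj_by (matrix_inv P) X) = X" using P by simp
qed

lemma conj_by_eq_iff [simp]: "conj_by P X = conj_by P Y \<longleftrightarrow> X = Y"
  using conj_by_inverse(1) by metis

lemma invertible_conj_by: "invertible A \<Longrightarrow> invertible (conj_by P A)"
  unfolding conj_by_def by (intro invertible_mult P invertible_matrix_inv)

lemma matrix_inv_conj_by: "invertible A \<Longrightarrow> matrix_inv (conj_by P A) = conj_by P (matrix_inv A)"
  by (rule matrix_inv_unique_right) (simp flip: conj_by_mult)

lemma conj_by_conj_by: "invertible A \<Longrightarrow> conj_by (conj_by P A) (conj_by P X) = conj_by P (conj_by A X)"
  by (simp add: conj_by_def[of "conj_by P A"] matrix_inv_conj_by flip: conj_by_mult)
    (simp add: conj_by_def)

lemma conj_by_smult: "conj_by P (smult_mat c X) = smult_mat c (conj_by P X)"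
  by (simp add: conj_by_def vec_eq_iff matrix_matrix_mult_def sum_distrib_left sum_distrib_right mult_ac)

lemma matrix_group_conj_by: "matrix_group G \<Longrightarrow> matrix_group (conj_by P ` G)"
  unfolding matrix_group_def
  by (auto simp: invertible_conj_by matrix_inv_conj_by intro: rev_image_eqI conj_by_mult[symmetric])

lemma det_conj_by: "det (conj_by P A) = det A"
proof -
  have "det P * det (matrix_inv P) = 1" using P by (simp flip: det_mul)
  then show ?thesis by (simp add: conj_by_def det_mul mult.commute mult.left_commute)
qed

end

lemma conj_by_mult_left:
  fixes A B :: "'k::field ^ 'n ^ 'n"
  assumes "invertible A" "invertible B"
  shows "conj_by (A ** B) X = conj_by A (conj_by B X)"
  by (simp add: conj_by_def matrix_inv_mult[OF assms] matrix_mul_assoc)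

lemma conj_by_commute_iff:
  fixes g A :: "'k::field ^ 'n ^ 'n"
  assumes "invertible g" shows "conj_by g A = A \<longleftrightarrow> g ** A = A ** g"
  unfolding conj_by_def using assms by (metis matrix_inv_cancel(5,6))

lemma topspace_zariski [simp]: "topspace zariski = UNIV"
proof -
  have "zariski_open (UNIV :: ('k::field ^ 'n ^ 'n) set)"
    unfolding zariski_open_def
    by (intro exI[of _ "{\<lambda>_. 1}"]) (auto intro: poly_fun.const)
  then show ?thesis using openin_subset[of zariski UNIV] by (auto simp: openin_zariski)
qed

lemma connectedin_conj_by:
  fixes G :: "('k::field ^ 'n ^ 'n) set"
  assumes "connectedin zariski G"
  shows "connectedin zariski (conj_by P ` G)"
proof (rule connectedin_continuous_map_image[OF _ assms])
  show "continuous_map zariski zariski (conj_by P)"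
    unfolding continuous_map_def openin_zariski
  proof (intro conjI allI impI)
    fix U :: "('k ^ 'n ^ 'n) set" assume "zariski_open U"
    then obtain S where S: "S \<subseteq> poly_fun" "U = {A. \<exists>p\<in>S. p A \<noteq> 0}" by (auto simp: zariski_open_def)
    have "(\<lambda>p A. p (conj_by P A)) ` S \<subseteq> poly_fun"
      unfolding conj_by_def using S(1) poly_fun_translate by blast
    then show "zariski_open {x \<in> topspace zariski. conj_by P x \<in> U}"
      unfolding zariski_open_def S(2) by (intro exI[of _ "(\<lambda>p A. p (conj_by P A)) ` S"]) auto
  qed auto
qed

lemma lie_algebra_conj_by:
  assumes P: "invertible P" and X: "X \<in> lie_algebra G"
  shows "conj_by P X \<in> lie_algebra (conj_by P ` G)"
  unfolding lie_algebra_iff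
proof
  fix p assume p: "p \<in> vanishing_ideal (conj_by P ` G)"
  then have pf: "p \<in> poly_fun" by (simp add: vanishing_ideal_def)
  have "(\<lambda>A. p (P ** A ** matrix_inv P)) \<in> vanishing_ideal G"
    using p poly_fun_translate[OF pf] by (auto simp: vanishing_ideal_def conj_by_def)
  then have "deriv_at (\<lambda>A. p (P ** A ** matrix_inv P)) (mat 1) X = 0"
    using X by (simp add: lie_algebra_iff)
  then show "deriv_at p (mat 1) (conj_by P X) = 0"
    unfolding deriv_at_comp_linear[OF pf] using P by (simp add: conj_by_def)
qed

lemma deriv_at_eq_on:
  assumes "X \<in> lie_algebra T" "p \<in> poly_fun" "q \<in> poly_fun" "\<And>A. A \<in> T \<Longrightarrow> p A = q A"
  shows "deriv_at p (mat 1) X = deriv_at q (mat 1) X"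
proof -
  have "(\<lambda>A. p A + (- 1) * q A) \<in> poly_fun" by (intro poly_fun.intros assms)
  then have "(\<lambda>A. p A + (- 1) * q A) \<in> vanishing_ideal T"
    using assms(4) by (simp add: vanishing_ideal_def)
  then have "deriv_at (\<lambda>A. p A + (- 1) * q A) (mat 1) X = 0" using assms(1) by (simp add: lie_algebra_iff)
  moreover have "deriv_at (\<lambda>A. p A + (- 1) * q A) (mat 1) X = deriv_at p (mat 1) X - deriv_at q (mat 1) X"
    unfolding deriv_at_add[OF assms(2) poly_fun.mult[OF poly_fun.const assms(3)]]
      deriv_at_mult[OF poly_fun.const assms(3)] by simp
  ultimately show ?thesis by simp
qed

lemma deriv_at_prod_power:
  assumes "\<And>i. i \<in> S \<Longrightarrow> f i \<in> poly_fun" "\<And>i. i \<in> S \<Longrightarrow> f i A = 1"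
  shows "deriv_at (\<lambda>A. \<Prod>i\<in>S. f i A ^ m i) A X = (\<Sum>i\<in>S. of_nat (m i) * deriv_at (f i) A X)"
  using assms
proof (induction S rule: infinite_finite_induct)
  case (insert i S)
  have pow: "deriv_at (\<lambda>A. f i A ^ k) A X = of_nat k * deriv_at (f i) A X" for k
  proof (induction k)
    case (Suc k)
    then show ?case using insert.prems[of i]
      by (simp add: deriv_at_mult poly_fun_power algebra_simps)
  qed simp
  have "(\<Prod>i\<in>S. f i A ^ m i) = 1" using insert.prems by (intro prod.neutral) auto
  moreover have "(\<lambda>A. \<Prod>i\<in>S. f i A ^ m i) \<in> poly_fun" "(\<lambda>A. f i A ^ m i) \<in> poly_fun"
    using insert.prems by (auto intro!: poly_fun_prod poly_fun_power)
  ultimately show ?case using insert pow[of "m i"] by (simp add: deriv_at_mult)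
qed simp_all

text \<open>If \<open>\<eta> \<cdot> det\<^sup>m = p\<close> and \<open>\<eta> \<cdot> det\<^sup>m\<^sup>' = p'\<close> on \<open>T\<close>, then \<open>p \<cdot> det\<^sup>m\<^sup>' = p' \<cdot> det\<^sup>m\<close> there; the derivatives of
  the two sides at the identity agree on the Lie algebra, so that all representations of \<open>\<eta>\<close> give
  the same differential.\<close>

lemma differential_eqI:
  fixes T :: "('k::field_char_0 ^ 'n ^ 'n) set"
  assumes T: "mat 1 \<in> T" and X: "X \<in> lie_algebra T" and one: "\<eta> (mat 1) = 1"
    and p: "regular_rep T \<eta> p m" "deriv_at p (mat 1) X = d + deriv_at (\<lambda>A. det A ^ m) (mat 1) X"
  shows "differential T \<eta> X = d"
  unfolding differential_def dderiv_eq_deriv_at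
proof (rule the_equality)
  show "\<exists>p m. regular_rep T \<eta> p m \<and> deriv_at p (mat 1) X = d + deriv_at (\<lambda>A. det A ^ m) (mat 1) X"
    using p by blast
  fix d' assume "\<exists>p m. regular_rep T \<eta> p m \<and> deriv_at p (mat 1) X = d' + deriv_at (\<lambda>A. det A ^ m) (mat 1) X"
  then obtain p' m' where p': "regular_rep T \<eta> p' m'"
    "deriv_at p' (mat 1) X = d' + deriv_at (\<lambda>A. det A ^ m') (mat 1) X" by blast
  have pf: "p \<in> poly_fun" "p' \<in> poly_fun" using p(1) p'(1) by (auto simp: regular_rep_def)
  have det: "(\<lambda>A. det A ^ k) \<in> poly_fun" for k by (intro poly_fun_power poly_fun_det poly_fun.coord)
  have p1: "p (mat 1) = 1" "p' (mat 1) = 1"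
  proof -
    have "\<eta> (mat 1) * det (mat 1 :: 'k ^ 'n ^ 'n) ^ m = p (mat 1)"
      "\<eta> (mat 1) * det (mat 1 :: 'k ^ 'n ^ 'n) ^ m' = p' (mat 1)"
      using p(1) p'(1) T unfolding regular_rep_def by blast+
    then show "p (mat 1) = 1" "p' (mat 1) = 1" using one by simp_all
  qed
  have "p A * det A ^ m' = p' A * det A ^ m" if "A \<in> T" for A
  proof -
    have "p A = \<eta> A * det A ^ m" "p' A = \<eta> A * det A ^ m'"
      using p(1) p'(1) that unfolding regular_rep_def by simp_all
    then show ?thesis by (simp only: mult_ac)
  qed
  from deriv_at_eq_on[OF X poly_fun.mult[OF pf(1) det] poly_fun.mult[OF pf(2) det] this]
  have "deriv_at (\<lambda>A. det A ^ m') (mat 1) X + deriv_at p (mat 1) X =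
      deriv_at (\<lambda>A. det A ^ m) (mat 1) X + deriv_at p' (mat 1) X"
    by (simp add: deriv_at_mult pf det p1)
  then show "d' = d" using p(2) p'(2) by (simp add: algebra_simps)
qed

text \<open>That one list \<open>L\<close> of coefficients and exponents serves both for the values on diagonal matrices and
  for the differential is what lets a relation between characters of a diagonal group say
  something about differentials.\<close>

lemma poly_fun_on_diagonal:
  fixes p :: "'k::field_char_0 ^ 'n ^ 'n \<Rightarrow> 'k"
  assumes "p \<in> poly_fun"
  shows "\<exists>L :: ('k \<times> ('n \<Rightarrow> nat)) list.
    (\<forall>d. p (diag_mat d) = (\<Sum>(a, \<mu>)\<leftarrow>L. a * (\<Prod>i\<in>UNIV. d i ^ \<mu> i))) \<and>
    (\<forall>x. deriv_at p (mat 1) (diag_mat x) = (\<Sum>(a, \<mu>)\<leftarrow>L. a * (\<Sum>i\<in>UNIV. of_nat (\<mu> i) * x i)))"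
  using assms
proof induction
  case (const c)
  show ?case by (intro exI[of _ "[(c, \<lambda>_. 0)]"]) simp
next
  case (coord i j)
  show ?case
  proof (cases "i = j")
    case True
    have "(\<Prod>k\<in>UNIV. d k ^ (if k = i then 1 else 0 :: nat)) = (\<Prod>k\<in>UNIV. if k = i then d i else 1)" for d :: "'n \<Rightarrow> 'k"
      by (intro prod.cong) auto
    moreover have "(\<Sum>k\<in>UNIV. of_nat (if k = i then 1 else 0) * x k) = (\<Sum>k\<in>UNIV. if k = i then x i else 0)" for x :: "'n \<Rightarrow> 'k"
      by (intro sum.cong) auto
    ultimately show ?thesis using True
      by (intro exI[of _ "[(1, \<lambda>k. if k = i then 1 else 0)]"]) (simp del: of_nat_eq_1_iff)
  next
    case False
    then show ?thesis by (intro exI[of _ "[]"]) simp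
  qed
next
  case (add p q)
  then obtain L M where
    "\<forall>d. p (diag_mat d) = (\<Sum>(a, \<mu>)\<leftarrow>L. a * (\<Prod>i\<in>UNIV. d i ^ \<mu> i))"
    "\<forall>x. deriv_at p (mat 1) (diag_mat x) = (\<Sum>(a, \<mu>)\<leftarrow>L. a * (\<Sum>i\<in>UNIV. of_nat (\<mu> i) * x i))"
    "\<forall>d. q (diag_mat d) = (\<Sum>(a, \<mu>)\<leftarrow>M. a * (\<Prod>i\<in>UNIV. d i ^ \<mu> i))"
    "\<forall>x. deriv_at q (mat 1) (diag_mat x) = (\<Sum>(a, \<mu>)\<leftarrow>M. a * (\<Sum>i\<in>UNIV. of_nat (\<mu> i) * x i))"
    by blast
  then show ?case by (intro exI[of _ "L @ M"]) (simp add: deriv_at_add[OF add.hyps])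
next
  case (mult p q)
  then obtain L M where
    L: "\<And>d. p (diag_mat d) = (\<Sum>(a, \<mu>)\<leftarrow>L. a * (\<Prod>i\<in>UNIV. d i ^ \<mu> i))"
    "\<And>x. deriv_at p (mat 1) (diag_mat x) = (\<Sum>(a, \<mu>)\<leftarrow>L. a * (\<Sum>i\<in>UNIV. of_nat (\<mu> i) * x i))" and
    M: "\<And>d. q (diag_mat d) = (\<Sum>(a, \<mu>)\<leftarrow>M. a * (\<Prod>i\<in>UNIV. d i ^ \<mu> i))"
    "\<And>x. deriv_at q (mat 1) (diag_mat x) = (\<Sum>(a, \<mu>)\<leftarrow>M. a * (\<Sum>i\<in>UNIV. of_nat (\<mu> i) * x i))"
    by blast
  define row where "row a \<mu> = map (\<lambda>(b, \<nu>). (a * b, \<lambda>i. \<mu> i + \<nu> i)) M" for a :: 'k and \<mu> :: "'n \<Rightarrow> nat"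
  define N where "N = concat (map (\<lambda>(a, \<mu>). row a \<mu>) L)"
  have mat1: "mat 1 = diag_mat (\<lambda>_. 1 :: 'k)" by (simp add: vec_eq_iff mat_def)
  have one: "p (mat 1) = (\<Sum>(a, \<mu>)\<leftarrow>L. a)" "q (mat 1) = (\<Sum>(b, \<nu>)\<leftarrow>M. b)"
    unfolding mat1 L M by simp_all
  have "(\<Sum>(a, \<mu>)\<leftarrow>N. a * (\<Prod>i\<in>UNIV. d i ^ \<mu> i)) = p (diag_mat d) * q (diag_mat d)" for d
  proof -
    have "(\<Sum>(b, \<nu>)\<leftarrow>row a \<mu>. b * (\<Prod>i\<in>UNIV. d i ^ \<nu> i)) = a * (\<Prod>i\<in>UNIV. d i ^ \<mu> i) * q (diag_mat d)" for a \<mu>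
      unfolding row_def M by (induction M) (auto simp: power_add prod.distrib algebra_simps)
    then show ?thesis unfolding N_def L by (induction L) (auto simp: distrib_right)
  qed
  moreover have "(\<Sum>(a, \<mu>)\<leftarrow>N. a * (\<Sum>i\<in>UNIV. of_nat (\<mu> i) * x i)) =
      p (mat 1) * deriv_at q (mat 1) (diag_mat x) + q (mat 1) * deriv_at p (mat 1) (diag_mat x)" for x
  proof -
    have "(\<Sum>(b, \<nu>)\<leftarrow>row a \<mu>. b * (\<Sum>i\<in>UNIV. of_nat (\<nu> i) * x i)) =
        a * deriv_at q (mat 1) (diag_mat x) + a * (\<Sum>i\<in>UNIV. of_nat (\<mu> i) * x i) * q (mat 1)" for a \<mu>
      unfolding row_def M one by (induction M) (auto simp: algebra_simps sum.distrib)
    then show ?thesis unfolding N_def L one(1) by (induction L) (auto simp: algebra_simps)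
  qed
  ultimately show ?case by (intro exI[of _ N]) (simp add: deriv_at_mult[OF mult.hyps])
qed

section \<open>Tori in diagonal coordinates\<close>

text \<open>All statements about the torus are made in the coordinates in which \<open>P\<close> diagonalizes it.\<close>

locale diagonalized_torus =
  fixes G T :: "('k::field_char_0 ^ 'n ^ 'n) set" and P :: "'k ^ 'n ^ 'n"
  assumes group_G: "matrix_group G" and connected_G: "connectedin zariski G"
    and group_T: "matrix_group T" and T_subset: "T \<subseteq> G"
    and invertible_P: "invertible P" and diagonal_T: "\<And>A. A \<in> T \<Longrightarrow> diagonal_matrix (conj_by P A)"
begin

definition coord :: "'k ^ 'n ^ 'n \<Rightarrow> 'n \<Rightarrow> 'k" where
  "coord X i = conj_by P X $ i $ i"

definition from_coords :: "('n \<Rightarrow> 'k) \<Rightarrow> 'k ^ 'n ^ 'n" where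
  "from_coords x = conj_by (matrix_inv P) (diag_mat x)"

definition coord_ratio :: "'n \<Rightarrow> 'n \<Rightarrow> 'k ^ 'n ^ 'n \<Rightarrow> 'k" where
  "coord_ratio p q = restrict (\<lambda>A. coord A p / coord A q) T"

lemma coord_from_coords [simp]: "coord (from_coords x) = x"
  by (simp add: coord_def from_coords_def invertible_P fun_eq_iff)

lemma poly_fun_coord: "(\<lambda>A. coord A i) \<in> poly_fun"
  unfolding coord_def conj_by_def by (rule poly_fun_translate[OF poly_fun.coord])

lemma deriv_at_coord_eq [simp]: "deriv_at (\<lambda>A. coord A i) A X = coord X i"
  unfolding coord_def conj_by_def by (rule deriv_at_linear_form)

lemma coord_one [simp]: "coord (mat 1) i = 1"
  unfolding coord_def conj_by_one[OF invertible_P] by (simp add: mat_def)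

lemma coord_nonzero: "A \<in> T \<Longrightarrow> coord A i \<noteq> 0"
  unfolding coord_def
  by (intro diagonal_invertible(1) diagonal_T invertible_conj_by invertible_P matrix_groupD(3)[OF group_T])

lemma coord_mult: "A \<in> T \<Longrightarrow> coord (A ** B) i = coord A i * coord B i"
  unfolding coord_def conj_by_mult[OF invertible_P] by (rule diagonal_matrix_mult_nth[OF diagonal_T])

lemma det_eq_prod_coord: "A \<in> T \<Longrightarrow> det A = (\<Prod>i\<in>UNIV. coord A i)"
proof -
  assume "A \<in> T"
  then have "det (conj_by P A) = (\<Prod>i\<in>UNIV. conj_by P A $ i $ i)"
    using diagonal_T by (intro det_diagonal) (simp add: diagonal_matrix_def)
  then show ?thesis by (simp add: det_conj_by invertible_P coord_def)
qed

lemma diagonal_lie_T: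
  assumes "X \<in> lie_algebra T" shows "diagonal_matrix (conj_by P X)"
  unfolding diagonal_matrix_def
proof (intro allI impI)
  fix i j :: 'n assume ij: "i \<noteq> j"
  have "(\<lambda>A. (P ** A ** matrix_inv P) $ i $ j) \<in> vanishing_ideal T"
    using diagonal_T ij poly_fun_translate[OF poly_fun.coord]
    by (auto simp: vanishing_ideal_def diagonal_matrix_def conj_by_def)
  then have "deriv_at (\<lambda>A. (P ** A ** matrix_inv P) $ i $ j) (mat 1) X = 0"
    using assms unfolding lie_algebra_iff by blast
  then show "conj_by P X $ i $ j = 0" by (simp only: deriv_at_linear_form conj_by_def)
qed

lemma from_coords_coord:
  assumes "X \<in> T \<or> X \<in> lie_algebra T" shows "from_coords (coord X) = X"
proof -
  have "diag_mat (coord X) = conj_by P X"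
    unfolding coord_def using diagonal_matrix_eq diagonal_T diagonal_lie_T assms by blast
  then show ?thesis by (simp add: from_coords_def invertible_P)
qed

lemma lie_T_eqI:
  assumes "X \<in> lie_algebra T" "Y \<in> lie_algebra T" "coord X = coord Y" shows "X = Y"
  using assms by (metis from_coords_coord)

lemma coord_smult [simp]: "coord (smult_mat c X) i = c * coord X i"
  by (simp add: coord_def conj_by_smult[OF invertible_P])

text \<open>On \<open>T\<close> the determinant is the product of the coordinates, so multiplying the ratio of two coordinates
  by it gives a polynomial.\<close>

lemma coord_ratio_character:
  assumes X: "X \<in> lie_algebra T"
  shows "regular_rep T (coord_ratio p q) (\<lambda>A. coord A p * (\<Prod>i\<in>UNIV - {q}. coord A i)) 1"
    and "differential T (coord_ratio p q) X = coord X p - coord X q"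
proof -
  let ?R = "\<lambda>A. \<Prod>i\<in>UNIV - {q}. coord A i"
  have R: "?R \<in> poly_fun" by (intro poly_fun_prod poly_fun_coord)
  have det: "det A = coord A q * ?R A" if "A \<in> T" for A
    using det_eq_prod_coord[OF that] by (simp add: prod.remove[of UNIV q])
  show reg: "regular_rep T (coord_ratio p q) (\<lambda>A. coord A p * ?R A) 1"
    unfolding regular_rep_def
    using coord_nonzero by (auto intro!: poly_fun.mult poly_fun_coord R simp: coord_ratio_def det)
  have R1: "?R (mat 1) = 1" by simp
  show "differential T (coord_ratio p q) X = coord X p - coord X q"
  proof (rule differential_eqI[OF matrix_groupD(1)[OF group_T] X _ reg])
    show "coord_ratio p q (mat 1) = 1" by (simp add: coord_ratio_def matrix_groupD(1)[OF group_T])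
    have "deriv_at (\<lambda>A. det A ^ 1) (mat 1) X = deriv_at (\<lambda>A. coord A q * ?R A) (mat 1) X"
      by (rule deriv_at_eq_on[OF X])
        (simp_all add: det poly_fun_det poly_fun.coord poly_fun.mult poly_fun_coord R)
    then show "deriv_at (\<lambda>A. coord A p * ?R A) (mat 1) X =
        coord X p - coord X q + deriv_at (\<lambda>A. det A ^ 1) (mat 1) X"
      by (simp only: deriv_at_mult[OF poly_fun_coord R] R1 deriv_at_coord_eq coord_one) simp
  qed
qed

lemma coord_ratio_root:
  assumes X: "X \<in> lie_algebra G" "X \<noteq> 0"
    and weight: "\<And>A. A \<in> T \<Longrightarrow> conj_by A X = smult_mat (coord A p / coord A q) X"
    and "\<exists>A\<in>T. coord A p \<noteq> coord A q"
  shows "coord_ratio p q \<in> roots G T"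
proof -
  have "regular_rep T (coord_ratio p q) (\<lambda>A. coord A p * (\<Prod>i\<in>UNIV - {q}. coord A i)) 1"
    by (rule coord_ratio_character(1)[OF lie_algebra_closed(1)])
  moreover have "coord_ratio p q (A ** B) = coord_ratio p q A * coord_ratio p q B" if "A \<in> T" "B \<in> T" for A B
    using that matrix_groupD(2)[OF group_T] by (simp add: coord_ratio_def coord_mult)
  ultimately have "coord_ratio p q \<in> characters T"
    using coord_nonzero by (auto simp: characters_def coord_ratio_def)
  moreover have "\<exists>A\<in>T. coord_ratio p q A \<noteq> 1"
    using assms(4) coord_nonzero by (auto simp: coord_ratio_def)
  moreover have "X \<in> weight_space G T (coord_ratio p q)"
    using X(1) weight by (simp add: weight_space_def coord_ratio_def)
  ultimately show ?thesis using X(2) by (auto simp: roots_def)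
qed

lemma conj_by_T_nth:
  assumes "A \<in> T"
  shows "conj_by P (conj_by A X) $ p $ q = coord A p / coord A q * conj_by P X $ p $ q"
proof -
  have A: "invertible A" by (rule matrix_groupD(3)[OF group_T assms])
  show ?thesis
    unfolding conj_by_conj_by[OF invertible_P A, symmetric] coord_def
    by (rule conj_by_diagonal_nth[OF diagonal_T[OF assms] invertible_conj_by[OF invertible_P A]])
qed

lemma root_is_coord_ratio:
  assumes "\<alpha> \<in> roots G T"
  obtains p q where "\<alpha> = coord_ratio p q"
proof -
  from assms obtain X where \<alpha>: "\<alpha> \<in> extensional T" and X: "X \<in> weight_space G T \<alpha>" "X \<noteq> 0"
    by (auto simp: roots_def characters_def)
  have "conj_by P X \<noteq> 0"
  proof
    assume "conj_by P X = 0"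
    then have "conj_by P X = conj_by P 0" by (simp add: conj_by_def)
    then show False using X(2) invertible_P by simp
  qed
  then obtain p q where pq: "conj_by P X $ p $ q \<noteq> 0" by (auto simp: vec_eq_iff)
  have "\<alpha> A = coord A p / coord A q" if A: "A \<in> T" for A
  proof -
    have "conj_by A X = smult_mat (\<alpha> A) X" using X(1) A by (simp add: weight_space_def)
    then have "coord A p / coord A q * conj_by P X $ p $ q = \<alpha> A * conj_by P X $ p $ q"
      using conj_by_T_nth[OF A, of X p q] by (simp add: conj_by_smult[OF invertible_P])
    then show ?thesis using pq by (metis mult_right_cancel)
  qed
  then have "\<alpha> = coord_ratio p q"
    using \<alpha> by (intro extensionalityI[of _ T]) (auto simp: coord_ratio_def)
  then show ?thesis by (rule that)
qed

text \<open>The theorem in diagonal coordinates applies because a ratio of coordinates that is the weight of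
  a nonzero element of the Lie algebra of \<open>G\<close> is a root, so that \<open>u\<close> has different coordinates there.\<close>

theorem centralizer_of_regular:
  assumes u: "u \<in> lie_algebra T" "\<And>\<alpha>. \<alpha> \<in> roots G T \<Longrightarrow> differential T \<alpha> u \<noteq> 0"
    and g: "g \<in> G" "conj_by g u = u" and A: "A \<in> T"
  shows "conj_by g A = A"
proof -
  note inv_G = matrix_groupD(3)[OF group_G]
  have "conj_by P g ** conj_by P A = conj_by P A ** conj_by P g"
  proof (rule centralizer_of_regular_diagonal[where G = "conj_by P ` G" and T = "conj_by P ` T" and u = "coord u"])
    show "matrix_group (conj_by P ` G)" "matrix_group (conj_by P ` T)"
      by (rule matrix_group_conj_by[OF invertible_P group_G], rule matrix_group_conj_by[OF invertible_P group_T])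
    show "connectedin zariski (conj_by P ` G)" by (rule connectedin_conj_by[OF connected_G])
    show "conj_by P ` T \<subseteq> conj_by P ` G" using T_subset by blast
    show "diagonal_matrix t" if "t \<in> conj_by P ` T" for t using that diagonal_T by blast
    show "conj_by P g \<in> conj_by P ` G" "conj_by P A \<in> conj_by P ` T" using g(1) A by blast+
  next
    fix p q p' q'
    assume eq: "\<And>t. t \<in> conj_by P ` T \<Longrightarrow> t $ p $ p / t $ q $ q = t $ p' $ p' / t $ q' $ q'"
    have "coord A p * coord A q' = coord A p' * coord A q" if "A \<in> T" for A
      using eq[of "conj_by P A"] that coord_nonzero[OF that] by (simp add: coord_def field_simps)
    then have "deriv_at (\<lambda>A. coord A p * coord A q') (mat 1) u = deriv_at (\<lambda>A. coord A p' * coord A q) (mat 1) u"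
      by (intro deriv_at_eq_on[OF u(1)] poly_fun.mult poly_fun_coord)
    then show "coord u p - coord u q = coord u p' - coord u q'"
      by (simp add: deriv_at_mult[OF poly_fun_coord poly_fun_coord] algebra_simps)
  next
    fix X p q assume X: "X \<in> lie_algebra (conj_by P ` G)" "X \<noteq> 0"
      "\<And>t. t \<in> conj_by P ` T \<Longrightarrow> conj_by t X = smult_mat (t $ p $ p / t $ q $ q) X"
      "\<exists>t\<in>conj_by P ` T. t $ p $ p \<noteq> t $ q $ q"
    define Y where "Y = conj_by (matrix_inv P) X"
    have XY: "X = conj_by P Y" by (simp add: Y_def invertible_P)
    have "conj_by (matrix_inv P) ` conj_by P ` G = G" by (simp add: image_image invertible_P)
    then have "Y \<in> lie_algebra G"
      using lie_algebra_conj_by[OF invertible_matrix_inv[OF invertible_P] X(1)] by (simp add: Y_def)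
    moreover have "Y \<noteq> 0" using X(2) XY by (auto simp: conj_by_def)
    moreover have "conj_by A Y = smult_mat (coord A p / coord A q) Y" if "A \<in> T" for A
    proof -
      have "conj_by (conj_by P A) X = smult_mat (coord A p / coord A q) X"
        using X(3)[of "conj_by P A"] that by (simp add: coord_def)
      then have "conj_by P (conj_by A Y) = conj_by P (smult_mat (coord A p / coord A q) Y)"
        unfolding XY using conj_by_conj_by[OF invertible_P matrix_groupD(3)[OF group_T that]]
        by (simp add: conj_by_smult[OF invertible_P])
      then show ?thesis using invertible_P by simp
    qed
    moreover have "\<exists>A\<in>T. coord A p \<noteq> coord A q" using X(4) by (auto simp: coord_def)
    ultimately have "coord_ratio p q \<in> roots G T" by (rule coord_ratio_root)
    then show "coord u p \<noteq> coord u q" using u(2) coord_ratio_character(2)[OF u(1)] by fastforce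
  next
    fix i j assume nz: "conj_by P g $ i $ j \<noteq> 0"
    have "g ** u = u ** g" using g(2) conj_by_commute_iff[OF inv_G[OF g(1)]] by blast
    then have "conj_by P g ** conj_by P u = conj_by P u ** conj_by P g"
      by (simp flip: conj_by_mult[OF invertible_P])
    then have "(conj_by P g ** conj_by P u) $ i $ j = (conj_by P u ** conj_by P g) $ i $ j" by simp
    then show "coord u i = coord u j"
      using nz by (simp add: diagonal_matrix_mult_nth[OF diagonal_lie_T[OF u(1)]] coord_def)
  qed
  then have "g ** A = A ** g" by (simp add: invertible_P flip: conj_by_mult[OF invertible_P])
  then show ?thesis using conj_by_commute_iff[OF inv_G[OF g(1)]] by blast
qed

text \<open>An element \<open>g\<close> normalizing \<open>T\<close> permutes the coordinates.  The permutation is read off from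
  a nonzero term in the expansion of \<open>det g\<close>, by comparing entries in \<open>g A = (g A g\<^sup>-\<^sup>1) g\<close>.\<close>

lemma normalizer_permutes_coords:
  assumes g: "g \<in> G" "conj_by g ` T = T"
  obtains \<sigma> where "\<And>X i. X \<in> T \<or> X \<in> lie_algebra T \<Longrightarrow> coord (conj_by g X) i = coord X (\<sigma> i)"
    and "\<And>X. X \<in> lie_algebra T \<Longrightarrow> conj_by g X \<in> lie_algebra T" and "\<sigma> permutes UNIV"
proof -
  note inv_g = matrix_groupD(3)[OF group_G g(1)]
  have lie: "conj_by g X \<in> lie_algebra T" if "X \<in> lie_algebra T" for X
    using lie_algebra_conj_by[OF inv_g that] g(2) by simp
  have "det (conj_by P g) \<noteq> 0"
    using invertible_conj_by[OF invertible_P inv_g] by (simp add: invertible_det_nz)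
  then obtain \<sigma> where \<sigma>: "\<sigma> permutes UNIV" "(\<Prod>i\<in>UNIV. conj_by P g $ i $ \<sigma> i) \<noteq> 0"
    unfolding det_def by (metis (mono_tags, lifting) mem_Collect_eq mult_zero_right sum.neutral)
  have "coord (conj_by g X) i = coord X (\<sigma> i)" if X: "X \<in> T \<or> X \<in> lie_algebra T" for X i
  proof -
    have d: "diagonal_matrix (conj_by P X)" "diagonal_matrix (conj_by P (conj_by g X))"
      using X g(2) diagonal_T diagonal_lie_T lie by blast+
    have "conj_by g X ** g = g ** X" using inv_g by (simp add: conj_by_def)
    then have "conj_by P (conj_by g X) ** conj_by P g = conj_by P g ** conj_by P X"
      by (simp flip: conj_by_mult[OF invertible_P])
    then have "(conj_by P (conj_by g X) ** conj_by P g) $ i $ \<sigma> i = (conj_by P g ** conj_by P X) $ i $ \<sigma> i" by simp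
    moreover have "conj_by P g $ i $ \<sigma> i \<noteq> 0" using \<sigma>(2) by (simp add: prod_zero_iff)
    ultimately show ?thesis by (simp add: diagonal_matrix_mult_nth[OF d(1)] diagonal_matrix_mult_nth[OF d(2)] coord_def)
  qed
  then show ?thesis using that lie \<sigma>(1) by blast
qed

text \<open>The Lie algebra of a torus is cut out by linear equations with integral coefficients, so it is
  stable under additive maps applied to the coordinates: the differential of a function on \<open>T\<close> is a
  sum over its monomials, where equal characters have equal differentials, and these are integral
  linear forms.\<close>

lemma additive_map_preserves_lie_T:
  fixes \<phi> :: "'k \<Rightarrow> 'k"
  assumes \<phi>: "\<And>x y. \<phi> (x + y) = \<phi> x + \<phi> y" and X: "X \<in> lie_algebra T"
  shows "from_coords (\<lambda>i. \<phi> (coord X i)) \<in> lie_algebra T"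
  unfolding lie_algebra_iff
proof
  fix p assume p: "p \<in> vanishing_ideal T"
  then have pf: "p \<in> poly_fun" by (simp add: vanishing_ideal_def)
  let ?q = "\<lambda>B. p (matrix_inv P ** B ** P)"
  have q_def: "?q B = p (conj_by (matrix_inv P) B)" for B
    by (simp add: conj_by_def matrix_inv_matrix_inv invertible_P)
  obtain L :: "('k \<times> ('n \<Rightarrow> nat)) list" where
    L: "\<And>d. ?q (diag_mat d) = (\<Sum>(a, \<mu>)\<leftarrow>L. a * (\<Prod>i\<in>UNIV. d i ^ \<mu> i))"
      "\<And>x. deriv_at ?q (mat 1) (diag_mat x) = (\<Sum>(a, \<mu>)\<leftarrow>L. a * (\<Sum>i\<in>UNIV. of_nat (\<mu> i) * x i))"
    using poly_fun_on_diagonal[OF poly_fun_translate[OF pf]] by blast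
  let ?a = "\<lambda>l. fst (L ! l)" and ?\<mu> = "\<lambda>l. snd (L ! l)"
  let ?m = "\<lambda>\<mu> A. \<Prod>i\<in>UNIV. coord A i ^ \<mu> i" and ?x = "\<lambda>i. \<phi> (coord X i)"
  have \<phi>0: "\<phi> 0 = 0" using \<phi>[of 0 0] by simp
  have \<phi>_nat: "\<phi> (of_nat k * x) = of_nat k * \<phi> x" for k x
    by (induction k) (simp_all add: \<phi>0 \<phi> distrib_right)
  have \<phi>_sum: "\<phi> (\<Sum>i\<in>S. f i) = (\<Sum>i\<in>S. \<phi> (f i))" for f and S :: "'n set"
    by (induction S rule: infinite_finite_induct) (simp_all add: \<phi>0 \<phi>)
  have "(\<Sum>l\<in>{..<length L}. (\<Sum>i\<in>UNIV. of_nat (?\<mu> l i) * ?x i) * ?a l) = 0"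
  proof (rule characters_relation_weighted[where M = T and e = "mat 1" and mul = "(**)" and \<eta> = "\<lambda>l. ?m (?\<mu> l)"])
    fix A assume A: "A \<in> T"
    have "(\<Sum>l<length L. ?a l * ?m (?\<mu> l) A) = ?q (diag_mat (coord A))"
      unfolding L(1) by (simp add: sum_list_sum_nth atLeast0LessThan case_prod_beta)
    also have "\<dots> = p A" using from_coords_coord[of A] A by (simp add: q_def from_coords_def)
    also have "\<dots> = 0" using p A by (simp add: vanishing_ideal_def)
    finally show "(\<Sum>l<length L. ?a l * ?m (?\<mu> l) A) = 0" .
  next
    fix l m assume "\<And>A. A \<in> T \<Longrightarrow> ?m (?\<mu> l) A = ?m (?\<mu> m) A"
    then have "deriv_at (?m (?\<mu> l)) (mat 1) X = deriv_at (?m (?\<mu> m)) (mat 1) X"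
      by (intro deriv_at_eq_on[OF X] poly_fun_prod poly_fun_power poly_fun_coord)
    then have "(\<Sum>i\<in>UNIV. of_nat (?\<mu> l i) * coord X i) = (\<Sum>i\<in>UNIV. of_nat (?\<mu> m i) * coord X i)"
      by (simp add: deriv_at_prod_power poly_fun_coord)
    then have "\<phi> (\<Sum>i\<in>UNIV. of_nat (?\<mu> l i) * coord X i) = \<phi> (\<Sum>i\<in>UNIV. of_nat (?\<mu> m i) * coord X i)"
      by simp
    then show "(\<Sum>i\<in>UNIV. of_nat (?\<mu> l i) * ?x i) = (\<Sum>i\<in>UNIV. of_nat (?\<mu> m i) * ?x i)"
      by (simp only: \<phi>_sum \<phi>_nat)
  qed (use matrix_groupD(1,2)[OF group_T] in \<open>simp_all add: coord_mult power_mult_distrib prod.distrib\<close>)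
  then have "deriv_at ?q (mat 1) (diag_mat ?x) = 0"
    unfolding L(2) by (simp add: sum_list_sum_nth atLeast0LessThan case_prod_beta mult.commute)
  then show "deriv_at p (mat 1) (from_coords ?x) = 0"
    unfolding deriv_at_comp_linear[OF pf] using invertible_P
    by (simp add: from_coords_def conj_by_def matrix_inv_matrix_inv)
qed

end

section \<open>Galois conjugation of roots of unity\<close>

definition int_eval :: "int poly \<Rightarrow> 'k::comm_ring_1 \<Rightarrow> 'k" where
  "int_eval p x = poly (map_poly of_int p) x"

lemma int_eval_simps [simp]:
  "int_eval 0 x = 0"
  "int_eval (pCons a p) x = of_int a + x * int_eval p x"
  "int_eval (monom c n) x = of_int c * x ^ n"
  "int_eval 1 x = 1"
  by (simp_all add: int_eval_def map_poly_pCons map_poly_monom poly_monom)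

lemma int_eval_add [simp]: "int_eval (p + q) x = int_eval p x + int_eval q x"
  by (induction p q rule: poly_induct2) (simp_all add: algebra_simps)

lemma int_eval_smult [simp]: "int_eval (smult a p) x = of_int a * int_eval p x"
  by (induction p) (simp_all add: algebra_simps)

lemma int_eval_diff [simp]: "int_eval (p - q) x = int_eval p x - int_eval q x"
  using int_eval_add[of "p - q" q x] by simp

lemma int_eval_mult [simp]: "int_eval (p * q) x = int_eval p x * int_eval q x"
  by (induction p) (simp_all add: algebra_simps)

lemma int_eval_power [simp]: "int_eval (p ^ n) x = int_eval p x ^ n"
  by (induction n) simp_all

lemma int_eval_pcompose [simp]: "int_eval (pcompose p q) x = int_eval p (int_eval q x)"
  by (induction p) (simp_all add: pcompose_pCons algebra_simps)

text \<open>All binomial coefficients of \<open>p\<close> except the outer two are divisible by \<open>p\<close>.\<close>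

lemma freshmans_dream_dvd:
  fixes x y :: "'a::comm_ring_1"
  assumes p: "prime p"
  shows "of_nat p dvd (x + y) ^ p - (x ^ p + y ^ p)"
proof -
  have p0: "p > 0" using p prime_gt_0_nat by blast
  have "(x + y) ^ p = (\<Sum>k\<le>p. of_nat (p choose k) * x ^ k * y ^ (p - k))" by (rule binomial_ring)
  also have "{..p} = insert 0 (insert p {0<..<p})" using p0 by auto
  also have "(\<Sum>k\<in>insert 0 (insert p {0<..<p}). of_nat (p choose k) * x ^ k * y ^ (p - k)) =
      y ^ p + (x ^ p + (\<Sum>k\<in>{0<..<p}. of_nat (p choose k) * x ^ k * y ^ (p - k)))"
    using p0 by simp
  finally have "(x + y) ^ p - (x ^ p + y ^ p) = (\<Sum>k\<in>{0<..<p}. of_nat (p choose k) * x ^ k * y ^ (p - k))"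
    by simp
  also have "of_nat p dvd \<dots>"
  proof (rule dvd_sum)
    fix k assume "k \<in> {0<..<p}"
    then have "p dvd (p choose k)" using p by (intro dvd_choose_prime) auto
    then obtain m where "p choose k = p * m" ..
    then show "of_nat p dvd of_nat (p choose k) * x ^ k * y ^ (p - k)" by (simp add: mult.assoc)
  qed
  finally show ?thesis .
qed

lemma int_power_prime_cong:
  fixes a :: int
  assumes p: "prime p"
  shows "int p dvd a ^ p - a"
proof (induction a rule: int_induct[where k = 0])
  case base
  then show ?case using p prime_gt_0_nat[OF p] by (simp add: power_0_left)
next
  case (step1 i)
  have "int p dvd ((i + 1) ^ p - (i ^ p + 1 ^ p)) + (i ^ p - i)"
    by (rule dvd_add[OF freshmans_dream_dvd[OF p, of i 1] step1(2)])
  then show ?case by (simp add: algebra_simps)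
next
  case (step2 i)
  have "int p dvd (i ^ p - i) - ((i - 1 + 1) ^ p - ((i - 1) ^ p + 1 ^ p))"
    by (rule dvd_diff[OF step2(2) freshmans_dream_dvd[OF p, of "i - 1" 1]])
  then show ?case by (simp add: algebra_simps)
qed

lemma poly_frobenius_dvd:
  fixes f :: "int poly"
  assumes p: "prime p"
  shows "[:int p:] dvd pcompose f (monom 1 p) - f ^ p"
proof (induction f)
  case 0
  then show ?case using prime_gt_0_nat[OF p] by (simp add: power_0_left)
next
  case (pCons a f)
  have eq: "pCons a f = [:a:] + monom 1 1 * f" by (simp add: monom_altdef)
  have P: "(of_nat p :: int poly) = [:int p:]" by (simp add: of_nat_poly)
  have d1: "[:int p:] dvd [:a - a ^ p:]"
    using int_power_prime_cong[OF p, of a] by (simp add: dvd_diff_commute)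
  have d2: "[:int p:] dvd monom 1 p * (pcompose f (monom 1 p) - f ^ p)" using pCons.IH by simp
  have d3: "[:int p:] dvd (pCons a f) ^ p - ([:a:] ^ p + (monom 1 1 * f) ^ p)"
    unfolding eq P[symmetric] by (rule freshmans_dream_dvd[OF p])
  have "[:int p:] dvd [:a - a ^ p:] + monom 1 p * (pcompose f (monom 1 p) - f ^ p) -
      ((pCons a f) ^ p - ([:a:] ^ p + (monom 1 1 * f) ^ p))"
    by (rule dvd_diff[OF dvd_add[OF d1 d2] d3])
  also have "[:a - a ^ p:] = [:a:] - [:a:] ^ p" by (simp add: poly_const_pow)
  also have "(monom 1 1 * f) ^ p = monom 1 p * f ^ p" by (simp add: power_mult_distrib monom_power)
  also have "[:a:] - [:a:] ^ p + monom 1 p * (pcompose f (monom 1 p) - f ^ p) -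
      ((pCons a f) ^ p - ([:a:] ^ p + monom 1 p * f ^ p)) =
      [:a:] + monom 1 p * pcompose f (monom 1 p) - (pCons a f) ^ p"
    by (simp add: algebra_simps)
  also have "\<dots> = pcompose (pCons a f) (monom 1 p) - (pCons a f) ^ p" by (simp add: pcompose_pCons)
  finally show ?case .
qed

text \<open>The irreducibility of the cyclotomic polynomials, in the form in which it is used.  Let \<open>f\<close> be
  the minimal polynomial of \<open>c\<close>, so that \<open>X\<^sup>b - 1 = f h\<close>.  If \<open>f\<close> did not vanish at \<open>x = c\<^sup>\<ell>\<close>, then \<open>h\<close>
  would, and differentiating gives \<open>b x\<^sup>b\<^sup>-\<^sup>1 = f(x) h'(x)\<close>; but \<open>f(c\<^sup>\<ell>)\<close> is congruent to \<open>f(c)\<^sup>\<ell> = 0\<close>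
  modulo \<open>\<ell>\<close>, so that \<open>\<ell>\<close> divides \<open>b\<close> in \<open>\<int>[c]\<close> and hence in \<open>\<int>\<close>.\<close>

lemma int_root_prime_power:
  fixes c :: "'k::field_char_0" and p :: "int poly"
  assumes b: "b > 0" "c ^ b = 1" and l: "prime l" "\<not> l dvd b" and p: "int_eval p c = 0"
  shows "int_eval p (c ^ l) = 0"
proof -
  let ?V = "\<lambda>d. \<exists>f. f \<noteq> 0 \<and> int_eval f c = 0 \<and> degree f = d"
  have deg0: "f = 0" if "int_eval f c = 0" "degree f = 0" for f
    using that by (auto elim!: degree_eq_zeroE)
  let ?X = "monom 1 b - 1 :: int poly"
  have X0: "?X \<noteq> 0"
  proof
    assume "?X = 0"
    then have "coeff ?X b = 0" by simp
    then show False using b(1) by simp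
  qed
  have X: "int_eval ?X c = 0" using b(2) by simp
  define d where "d = (LEAST d. ?V d)"
  have "?V d" unfolding d_def by (rule LeastI[of ?V "degree ?X"]) (use X0 X in blast)
  then obtain f0 where f0: "f0 \<noteq> 0" "int_eval f0 c = 0" "degree f0 = d" by blast
  have least: "f = 0" if "int_eval f c = 0" "degree f < d" for f
    using not_less_Least[of "degree f" ?V] that unfolding d_def by blast
  define f where "f = primitive_part f0"
  have content_f: "content f = 1" using f0(1) by (simp add: f_def)
  have f: "f \<noteq> 0" "degree f = d" using f0 by (auto simp: f_def)
  have "int_eval (smult (content f0) f) c = 0" using f0(2) by (simp add: f_def)
  then have fc: "int_eval f c = 0" using f0(1) by simp
  have d0: "d \<noteq> 0" using deg0[of f] f fc by blast
  have red: "\<exists>q r k. smult (lead_coeff f ^ k) g = f * q + r \<and> (r = 0 \<or> degree r < d)" for g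
    using pseudo_divmod[OF f(1) surjective_pairing, of g] f(2) by blast
  have dvd: "f dvd g" if g: "int_eval g c = 0" for g
  proof -
    obtain q r k where qr: "smult (lead_coeff f ^ k) g = f * q + r" "r = 0 \<or> degree r < d"
      using red by blast
    have "int_eval (smult (lead_coeff f ^ k) g) c = int_eval (f * q + r) c" using qr(1) by simp
    then have "int_eval r c = 0" using g fc by simp
    then have "r = 0" using qr(2) least by blast
    then have eq: "smult (lead_coeff f ^ k) g = f * q" using qr(1) by simp
    have "content q = normalize (lead_coeff f ^ k) * content g"
      using arg_cong[OF eq, of content] by (simp add: content_mult content_f)
    then have "[:lead_coeff f ^ k:] dvd q" by (simp add: const_poly_dvd_iff_dvd_content)
    then obtain q' where "q = smult (lead_coeff f ^ k) q'" by (auto simp: dvd_def)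
    then have "smult (lead_coeff f ^ k) g = smult (lead_coeff f ^ k) (f * q')" using eq by simp
    then have "smult (lead_coeff f ^ k) (g - f * q') = 0" by (simp only: smult_diff_right diff_self)
    then have "g - f * q' = 0" using f(1) by simp
    then show ?thesis by simp
  qed
  obtain h where h: "?X = f * h" using dvd[OF X] ..
  have lc: "is_unit (lead_coeff f)"
  proof -
    have "coeff ?X b = 1" using b(1) by simp
    moreover have "degree ?X = b"
      using b(1) by (intro antisym degree_diff_le degree_monom_le le_degree) simp_all
    ultimately have "lead_coeff ?X = 1" by simp
    then show ?thesis using h by (metis dvd_triv_left lead_coeff_mult)
  qed
  define x where "x = c ^ l"
  have xb: "x ^ b = 1" using b(2) by (simp add: x_def power_mult[symmetric] mult.commute power_mult)
  have "int_eval f x = 0"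
  proof (rule ccontr)
    assume fx: "int_eval f x \<noteq> 0"
    have "int_eval f x * int_eval h x = 0" using arg_cong[OF h, of "\<lambda>p. int_eval p x"] xb by simp
    then have hx: "int_eval h x = 0" using fx by simp
    have "pderiv ?X = f * pderiv h + h * pderiv f" unfolding h by (simp add: pderiv_mult mult.commute)
    then have "int_eval (pderiv ?X) x = int_eval f x * int_eval (pderiv h) x" by (simp add: hx)
    then have "of_nat b * x ^ (b - 1) = int_eval f x * int_eval (pderiv h) x"
      by (simp add: pderiv_diff pderiv_monom)
    then have bx: "of_nat b = int_eval f x * int_eval (pderiv h) x * x"
      using xb b(1) by (metis (no_types, lifting) mult.assoc mult.right_neutral power_minus_mult)
    obtain g where g: "pcompose f (monom 1 l) - f ^ l = [:int l:] * g"
      using poly_frobenius_dvd[OF l(1), of f] ..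
    have "int_eval f x = of_nat l * int_eval g c"
      using arg_cong[OF g, of "\<lambda>p. int_eval p c"] fc prime_gt_0_nat[OF l(1)] by (simp add: x_def power_0_left)
    then have "of_nat b = of_nat l * int_eval (g * pcompose (pderiv h * monom 1 1) (monom 1 l)) c"
      using bx by (simp add: x_def mult.assoc)
    then obtain Q where Q: "of_nat b = of_nat l * int_eval Q c" by blast
    \<comment> \<open>Reducing \<open>Q\<close> modulo \<open>f\<close>, whose leading coefficient is a unit, makes the degrees so small that the
      relation at \<open>c\<close> becomes one between polynomials.\<close>
    obtain q r k where qr: "smult (lead_coeff f ^ k) Q = f * q + r" "r = 0 \<or> degree r < d"
      using red by blast
    let ?u = "lead_coeff f ^ k"
    have "int_eval (smult ?u Q) c = int_eval r c" unfolding qr(1) by (simp add: fc)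
    then have "of_int (?u * int b) = of_nat l * int_eval r c" using Q by simp
    then have "int_eval ([:?u * int b:] - smult (int l) r) c = 0" by simp
    moreover have "degree ([:?u * int b:] - smult (int l) r) < d"
      using qr(2) d0 by (intro degree_diff_less) auto
    ultimately have "[:?u * int b:] - smult (int l) r = 0" by (rule least)
    then have "coeff ([:?u * int b:] - smult (int l) r) 0 = 0" by simp
    then have "?u * int b = int l * coeff r 0" by simp
    then have "int l dvd ?u * int b" by simp
    moreover have "is_unit ?u" using lc by (simp add: power_abs)
    ultimately have "int l dvd int b" by (simp add: dvd_mult_unit_iff')
    then show False using l(2) by simp
  qed
  then show ?thesis using dvd[OF p] by (auto simp: x_def dvd_def)
qed

lemma int_root_coprime_power:
  fixes c :: "'k::field_char_0"
  assumes "b > 0" "c ^ b = 1" "m > 0" "coprime m b" "int_eval p c = 0"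
  shows "int_eval p (c ^ m) = 0"
  using assms(2-)
proof (induction m arbitrary: c rule: less_induct)
  case (less m)
  show ?case
  proof (cases "m = 1")
    case True
    then show ?thesis using less.prems by simp
  next
    case False
    then obtain l where l: "prime l" "l dvd m" using prime_factor_nat by blast
    then obtain m' where m': "m = l * m'" by blast
    have m0: "m' > 0" "m' < m" using m' less.prems(2) prime_gt_1_nat[OF l(1)] by auto
    have "\<not> l dvd b" using l less.prems(3) by (metis coprime_common_divisor not_prime_unit)
    then have root: "int_eval p (c ^ l) = 0" by (rule int_root_prime_power[OF assms(1) less.prems(1) l(1) _ less.prems(4)])
    have one: "(c ^ l) ^ b = 1"
      using less.prems(1) by (metis mult.commute power_mult power_one)
    have "coprime m' b" using less.prems(3) m' by simp
    from less.IH[OF m0(2) one m0(1) this root] have "int_eval p ((c ^ l) ^ m') = 0" .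
    then show ?thesis by (simp add: m' power_mult)
  qed
qed

text \<open>This form of primitivity is the one that compares with orders in a group.\<close>

definition primitive_root :: "nat \<Rightarrow> 'k::field \<Rightarrow> bool" where
  "primitive_root b c \<longleftrightarrow> b > 0 \<and> (\<forall>m. c ^ m = 1 \<longleftrightarrow> b dvd m)"

lemma primitive_root_power_eq:
  fixes c c' :: "'k::field"
  assumes c: "primitive_root b c" and c': "primitive_root b c'"
  obtains m where "m > 0" "coprime m b" "c' = c ^ m"
proof -
  have b: "b > 0" using c by (simp add: primitive_root_def)
  have c0: "c \<noteq> 0" using c by (metis dvd_refl power_0_left primitive_root_def zero_neq_one less_irrefl)
  have inj: "inj_on (\<lambda>m. c ^ m) {..<b}"
  proof (rule linorder_inj_onI)
    fix i j assume ij: "i < j" "i \<in> {..<b}" "j \<in> {..<b}"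
    show "c ^ i \<noteq> c ^ j"
    proof
      assume eq: "c ^ i = c ^ j"
      have "c ^ i * c ^ (j - i) = c ^ j" using ij(1) by (simp flip: power_add)
      then have "c ^ i * 1 = c ^ i * c ^ (j - i)" using eq by simp
      then have "c ^ (j - i) = 1" using c0 by (metis mult_cancel_left power_not_zero)
      then have "b dvd j - i" using c by (simp add: primitive_root_def)
      then show False using ij by (auto dest: dvd_imp_le)
    qed
  qed auto
  let ?p = "monom 1 b - 1 :: 'k poly"
  have p0: "?p \<noteq> 0"
  proof
    assume "?p = 0"
    then have "coeff ?p b = 0" by simp
    then show False using b by simp
  qed
  have deg: "degree ?p \<le> b" by (rule degree_diff_le) (simp_all add: degree_monom_le)
  let ?S = "{x. poly ?p x = 0}"
  have "(\<lambda>m. c ^ m) ` {..<b} \<subseteq> ?S"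
    using c by (auto simp: poly_monom primitive_root_def simp flip: power_mult)
  moreover have "card ?S \<le> card ((\<lambda>m. c ^ m) ` {..<b})"
    using card_poly_roots_bound[OF p0] deg by (simp add: card_image[OF inj])
  ultimately have "(\<lambda>m. c ^ m) ` {..<b} = ?S"
    using poly_roots_finite[OF p0] by (intro card_seteq)
  moreover have "c' \<in> ?S" using c' by (simp add: poly_monom primitive_root_def)
  ultimately obtain m0 where m0: "c' = c ^ m0" by blast
  define m where "m = m0 + b"
  have m: "c' = c ^ m" using m0 c by (simp add: m_def power_add primitive_root_def)
  have "coprime m b"
  proof (rule coprimeI)
    fix g assume g: "g dvd m" "g dvd b"
    then obtain m' b' where "m = g * m'" "b = g * b'" by (auto simp: dvd_def)
    moreover then have "c' ^ b' = c ^ (b * m')" by (simp add: m power_mult[symmetric] mult.commute mult.left_commute)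
    then have "c' ^ b' = 1" using c by (simp add: primitive_root_def)
    then have "b dvd b'" using c' by (simp add: primitive_root_def)
    ultimately show "is_unit g" using b by simp
  qed
  moreover have "m > 0" using b by (simp add: m_def)
  ultimately show ?thesis using that m by blast
qed

lemma primitive_root_inverse: "primitive_root b c \<Longrightarrow> primitive_root b (inverse c)"
  by (simp add: primitive_root_def power_inverse)

text \<open>A substitute for an automorphism of the field that maps \<open>c\<close> to \<open>c'\<close>.  From a rational linear
  functional \<open>\<phi>\<close> one gets the additive map \<open>\<Phi>(y) = \<Sum>\<^sub>j c'\<^sup>-\<^sup>j \<phi>(c\<^sup>j y)\<close> with the required equivariance.
  That some \<open>\<Phi>(d)\<close> is nonzero may be checked with \<open>c\<close> in place of \<open>c'\<close>, because the two are
  Galois conjugate; and then the \<open>\<Phi>(d)\<close> are the coordinates of \<open>\<Sum>\<^sub>j c\<^sup>-\<^sup>j c\<^sup>j d = b d\<close>.\<close>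

lemma exists_equivariant_additive:
  fixes c c' d :: "'k::field_char_0"
  assumes c: "primitive_root b c" and c': "primitive_root b c'" and d: "d \<noteq> 0"
  obtains \<Phi> :: "'k \<Rightarrow> 'k" where "\<And>x y. \<Phi> (x + y) = \<Phi> x + \<Phi> y" "\<And>y. \<Phi> (c * y) = c' * \<Phi> y" "\<Phi> d \<noteq> 0"
proof -
  have b: "b > 0" using c by (simp add: primitive_root_def)
  have cb: "c ^ b = 1" "c' ^ b = 1" using c c' by (auto simp: primitive_root_def)
  then have c0: "c \<noteq> 0" "c' \<noteq> 0" using b by (auto simp: power_0_left)
  obtain \<phi> :: "'k \<Rightarrow> 'k \<Rightarrow> rat" where \<phi>: "\<And>\<beta> x y. \<phi> \<beta> (x + y) = \<phi> \<beta> x + \<phi> \<beta> y"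
      "\<And>x. finite {\<beta>. \<phi> \<beta> x \<noteq> 0}" "\<And>x. (\<Sum>\<beta> | \<phi> \<beta> x \<noteq> 0. of_rat (\<phi> \<beta> x) * \<beta>) = x"
    by (rule rational_coordinates) blast
  define \<Phi> where "\<Phi> c' \<beta> y = (\<Sum>j<b. inverse c' ^ j * of_rat (\<phi> \<beta> (c ^ j * y)))" for c' :: 'k and \<beta> y
  have "\<exists>\<beta>. \<Phi> c \<beta> d \<noteq> 0"
  proof (rule ccontr)
    assume "\<not> ?thesis"
    then have zero: "\<Phi> c \<beta> d = 0" for \<beta> by blast
    define S where "S = (\<Union>j<b. {\<beta>. \<phi> \<beta> (c ^ j * d) \<noteq> 0})"
    have "finite S" unfolding S_def using \<phi>(2) by blast
    have "(\<Sum>\<beta>\<in>S. \<Phi> c \<beta> d * \<beta>) = (\<Sum>j<b. inverse c ^ j * (\<Sum>\<beta>\<in>S. of_rat (\<phi> \<beta> (c ^ j * d)) * \<beta>))"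
      unfolding \<Phi>_def sum_distrib_right sum_distrib_left by (subst sum.swap) (simp add: mult.assoc)
    also have "\<dots> = (\<Sum>j<b. inverse c ^ j * (c ^ j * d))"
    proof (intro sum.cong refl arg_cong[where f = "\<lambda>x. _ * x"])
      fix j assume "j \<in> {..<b}"
      then have "(\<Sum>\<beta>\<in>S. of_rat (\<phi> \<beta> (c ^ j * d)) * \<beta>) =
          (\<Sum>\<beta> | \<phi> \<beta> (c ^ j * d) \<noteq> 0. of_rat (\<phi> \<beta> (c ^ j * d)) * \<beta>)"
        by (intro sum.mono_neutral_right \<open>finite S\<close>) (auto simp: S_def)
      then show "(\<Sum>\<beta>\<in>S. of_rat (\<phi> \<beta> (c ^ j * d)) * \<beta>) = c ^ j * d" using \<phi>(3) by simp
    qed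
    also have "\<dots> = of_nat b * d"
      using c0(1) by (simp add: power_inverse flip: mult.assoc)
    finally show False using zero b d by simp
  qed
  then obtain \<beta> where \<beta>: "\<Phi> c \<beta> d \<noteq> 0" ..
  have nonzero: "\<Phi> c' \<beta> d \<noteq> 0"
  proof
    assume 0: "\<Phi> c' \<beta> d = 0"
    define N where "N = (\<Prod>j<b. snd (quotient_of (\<phi> \<beta> (c ^ j * d))))"
    have N: "N > 0" unfolding N_def by (intro prod_pos) (simp add: quotient_of_denom_pos')
    have "\<exists>z. of_int N * \<phi> \<beta> (c ^ j * d) = of_int z" if j: "j < b" for j
    proof -
      let ?q = "\<phi> \<beta> (c ^ j * d)"
      have "N = snd (quotient_of ?q) * (\<Prod>j\<in>{..<b} - {j}. snd (quotient_of (\<phi> \<beta> (c ^ j * d))))"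
        unfolding N_def using j by (simp add: prod.remove)
      moreover have "of_int (snd (quotient_of ?q)) * ?q = of_int (fst (quotient_of ?q))"
        using quotient_of_div[of ?q "fst (quotient_of ?q)" "snd (quotient_of ?q)"] quotient_of_denom_pos'[of ?q]
        by (simp add: field_simps)
      ultimately have "of_int N * ?q = of_int (fst (quotient_of ?q) * (\<Prod>j\<in>{..<b} - {j}. snd (quotient_of (\<phi> \<beta> (c ^ j * d)))))"
        by (simp add: mult.assoc mult.left_commute)
      then show ?thesis by blast
    qed
    then obtain z where z: "\<And>j. j < b \<Longrightarrow> of_int N * \<phi> \<beta> (c ^ j * d) = of_int (z j)" by metis
    define p where "p = (\<Sum>j<b. monom (z j) j)"
    have sum: "int_eval (\<Sum>j\<in>S. monom (z j) j) x = (\<Sum>j\<in>S. of_int (z j) * x ^ j)" for x :: 'k and S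
      by (induction S rule: infinite_finite_induct) simp_all
    have p: "int_eval p (inverse e) = of_int N * \<Phi> e \<beta> d" for e :: 'k
    proof -
      have "of_int (z j) * inverse e ^ j = of_int N * (inverse e ^ j * of_rat (\<phi> \<beta> (c ^ j * d)))" if "j < b" for j
      proof -
        have "(of_int (z j) :: 'k) = of_rat (of_int N * \<phi> \<beta> (c ^ j * d))" unfolding z[OF that] by simp
        then show ?thesis by (simp add: of_rat_mult)
      qed
      then show ?thesis unfolding p_def sum \<Phi>_def sum_distrib_left by (intro sum.cong) auto
    qed
    obtain m where m: "m > 0" "coprime m b" "inverse c = inverse c' ^ m"
      using primitive_root_power_eq[OF primitive_root_inverse[OF c'] primitive_root_inverse[OF c]] by blast
    have "int_eval p (inverse c' ^ m) = 0"
      using 0 cb(2) by (intro int_root_coprime_power[OF b _ m(1,2)]) (simp_all add: p power_inverse)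
    then show False using \<beta> N by (simp add: p flip: m(3))
  qed
  show ?thesis
  proof (rule that[of "\<Phi> c' \<beta>"])
    show "\<Phi> c' \<beta> (x + y) = \<Phi> c' \<beta> x + \<Phi> c' \<beta> y" for x y
      unfolding \<Phi>_def by (simp add: distrib_left \<phi>(1) of_rat_add sum.distrib)
    fix y
    let ?F = "\<lambda>j. inverse c' ^ j * of_rat (\<phi> \<beta> (c ^ j * y))"
    have "\<Phi> c' \<beta> (c * y) = (\<Sum>j<b. c' * ?F (Suc j))"
      unfolding \<Phi>_def using c0(2) by (intro sum.cong refl) (simp add: mult_ac)
    also have "\<dots> = c' * (\<Sum>j<b. ?F (Suc j))" by (simp only: sum_distrib_left)
    also have "(\<Sum>j<b. ?F (Suc j)) = (\<Sum>j<Suc b. ?F j) - ?F 0" by (subst sum.lessThan_Suc_shift) simp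
    also have "\<dots> = \<Phi> c' \<beta> y" using cb by (simp add: \<Phi>_def power_inverse)
    finally show "\<Phi> c' \<beta> (c * y) = c' * \<Phi> c' \<beta> y" .
  qed (rule nonzero)
qed

lemma exists_equivariant_additive_nonvanishing:
  fixes c c' :: "'k::field_char_0"
  assumes c: "primitive_root b c" and c': "primitive_root b c'" and D: "finite D" "0 \<notin> D"
  obtains \<Phi> :: "'k \<Rightarrow> 'k" where "\<And>x y. \<Phi> (x + y) = \<Phi> x + \<Phi> y" "\<And>y. \<Phi> (c * y) = c' * \<Phi> y"
    "\<And>d. d \<in> D \<Longrightarrow> \<Phi> d \<noteq> 0"
proof -
  let ?F = "{\<Phi> :: 'k \<Rightarrow> 'k. (\<forall>x y. \<Phi> (x + y) = \<Phi> x + \<Phi> y) \<and> (\<forall>y. \<Phi> (c * y) = c' * \<Phi> y)}"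
  have "?F \<noteq> {}"
    unfolding ex_in_conv[symmetric] by (rule exI[of _ "\<lambda>_. 0"]) simp
  moreover have "\<exists>\<Phi>\<in>?F. \<Phi> d \<noteq> 0" if "d \<in> D" for d
  proof -
    have "d \<noteq> 0" using that D(2) by auto
    from exists_equivariant_additive[OF c c' this]
    obtain \<Phi> :: "'k \<Rightarrow> 'k" where \<Phi>: "\<And>x y. \<Phi> (x + y) = \<Phi> x + \<Phi> y" "\<And>y. \<Phi> (c * y) = c' * \<Phi> y" "\<Phi> d \<noteq> 0"
      by blast
    then show ?thesis by (intro bexI[of _ \<Phi>]) simp_all
  qed
  moreover have "(\<lambda>x. f x + of_nat m * g x) \<in> ?F" if "f \<in> ?F" "g \<in> ?F" for f g m
    using that by (simp add: distrib_left mult_ac)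
  ultimately have "\<exists>\<Phi>\<in>?F. \<forall>d\<in>D. \<Phi> d \<noteq> 0"
    by (intro exists_nonvanishing_on_finite[OF D(1)])
  then show ?thesis using that by blast
qed

section \<open>The Weyl group\<close>

lemma group_GL: "group (GL :: ('k::field ^ 'n ^ 'n) monoid)"
proof (rule groupI)
  fix A :: "'k ^ 'n ^ 'n" assume "A \<in> carrier GL"
  then show "\<exists>B\<in>carrier GL. B \<otimes>\<^bsub>GL\<^esub> A = \<one>\<^bsub>GL\<^esub>"
    by (intro bexI[of _ "matrix_inv A"]) (simp_all add: GL_def invertible_matrix_inv)
qed (simp_all add: GL_def invertible_mult matrix_mul_assoc, simp add: invertible_def exI[of _ "mat 1"])

lemma inv_GL: "invertible A \<Longrightarrow> inv\<^bsub>GL\<^esub> A = matrix_inv A" for A :: "'k::field ^ 'n ^ 'n"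
  by (rule group.inv_equality[OF group_GL]) (simp_all add: GL_def invertible_matrix_inv)

lemma subgroup_GL_iff: "subgroup H GL \<longleftrightarrow> matrix_group H" for H :: "('k::field ^ 'n ^ 'n) set"
proof
  assume "subgroup H GL"
  then interpret subgroup H GL .
  have inv: "invertible A" if "A \<in> H" for A using subset that by (auto simp: GL_def)
  have "A ** B \<in> H" if "A \<in> H" "B \<in> H" for A B using m_closed[OF that] by (simp add: GL_def)
  moreover have "mat 1 \<in> H" using one_closed by (simp add: GL_def)
  moreover have "matrix_inv A \<in> H" if "A \<in> H" for A
    using m_inv_closed[OF that] by (simp add: inv_GL[OF inv[OF that]])
  ultimately show "matrix_group H" using inv by (simp add: matrix_group_def)
next
  assume H: "matrix_group H"
  show "subgroup H GL"
  proof
    show "H \<subseteq> carrier GL" using matrix_groupD(3)[OF H] by (auto simp: GL_def)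
    show "A \<otimes>\<^bsub>GL\<^esub> B \<in> H" if "A \<in> H" "B \<in> H" for A B
      using matrix_groupD(2)[OF H that] by (simp add: GL_def)
    show "\<one>\<^bsub>GL\<^esub> \<in> H" using matrix_groupD(1)[OF H] by (simp add: GL_def)
    show "inv\<^bsub>GL\<^esub> A \<in> H" if "A \<in> H" for A
      using matrix_groupD(4)[OF H that] by (simp add: inv_GL[OF matrix_groupD(3)[OF H that]])
  qed
qed

lemma conj_by_image_matrix_inv:
  fixes g :: "'k::field ^ 'n ^ 'n"
  assumes "invertible g" "conj_by g ` T = T" shows "conj_by (matrix_inv g) ` T = T"
proof -
  have "conj_by (matrix_inv g) ` T = conj_by (matrix_inv g) ` conj_by g ` T" using assms(2) by simp
  also have "\<dots> = T" by (simp add: image_image assms(1))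
  finally show ?thesis .
qed

context diagonalized_torus
begin

abbreviation "N \<equiv> torus_normalizer G T"
abbreviation "Z \<equiv> torus_centralizer G T"
abbreviation "N_group \<equiv> GL\<lparr>carrier := N\<rparr>"

lemma matrix_group_N: "matrix_group N"
  unfolding matrix_group_def
proof (intro conjI ballI)
  note inv = matrix_groupD(3)[OF group_G]
  show "mat 1 \<in> N" using matrix_groupD(1)[OF group_G]
    by (simp add: torus_normalizer_def conj_by_def matrix_inv_unique_right(2)[of "mat 1" "mat 1"])
  fix A B assume A: "A \<in> N" and B: "B \<in> N"
  then have AB: "A \<in> G" "B \<in> G" "conj_by A ` T = T" "conj_by B ` T = T" by (auto simp: torus_normalizer_def)
  have "conj_by (A ** B) ` T = conj_by A ` conj_by B ` T"
    unfolding image_image by (intro image_cong refl conj_by_mult_left inv AB)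
  then have "conj_by (A ** B) ` T = T" using AB by simp
  then show "A ** B \<in> N" using AB matrix_groupD(2)[OF group_G] by (simp add: torus_normalizer_def)
next
  fix A assume "A \<in> N"
  then have A: "A \<in> G" "conj_by A ` T = T" by (auto simp: torus_normalizer_def)
  then show "invertible A" by (intro matrix_groupD(3)[OF group_G])
  then show "matrix_inv A \<in> N"
    using A conj_by_image_matrix_inv matrix_groupD(4)[OF group_G] by (simp add: torus_normalizer_def)
qed

lemma group_N: "group N_group"
  using subgroup.subgroup_is_group[OF _ group_GL] matrix_group_N subgroup_GL_iff by blast

lemma normal_Z: "Z \<lhd> N_group"
proof -
  note inv = matrix_groupD(3)[OF group_G] and invN = matrix_groupD(3)[OF matrix_group_N]
  have ZN: "Z \<subseteq> N" by (auto simp: torus_centralizer_def torus_normalizer_def)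
  have inv_N: "inv\<^bsub>N_group\<^esub> A = matrix_inv A" if "A \<in> N" for A
    using group.m_inv_consistent[OF group_GL, of N A] matrix_group_N that inv_GL[OF invN[OF that]]
    by (simp add: subgroup_GL_iff)
  have Z_conj: "conj_by A B = B" if "A \<in> Z" "B \<in> T" for A B using that by (simp add: torus_centralizer_def)
  have Z_G: "A \<in> G" if "A \<in> Z" for A using that by (simp add: torus_centralizer_def)
  have "subgroup Z N_group"
  proof
    show "Z \<subseteq> carrier N_group" using ZN by simp
    show "A \<otimes>\<^bsub>N_group\<^esub> B \<in> Z" if "A \<in> Z" "B \<in> Z" for A B
      using that matrix_groupD(2)[OF group_G]
      by (simp add: GL_def torus_centralizer_def conj_by_mult_left inv)
    show "\<one>\<^bsub>N_group\<^esub> \<in> Z"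
      using matrix_groupD(1)[OF group_G]
      by (simp add: GL_def torus_centralizer_def conj_by_def matrix_inv_unique_right(2)[of "mat 1" "mat 1"])
    show "inv\<^bsub>N_group\<^esub> A \<in> Z" if A: "A \<in> Z" for A
    proof -
      have "conj_by (matrix_inv A) B = B" if "B \<in> T" for B
        using conj_by_inverse(1)[OF inv[OF Z_G[OF A]], of B] Z_conj[OF A that] by simp
      then show ?thesis
        using A ZN inv_N matrix_groupD(4)[OF group_G Z_G[OF A]] by (auto simp: torus_centralizer_def)
    qed
  qed
  moreover have "A \<otimes>\<^bsub>N_group\<^esub> B \<otimes>\<^bsub>N_group\<^esub> inv\<^bsub>N_group\<^esub> A \<in> Z" if A: "A \<in> N" and B: "B \<in> Z" for A B
  proof -
    have AG: "A \<in> G" using A by (simp add: torus_normalizer_def)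
    have iA: "invertible A" by (rule inv[OF AG])
    have "conj_by (A ** B ** matrix_inv A) C = C" if C: "C \<in> T" for C
    proof -
      have "conj_by (matrix_inv A) C \<in> T"
        using conj_by_image_matrix_inv[OF iA] A C by (auto simp: torus_normalizer_def)
      then have "conj_by B (conj_by (matrix_inv A) C) = conj_by (matrix_inv A) C" by (rule Z_conj[OF B])
      then show ?thesis
        using conj_by_inverse(2)[OF iA, of C]
        by (simp add: conj_by_mult_left invertible_mult invertible_matrix_inv iA inv[OF Z_G[OF B]])
    qed
    then show ?thesis
      using AG Z_G[OF B] matrix_groupD(2,4)[OF group_G] inv_N[OF A] by (simp add: torus_centralizer_def GL_def)
  qed
  ultimately show ?thesis
    using group.normal_inv_iff[OF group_N] by simp
qed

lemma group_weyl: "group (weyl_group G T)"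
  unfolding weyl_group_def by (rule normal.factorgroup_is_group[OF normal_Z])

lemma weyl_rep_normalizes:
  assumes w: "w \<in> carrier (weyl_group G T)"
  shows "weyl_rep w \<in> N" "w = Z #>\<^bsub>N_group\<^esub> weyl_rep w"
proof -
  interpret normal Z N_group by (rule normal_Z)
  from w obtain g where g: "g \<in> N" "w = Z #>\<^bsub>N_group\<^esub> g"
    by (auto simp: weyl_group_def FactGroup_def RCOSETS_def)
  have "g \<in> w" using g rcos_self[of g] is_subgroup by simp
  then have rep: "weyl_rep w \<in> w" unfolding weyl_rep_def by (rule someI)
  then show 2: "w = Z #>\<^bsub>N_group\<^esub> weyl_rep w"
    using repr_independence[of "weyl_rep w" Z g] g is_subgroup by simp
  show "weyl_rep w \<in> N" using rep g r_coset_subset_G[OF subset, of g] by auto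
qed

lemma weyl_power_eq_one_iff:
  assumes w: "w \<in> carrier (weyl_group G T)"
  shows "w [^]\<^bsub>weyl_group G T\<^esub> (m::nat) = \<one>\<^bsub>weyl_group G T\<^esub> \<longleftrightarrow>
    (\<forall>A\<in>T. (conj_by (weyl_rep w) ^^ m) A = A)"
    and "((\<forall>A\<in>T. (conj_by (weyl_rep w) ^^ m) A = A) \<longleftrightarrow> group.ord (weyl_group G T) w dvd m)"
    and "\<exists>h\<in>G. \<forall>X. conj_by h X = (conj_by (weyl_rep w) ^^ m) X"
proof -
  interpret normal Z N_group by (rule normal_Z)
  define g where "g = weyl_rep w"
  have g: "g \<in> N" "w = Z #>\<^bsub>N_group\<^esub> g" using weyl_rep_normalizes[OF w] by (auto simp: g_def)
  let ?h = "g [^]\<^bsub>N_group\<^esub> m"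
  have hN: "g [^]\<^bsub>N_group\<^esub> k \<in> N" for k :: nat using g(1) group.is_monoid[OF group_N] monoid.nat_pow_closed[of N_group g k] by simp
  then have hG: "?h \<in> G" by (simp add: torus_normalizer_def)
  have conj: "conj_by (g [^]\<^bsub>N_group\<^esub> k) X = (conj_by g ^^ k) X" for k :: nat and X
  proof (induction k arbitrary: X)
    case 0
    then show ?case by (simp add: GL_def conj_by_def matrix_inv_unique_right(2)[of "mat 1" "mat 1"])
  next
    case (Suc k)
    have "g [^]\<^bsub>N_group\<^esub> Suc k = (g [^]\<^bsub>N_group\<^esub> k) ** g" by (simp add: GL_def)
    then have "conj_by (g [^]\<^bsub>N_group\<^esub> Suc k) X = conj_by (g [^]\<^bsub>N_group\<^esub> k) (conj_by g X)"
      using conj_by_mult_left[of "g [^]\<^bsub>N_group\<^esub> k" g] matrix_groupD(3)[OF matrix_group_N] hN g(1) by simp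
    then show ?case using Suc.IH by (simp add: funpow_swap1)
  qed
  have "w [^]\<^bsub>weyl_group G T\<^esub> m = Z #>\<^bsub>N_group\<^esub> ?h"
    unfolding weyl_group_def g(2)
    by (rule hom_nat_pow[OF r_coset_hom_Mod _ group_N factorgroup_is_group, symmetric]) (simp add: g(1))
  then have "w [^]\<^bsub>weyl_group G T\<^esub> m = \<one>\<^bsub>weyl_group G T\<^esub> \<longleftrightarrow> Z #>\<^bsub>N_group\<^esub> ?h = Z"
    by (simp add: weyl_group_def)
  also have "\<dots> \<longleftrightarrow> ?h \<in> Z"
    using coset_join1[of Z ?h] coset_join2[of ?h Z] hN is_subgroup by auto
  also have "\<dots> \<longleftrightarrow> (\<forall>A\<in>T. (conj_by g ^^ m) A = A)"
    using hG by (simp add: torus_centralizer_def conj)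
  finally show 1: "w [^]\<^bsub>weyl_group G T\<^esub> m = \<one>\<^bsub>weyl_group G T\<^esub> \<longleftrightarrow>
    (\<forall>A\<in>T. (conj_by (weyl_rep w) ^^ m) A = A)" by (simp add: g_def)
  show "((\<forall>A\<in>T. (conj_by (weyl_rep w) ^^ m) A = A) \<longleftrightarrow> group.ord (weyl_group G T) w dvd m)"
    using 1 group.pow_eq_id[OF group_weyl w, of m] by simp
  show "\<exists>h\<in>G. \<forall>X. conj_by h X = (conj_by (weyl_rep w) ^^ m) X"
    using hG conj by (auto simp: g_def)
qed

text \<open>The group order function is 0 on elements of infinite order, so finiteness has to be shown: the
  permutation of the coordinates induced by \<open>w\<close> has a finite order, and it determines the action on \<open>T\<close>.\<close>

lemma weyl_ord_pos:
  assumes w: "w \<in> carrier (weyl_group G T)"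
  shows "group.ord (weyl_group G T) w > 0"
proof -
  let ?g = "weyl_rep w"
  have g: "?g \<in> G" "conj_by ?g ` T = T"
    using weyl_rep_normalizes(1)[OF w] by (auto simp: torus_normalizer_def)
  obtain \<sigma> where \<sigma>: "\<And>X i. X \<in> T \<or> X \<in> lie_algebra T \<Longrightarrow> coord (conj_by ?g X) i = coord X (\<sigma> i)" "\<sigma> permutes UNIV"
    by (rule normalizer_permutes_coords[OF g]) blast
  have "permutation \<sigma>" using \<sigma>(2) by (auto simp: permutation_permutes)
  then obtain m where m: "\<sigma> ^^ m = id" "m > 0" by (rule permutation_is_nilpotent)
  have "(conj_by ?g ^^ m) A = A" if A: "A \<in> T" for A
  proof -
    have T: "(conj_by ?g ^^ k) A \<in> T" for k using A g(2) by (induction k) auto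
    have "coord ((conj_by ?g ^^ k) A) i = coord A ((\<sigma> ^^ k) i)" for k i
    proof (induction k arbitrary: i)
      case (Suc k)
      have "coord ((conj_by ?g ^^ Suc k) A) i = coord ((conj_by ?g ^^ k) A) (\<sigma> i)"
        using \<sigma>(1)[of "(conj_by ?g ^^ k) A" i] T[of k] by simp
      also have "\<dots> = coord A ((\<sigma> ^^ Suc k) i)" by (simp add: Suc.IH funpow_swap1)
      finally show ?case .
    qed simp
    then have "coord ((conj_by ?g ^^ m) A) = coord A" using m(1) by (simp add: fun_eq_iff)
    then show ?thesis using from_coords_coord[of "(conj_by ?g ^^ m) A"] from_coords_coord[of A] T A by metis
  qed
  then have "group.ord (weyl_group G T) w dvd m" using weyl_power_eq_one_iff(2)[OF w] by blast
  then show ?thesis using m(2) by (metis dvd_0_left gr0I less_irrefl)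
qed

lemma weyl_ord_dvd_if_fixes_regular:
  assumes w: "w \<in> carrier (weyl_group G T)"
    and u: "u \<in> lie_algebra T" "\<And>\<alpha>. \<alpha> \<in> roots G T \<Longrightarrow> differential T \<alpha> u \<noteq> 0"
    and fix_u: "(conj_by (weyl_rep w) ^^ m) u = u"
  shows "group.ord (weyl_group G T) w dvd m"
proof -
  obtain h where h: "h \<in> G" "\<And>X. conj_by h X = (conj_by (weyl_rep w) ^^ m) X"
    using weyl_power_eq_one_iff(3)[OF w, of m] by blast
  have "\<forall>A\<in>T. (conj_by (weyl_rep w) ^^ m) A = A"
    using centralizer_of_regular[OF u h(1)] h(2) fix_u by auto
  then show ?thesis using weyl_power_eq_one_iff(2)[OF w] by blast
qed

text \<open>An element acts on the Lie algebra of \<open>T\<close> by the differential of its action on \<open>T\<close>, so an element that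
  centralizes \<open>T\<close> fixes the Lie algebra pointwise.\<close>

lemma weyl_power_ord_fixes_lie_T:
  assumes w: "w \<in> carrier (weyl_group G T)" and X: "X \<in> lie_algebra T"
  shows "(conj_by (weyl_rep w) ^^ group.ord (weyl_group G T) w) X = X"
proof -
  let ?l = "group.ord (weyl_group G T) w"
  obtain h where h: "h \<in> G" "\<And>X. conj_by h X = (conj_by (weyl_rep w) ^^ ?l) X"
    using weyl_power_eq_one_iff(3)[OF w, of ?l] by blast
  have "(h ** A ** matrix_inv h) $ i $ j = A $ i $ j" if "A \<in> T" for A i j
    using weyl_power_eq_one_iff(2)[OF w, of ?l] h(2)[of A] that by (simp add: conj_by_def)
  then have "deriv_at (\<lambda>A. (h ** A ** matrix_inv h) $ i $ j) (mat 1) X = deriv_at (\<lambda>A. A $ i $ j) (mat 1) X" for i j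
    by (intro deriv_at_eq_on[OF X] poly_fun_translate[OF poly_fun.coord] poly_fun.coord)
  then have "conj_by h X = X"
    by (simp add: deriv_at_linear_form conj_by_def vec_eq_iff)
  then show ?thesis using h(2) by simp
qed

lemma conj_by_iterate_eigenvector:
  assumes "invertible g" "conj_by g u = smult_mat c u"
  shows "(conj_by g ^^ m) u = smult_mat (c ^ m) u"
proof (induction m)
  case (Suc m)
  have "(conj_by g ^^ Suc m) u = smult_mat (c ^ m) (smult_mat c u)"
    by (simp add: Suc.IH conj_by_smult[OF assms(1)] assms(2))
  then show ?case by (simp add: vec_eq_iff mult_ac)
qed (simp add: vec_eq_iff)

text \<open>This is Springer's theorem on the order of a regular element: \<open>w\<^sup>m\<close> multiplies \<open>u\<close> by \<open>c\<^sup>m\<close>, and it is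
  trivial as soon as it fixes the regular element \<open>u\<close>.\<close>

lemma regular_eigenvalue_primitive:
  assumes w: "w \<in> carrier (weyl_group G T)"
    and u: "u \<in> lie_algebra T" "u \<noteq> 0" "\<And>\<alpha>. \<alpha> \<in> roots G T \<Longrightarrow> differential T \<alpha> u \<noteq> 0"
    and eig: "conj_by (weyl_rep w) u = smult_mat c u"
  shows "primitive_root (group.ord (weyl_group G T) w) c"
proof -
  let ?l = "group.ord (weyl_group G T) w"
  have inv: "invertible (weyl_rep w)"
    by (rule matrix_groupD(3)[OF matrix_group_N weyl_rep_normalizes(1)[OF w]])
  note iter = conj_by_iterate_eigenvector[OF inv eig]
  have fixed_iff: "smult_mat x u = u \<longleftrightarrow> x = 1" for x using u(2) by (auto simp: vec_eq_iff)
  have "c ^ ?l = 1" using weyl_power_ord_fixes_lie_T[OF w u(1)] by (simp only: iter fixed_iff)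
  moreover have "?l dvd m" if "c ^ m = 1" for m
    using that by (intro weyl_ord_dvd_if_fixes_regular[OF w u(1,3)]) (simp_all only: iter fixed_iff)
  ultimately have "c ^ m = 1 \<longleftrightarrow> ?l dvd m" for m by (auto simp: dvd_def power_mult)
  then show ?thesis using weyl_ord_pos[OF w] by (simp add: primitive_root_def)
qed

text \<open>The element \<open>w\<close> permutes the coordinates and roots are differences of coordinates.  So an
  additive map \<open>\<Phi>\<close> with \<open>\<Phi>(c y) = c' \<Phi>(y)\<close>, applied to all coordinates of \<open>u\<close>, yields an eigenvector with
  eigenvalue \<open>c'\<close>, and it is regular if \<open>\<Phi>\<close> does not vanish on the values of the roots at \<open>u\<close>.\<close>

lemma regular_eigenvector_conjugate:
  assumes w: "w \<in> carrier (weyl_group G T)"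
    and u: "u \<in> lie_algebra T" "\<And>\<alpha>. \<alpha> \<in> roots G T \<Longrightarrow> differential T \<alpha> u \<noteq> 0"
    and eig: "conj_by (weyl_rep w) u = smult_mat c u"
    and c: "primitive_root b c" and c': "primitive_root b c'"
  obtains v where "v \<in> lie_algebra T" "\<And>\<alpha>. \<alpha> \<in> roots G T \<Longrightarrow> differential T \<alpha> v \<noteq> 0"
    "conj_by (weyl_rep w) v = smult_mat c' v"
proof -
  let ?g = "weyl_rep w"
  have g: "?g \<in> G" "conj_by ?g ` T = T"
    using weyl_rep_normalizes(1)[OF w] by (auto simp: torus_normalizer_def)
  obtain \<sigma> where \<sigma>: "\<And>X i. X \<in> T \<or> X \<in> lie_algebra T \<Longrightarrow> coord (conj_by ?g X) i = coord X (\<sigma> i)"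
    and lie: "\<And>X. X \<in> lie_algebra T \<Longrightarrow> conj_by ?g X \<in> lie_algebra T"
    by (rule normalizer_permutes_coords[OF g]) blast
  define D where "D = range (\<lambda>(p, q). coord u p - coord u q) - {0}"
  have "finite D" "0 \<notin> D" by (auto simp: D_def)
  then obtain \<Phi> :: "'k \<Rightarrow> 'k" where \<Phi>: "\<And>x y. \<Phi> (x + y) = \<Phi> x + \<Phi> y" "\<And>y. \<Phi> (c * y) = c' * \<Phi> y"
    "\<And>d. d \<in> D \<Longrightarrow> \<Phi> d \<noteq> 0"
    using exists_equivariant_additive_nonvanishing[OF c c'] by blast
  define v where "v = from_coords (\<lambda>i. \<Phi> (coord u i))"
  have v: "v \<in> lie_algebra T" unfolding v_def by (rule additive_map_preserves_lie_T[OF \<Phi>(1) u(1)])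
  have cv: "coord v i = \<Phi> (coord u i)" for i by (simp add: v_def)
  show ?thesis
  proof (rule that[OF v])
    fix \<alpha> assume \<alpha>: "\<alpha> \<in> roots G T"
    obtain p q where pq: "\<alpha> = coord_ratio p q" by (rule root_is_coord_ratio[OF \<alpha>])
    have "coord u p - coord u q \<noteq> 0" using u(2)[OF \<alpha>] coord_ratio_character(2)[OF u(1)] by (simp add: pq)
    then have "coord u p - coord u q \<in> D" by (auto simp: D_def)
    moreover have "\<Phi> (coord u p) = \<Phi> (coord u p - coord u q) + \<Phi> (coord u q)"
      using \<Phi>(1)[of "coord u p - coord u q" "coord u q"] by simp
    ultimately show "differential T \<alpha> v \<noteq> 0"
      using \<Phi>(3) coord_ratio_character(2)[OF v] by (simp add: pq cv)
  next
    have "coord (conj_by ?g v) i = coord (smult_mat c' v) i" for i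
    proof -
      have "coord u (\<sigma> i) = c * coord u i" using \<sigma>[of u i] u(1) eig by simp
      then show ?thesis using \<sigma>[of v i] v \<Phi>(2) by (simp add: cv)
    qed
    then show "conj_by ?g v = smult_mat c' v"
      by (intro lie_T_eqI lie v lie_algebra_closed(3)) auto
  qed
qed

end

section \<open>Coefficients of elements over the power series ring\<close>

definition coeff_mat :: "'k::field fps ^ 'n ^ 'n \<Rightarrow> nat \<Rightarrow> 'k ^ 'n ^ 'n" where
  "coeff_mat U m = map_matrix (\<lambda>f. fps_nth f m) U"

lemma coeff_mat_nth [simp]: "coeff_mat U m $ i $ j = fps_nth (U $ i $ j) m"
  by (simp add: coeff_mat_def)

lemma coeff_mat_eqI: "(\<And>m. coeff_mat U m = coeff_mat V m) \<Longrightarrow> U = V"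
  by (simp add: vec_eq_iff fps_eq_iff)

lemma coeff_mat_lie_algebra:
  fixes U :: "'k::field_char_0 fps ^ 'n ^ 'n"
  assumes "U \<in> extend_scalars (lie_algebra T)"
  shows "coeff_mat U m \<in> lie_algebra T"
proof -
  from assms obtain S c where S: "S \<subseteq> lie_algebra T"
    and U: "U = (\<Sum>X\<in>S. smult_mat (c X) (map_matrix fps_const X))" by (auto simp: extend_scalars_def)
  have "coeff_mat U m = (\<Sum>X\<in>S. smult_mat (fps_nth (c X) m) X)"
    by (simp add: U vec_eq_iff fps_sum_nth)
  then show ?thesis using S lie_algebra_lincomb[of S "\<lambda>X. X" T "\<lambda>X. fps_nth (c X) m"] by auto
qed

text \<open>Coefficientwise, \<open>\<tau>\<^sub>E\<close> is the multiplication by \<open>z\<^sup>m\<close>; so the fixed point condition becomes an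
  eigenvector condition on each coefficient.\<close>

lemma coeff_mat_twisted_action:
  fixes U :: "'k::field fps ^ 'n ^ 'n"
  shows "coeff_mat (weyl_act_E w (map_matrix (tau_E z) U)) m =
    conj_by (weyl_rep w) (smult_mat (z ^ m) (coeff_mat U m))"
  by (simp add: vec_eq_iff weyl_act_E_def conj_by_def matrix_matrix_mult_def tau_E_def fps_sum_nth)

lemma fps_nth_extend_functional: "fps_nth (extend_functional \<phi> U) m = \<phi> (coeff_mat U m)"
  by (simp add: extend_functional_def coeff_mat_def)

lemma compatible_roots_primitive:
  assumes "compatible_roots_of_unity \<zeta>" "l > 0" shows "primitive_root l (\<zeta> l)"
proof -
  have l: "\<zeta> l ^ l = 1" "\<And>j. 0 < j \<Longrightarrow> j < l \<Longrightarrow> \<zeta> l ^ j \<noteq> 1"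
    using assms by (auto simp: compatible_roots_of_unity_def)
  have mod: "\<zeta> l ^ m = \<zeta> l ^ (m mod l)" for m
  proof -
    have "\<zeta> l ^ m = (\<zeta> l ^ l) ^ (m div l) * \<zeta> l ^ (m mod l)"
      by (simp flip: power_mult power_add)
    then show ?thesis by (simp add: l(1))
  qed
  have "\<zeta> l ^ m = 1 \<longleftrightarrow> l dvd m" for m
    unfolding mod[of m] using l(2)[of "m mod l"] assms(2) by (cases "m mod l = 0") (auto simp: dvd_eq_mod_eq_0)
  then show ?thesis using assms(2) by (simp add: primitive_root_def)
qed

lemma primitive_root_coprime_power:
  assumes "primitive_root b c" "coprime a b" shows "primitive_root b (c ^ a)"
proof -
  have "b dvd a * m \<longleftrightarrow> b dvd m" for m
    using assms(2) by (simp add: coprime_dvd_mult_right_iff coprime_commute)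
  then show ?thesis using assms(1) by (simp add: primitive_root_def flip: power_mult)
qed

section \<open>The strata of constant valuation\<close>

theorem proposition4p9p1:
  fixes G T :: "('k::{alg_closed_field, field_char_0} ^ 'n ^ 'n) set"
    and w :: "('k ^ 'n ^ 'n) set"
    and \<zeta> :: "nat \<Rightarrow> 'k"
    and r :: "('k ^ 'n ^ 'n \<Rightarrow> 'k) \<Rightarrow> rat"
    and a b :: nat
  assumes "connected_reductive G"
    and "maximal_torus T G"
    and "roots G T \<noteq> {}"
    and "compatible_roots_of_unity \<zeta>"
    and "b > 0" and "coprime a b"
    and "\<forall>\<alpha> \<in> roots G T. r \<alpha> = of_nat a / of_nat b"
    and "w \<in> carrier (weyl_group G T)"
  shows "t_w_stratum \<zeta> G T w r \<noteq> {} \<longleftrightarrow>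
    springer_regular G T w \<and> group.ord (weyl_group G T) w = b"
proof -
  note w = \<open>w \<in> carrier (weyl_group G T)\<close>
  obtain P where "invertible P" "\<forall>A\<in>T. diagonal_matrix (conj_by P A)"
    using assms(2) by (auto simp: maximal_torus_def torus_def)
  then interpret diagonalized_torus G T P
    using assms(1,2)
    by unfold_locales (auto simp: connected_reductive_def reductive_def algebraic_group_def
        maximal_torus_def torus_def subgroup_GL_iff)
  let ?g = "weyl_rep w"
  define l where "l = group.ord (weyl_group G T) w"
  define z where "z = \<zeta> l"
  have l: "l > 0" unfolding l_def by (rule weyl_ord_pos[OF w])
  have z: "primitive_root l z" unfolding z_def by (rule compatible_roots_primitive[OF assms(4) l])
  have zl: "z ^ l = 1" using z by (simp add: primitive_root_def)
  then have z0: "z \<noteq> 0" using l by (auto simp: power_0_left)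
  have g: "invertible ?g"
    by (rule matrix_groupD(3)[OF matrix_group_N weyl_rep_normalizes(1)[OF w]])
  have diff_0: "differential T \<alpha> 0 = 0" if \<alpha>: "\<alpha> \<in> roots G T" for \<alpha>
  proof -
    obtain p q where "\<alpha> = coord_ratio p q" by (rule root_is_coord_ratio[OF \<alpha>])
    then show ?thesis using coord_ratio_character(2)[OF lie_algebra_closed(1)]
      by (simp add: coord_def conj_by_def)
  qed
  have smult_1: "smult_mat x (smult_mat y X) = X" if "x * y = 1" for x y and X :: "'k ^ 'n ^ 'n"
    using that by (simp add: vec_eq_iff flip: mult.assoc)
  obtain \<alpha>\<^sub>0 where \<alpha>\<^sub>0: "\<alpha>\<^sub>0 \<in> roots G T" using assms(3) by blast
  show ?thesis
  proof
    assume "t_w_stratum \<zeta> G T w r \<noteq> {}"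
    then obtain U where U: "U \<in> extend_scalars (lie_algebra T)"
      "weyl_act_E w (map_matrix (tau_E z) U) = U"
      and val: "\<And>\<alpha>. \<alpha> \<in> roots G T \<Longrightarrow>
        val_E l (extend_functional (differential T \<alpha>) U) = ereal (of_rat (of_nat a / of_nat b))"
      using assms(7) by (auto simp: t_w_stratum_def t_w_def l_def z_def)
    \<comment> \<open>The position of the leading coefficient; it is the same for all roots, as \<open>j b = l a\<close>.\<close>
    define j where "j = subdegree (extend_functional (differential T \<alpha>\<^sub>0) U)"
    have sub: "extend_functional (differential T \<alpha>) U \<noteq> 0 \<and>
        subdegree (extend_functional (differential T \<alpha>) U) * b = l * a" if "\<alpha> \<in> roots G T" for \<alpha>
    proof -
      let ?f = "extend_functional (differential T \<alpha>) U"
      have f: "?f \<noteq> 0" using val[OF that] by (auto simp: val_E_def)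
      then have "real (subdegree ?f) / real l = real a / real b"
        using val[OF that] by (simp add: val_E_def of_rat_divide)
      then have "real (subdegree ?f * b) = real (l * a)" using l assms(5) by (simp add: field_simps)
      then have "subdegree ?f * b = l * a" by (simp only: of_nat_eq_iff)
      then show ?thesis using f by blast
    qed
    have j: "j * b = l * a" using sub[OF \<alpha>\<^sub>0] by (simp add: j_def)
    let ?u = "coeff_mat U j"
    have u: "?u \<in> lie_algebra T" by (rule coeff_mat_lie_algebra[OF U(1)])
    have regular: "differential T \<alpha> ?u \<noteq> 0" if "\<alpha> \<in> roots G T" for \<alpha>
    proof -
      have "subdegree (extend_functional (differential T \<alpha>) U) = j"
        using sub[OF that] j assms(5) by (metis mult_cancel2 not_gr0)
      then show ?thesis
        using sub[OF that] nth_subdegree_nonzero[of "extend_functional (differential T \<alpha>) U"]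
        by (simp add: fps_nth_extend_functional)
    qed
    have u0: "?u \<noteq> 0" using regular[OF \<alpha>\<^sub>0] diff_0[OF \<alpha>\<^sub>0] by auto
    have "smult_mat (z ^ j) (conj_by ?g ?u) = ?u"
      using arg_cong[OF U(2), of "\<lambda>V. coeff_mat V j"] by (simp add: coeff_mat_twisted_action conj_by_smult[OF g])
    then have "smult_mat (inverse (z ^ j)) (smult_mat (z ^ j) (conj_by ?g ?u)) = smult_mat (inverse (z ^ j)) ?u"
      by simp
    then have eig: "conj_by ?g ?u = smult_mat (inverse (z ^ j)) ?u"
      using z0 by (subst (asm) smult_1) simp_all
    have "l dvd b"
    proof -
      have "inverse (z ^ j) ^ b = 1"
        using zl by (simp add: power_inverse j power_mult flip: power_mult[of z j b])
      then show ?thesis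
        using regular_eigenvalue_primitive[OF w u u0 regular eig] by (simp add: primitive_root_def l_def)
    qed
    moreover have "b dvd l"
    proof -
      have "b dvd l * a" using j by (metis dvd_triv_right)
      then show ?thesis using assms(6) by (simp add: coprime_dvd_mult_left_iff coprime_commute)
    qed
    ultimately have "l = b" by (rule dvd_antisym)
    moreover have "springer_regular G T w"
      unfolding springer_regular_def weyl_act_def using u u0 eig regular by blast
    ultimately show "springer_regular G T w \<and> group.ord (weyl_group G T) w = b" by (simp add: l_def)
  next
    assume "springer_regular G T w \<and> group.ord (weyl_group G T) w = b"
    then have lb: "l = b" and "springer_regular G T w" by (simp_all add: l_def)
    then obtain u c where u: "u \<in> lie_algebra T" "u \<noteq> 0"
      "\<And>\<alpha>. \<alpha> \<in> roots G T \<Longrightarrow> differential T \<alpha> u \<noteq> 0"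
      and eig: "conj_by ?g u = smult_mat c u"
      by (auto simp: springer_regular_def weyl_act_def)
    have c: "primitive_root b c"
      using regular_eigenvalue_primitive[OF w u eig] lb by (simp add: l_def)
    have c': "primitive_root b (inverse (z ^ a))"
      using z lb assms(6) by (intro primitive_root_inverse primitive_root_coprime_power) simp_all
    obtain v where v: "v \<in> lie_algebra T" "\<And>\<alpha>. \<alpha> \<in> roots G T \<Longrightarrow> differential T \<alpha> v \<noteq> 0"
      "conj_by ?g v = smult_mat (inverse (z ^ a)) v"
      using regular_eigenvector_conjugate[OF w u(1,3) eig c c'] by blast
    define U where "U = smult_mat (fps_X ^ a) (map_matrix fps_const v)"
    have coeff: "coeff_mat U m = (if m = a then v else 0)" for m
      by (simp add: U_def vec_eq_iff fps_X_power_mult_nth)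
    have "U \<in> extend_scalars (lie_algebra T)"
      unfolding extend_scalars_def U_def using v(1)
      by (intro CollectI exI[of _ "{v}"] exI[of _ "\<lambda>_. fps_X ^ a"]) simp
    moreover have "weyl_act_E w (map_matrix (tau_E z) U) = U"
    proof (rule coeff_mat_eqI)
      fix m
      show "coeff_mat (weyl_act_E w (map_matrix (tau_E z) U)) m = coeff_mat U m"
      proof (cases "m = a")
        case True
        then show ?thesis
          using z0 by (simp add: coeff_mat_twisted_action coeff conj_by_smult[OF g] v(3) smult_1)
      next
        case False
        have "smult_mat (z ^ m) (0 :: 'k ^ 'n ^ 'n) = 0" by (simp add: vec_eq_iff)
        then show ?thesis using False by (simp add: coeff_mat_twisted_action coeff conj_by_def)
      qed
    qed
    moreover have "val_E l (extend_functional (differential T \<alpha>) U) = ereal (of_rat (r \<alpha>))"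
      if \<alpha>: "\<alpha> \<in> roots G T" for \<alpha>
    proof -
      let ?f = "extend_functional (differential T \<alpha>) U"
      have nth: "fps_nth ?f m = (if m = a then differential T \<alpha> v else 0)" for m
        by (simp add: fps_nth_extend_functional coeff diff_0[OF \<alpha>])
      then have "subdegree ?f = a" using v(2)[OF \<alpha>] by (intro subdegreeI) simp_all
      moreover have "?f \<noteq> 0" using nth[of a] v(2)[OF \<alpha>] by auto
      ultimately show ?thesis using assms(7) \<alpha> lb by (simp add: val_E_def of_rat_divide)
    qed
    ultimately have "U \<in> t_w_stratum \<zeta> G T w r"
      by (simp add: t_w_stratum_def t_w_def l_def z_def)
    then show "t_w_stratum \<zeta> G T w r \<noteq> {}" by blast
  qed
qed

end
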